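(* Let $\Bbbk$ be an algebraically closed field of characteristic $0$, let $d\ge 2$ be an integer, and let $X\subset\mathbb{P}^{n+e}_{\Bbbk}$ be an algebraic set of dimension $n$ and codimension $e\ge1$ satisfying condition $\mathrm{ND}(d-1)$. If $X$ has property $\mathbf{N}_{d,e}$, then $X$ is $d$-regular; more precisely, $X$ is arithmetically Cohen-Macaulay with $d$-linear resolution.
   Context: An algebraic set is a reduced closed subscheme $X\subset\mathbb{P}^N$ ($N=n+e$), possibly reducible and not equidimensional. Let $R=\Bbbk[x_0,\dots,x_N]$ and $I_X=\bigoplus_{m\ge0}H^0(\mathcal{I}_{X/\mathbb{P}^N}(m))\subset R$, the saturated defining ideal. Graded Betti numbers: $\beta_{i,j}(X):=\dim_{\Bbbk}\operatorname{Tor}^R_i(R/I_X,\Bbbk)_{i+j}$. Property $\mathbf{N}_{d,p}$ ($d\ge2$, $p\ge1$): $\beta_{i,j}(X)=0$ for all $i\le p$ and all $j\ge d$. Condition $\mathrm{ND}(\ell)$: a closed subscheme $X\subset\mathbb{P}^N$ of codimension $e$ satisfies condition $\mathrm{ND}(\ell)$ if for each dimension $m$ with $e\le m\le N$ and a general linear subspace $\Lambda\subset\mathbb{P}^N$ of dimension $m$ one has $H^0(\mathcal{I}_{X\cap\Lambda/\Lambda}(\ell))=0$. $X$ is $d$-regular if $I_X$ is $d$-regular in the sense of Castelnuovo-Mumford, i.e. $\beta_{i,j}(X)=0$ for all $i$ and all $j\ge d$. $X$ is arithmetically Cohen-Macaulay if $\operatorname{depth}(R/I_X)=\dim X+1$.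 $X$ has $d$-linear resolution if $\beta_{i,j}(X)=0$ for all $i\ge1$ and $j\ne d-1$. *)

theory Defs
  imports
    "HOL-Computational_Algebra.Polynomial"
    "HOL-Library.Poly_Mapping"
    "HOL-Library.Function_Algebras"
    "HOL-Library.Extended_Nat"
begin

section \<open>Coordinate vectors and polynomials\<close>

text \<open>
  All coordinate spaces live inside functions: \<open>\<k>\<^sup>N\<^sup>+\<^sup>1\<close> is the set of functions
  \<open>nat \<Rightarrow> \<k>\<close> that vanish beyond \<open>N\<close>, so that the dimension is an ordinary variable.
\<close>

definition scale_vec :: "'k::field \<Rightarrow> ('v \<Rightarrow> 'k) \<Rightarrow> 'v \<Rightarrow> 'k" where
  "scale_vec c v = (\<lambda>i. c * v i)"

interpretation vec: vector_space "scale_vec :: 'k::field \<Rightarrow> ('v \<Rightarrow> 'k) \<Rightarrow> 'v \<Rightarrow> 'k"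
  by unfold_locales (auto simp: scale_vec_def fun_eq_iff algebra_simps)

definition coords :: "nat \<Rightarrow> (nat \<Rightarrow> 'k::field) set" where
  "coords N = {v. \<forall>i>N. v i = 0}"

text \<open>A polynomial maps each monomial (an exponent vector) to its coefficient.\<close>

type_synonym ('v, 'k) mpoly = "('v \<Rightarrow>\<^sub>0 nat) \<Rightarrow>\<^sub>0 'k"

definition polys :: "'v set \<Rightarrow> ('v, 'k::field) mpoly set" where
  "polys V = {p. \<forall>m\<in>Poly_Mapping.keys p. Poly_Mapping.keys m \<subseteq> V}"

definition mpoly_eval :: "('v, 'k::field) mpoly \<Rightarrow> ('v \<Rightarrow> 'k) \<Rightarrow> 'k" where
  "mpoly_eval p v = (\<Sum>m\<in>Poly_Mapping.keys p. Poly_Mapping.lookup p m *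
                 (\<Prod>i\<in>Poly_Mapping.keys m. v i ^ Poly_Mapping.lookup m i))"

definition var :: "'v \<Rightarrow> ('v, 'k::field) mpoly" where
  "var i = Poly_Mapping.single (Poly_Mapping.single i 1) 1"

definition mon_degree :: "('v \<Rightarrow>\<^sub>0 nat) \<Rightarrow> nat" where
  "mon_degree m = (\<Sum>i\<in>Poly_Mapping.keys m. Poly_Mapping.lookup m i)"

text \<open>The ring \<open>R = \<k>[x\<^sub>0,\<dots>,x\<^sub>N]\<close> and its graded pieces \<open>R\<^sub>s\<close>; the degree is an integer, so that
  \<open>R\<^sub>s = 0\<close> for \<open>s < 0\<close>.\<close>

abbreviation (input) polyring :: "nat \<Rightarrow> (nat, 'k::field) mpoly set" where
  "polyring N \<equiv> polys {..N}"

definition forms :: "nat \<Rightarrow> int \<Rightarrow> (nat, 'k::field) mpoly set" where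
  "forms N s = {p \<in> polyring N. \<forall>m\<in>Poly_Mapping.keys p. int (mon_degree m) = s}"

definition is_ideal :: "nat \<Rightarrow> (nat, 'k::field) mpoly set \<Rightarrow> bool" where
  "is_ideal N J \<longleftrightarrow> J \<subseteq> polyring N \<and> 0 \<in> J \<and> (\<forall>p\<in>J. \<forall>q\<in>J. p + q \<in> J) \<and>
     (\<forall>g\<in>polyring N. \<forall>p\<in>J. g * p \<in> J)"

definition ideal_gen :: "nat \<Rightarrow> (nat, 'k::field) mpoly set \<Rightarrow> (nat, 'k) mpoly set" where
  "ideal_gen N S = \<Inter>{J. is_ideal N J \<and> S \<subseteq> J}"

section \<open>Projective space, linear subspaces and algebraic sets\<close>

text \<open>\<open>grass N m\<close> is the Grassmannian of \<open>m\<close>-dimensional linear subspaces of \<open>\<P>\<^sup>N\<close>, each given as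
  the corresponding \<open>(m+1)\<close>-dimensional vector subspace of \<open>\<k>\<^sup>N\<^sup>+\<^sup>1\<close>.\<close>

definition grass :: "nat \<Rightarrow> nat \<Rightarrow> (nat \<Rightarrow> 'k::field) set set" where
  "grass N m = {W. vec.subspace W \<and> W \<subseteq> coords N \<and> vec.dim W = m + 1}"

definition proj_space :: "nat \<Rightarrow> (nat \<Rightarrow> 'k::field) set set" where
  "proj_space N = grass N 0"

definition points_of :: "nat \<Rightarrow> (nat \<Rightarrow> 'k::field) set \<Rightarrow> (nat \<Rightarrow> 'k) set set" where
  "points_of N W = {L \<in> proj_space N. L \<subseteq> W}"

definition vanishes_at :: "(nat, 'k::field) mpoly \<Rightarrow> (nat \<Rightarrow> 'k) set \<Rightarrow> bool" where
  "vanishes_at f L \<longleftrightarrow> (\<forall>v\<in>L. mpoly_eval f v = 0)"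

text \<open>Over an algebraically closed field, a reduced closed subscheme of \<open>\<P>\<^sup>N\<close> is the same as its
  set of closed points, which is a Zariski closed set.\<close>

definition algebraic_set :: "nat \<Rightarrow> (nat \<Rightarrow> 'k::field) set set \<Rightarrow> bool" where
  "algebraic_set N X \<longleftrightarrow> (\<exists>S. S \<subseteq> (\<Union>s. forms N s) \<and>
     X = {L \<in> proj_space N. \<forall>f\<in>S. vanishes_at f L})"

definition irreducible_set :: "nat \<Rightarrow> (nat \<Rightarrow> 'k::field) set set \<Rightarrow> bool" where
  "irreducible_set N Z \<longleftrightarrow> algebraic_set N Z \<and> Z \<noteq> {} \<and>
     (\<forall>A B. algebraic_set N A \<and> algebraic_set N B \<and> Z = A \<union> B \<longrightarrow> Z = A \<or> Z = B)"

definition irreducible_chain :: "nat \<Rightarrow> (nat \<Rightarrow> 'k::field) set set \<Rightarrow> nat \<Rightarrow> bool" where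
  "irreducible_chain N X r \<longleftrightarrow> (\<exists>Z. (\<forall>i\<le>r. irreducible_set N (Z i) \<and> Z i \<subseteq> X) \<and>
     (\<forall>i<r. Z i \<subset> Z (Suc i)))"

text \<open>Krull dimension, as a relation: the empty set has no dimension \<open>r :: nat\<close>.\<close>

definition has_dim :: "nat \<Rightarrow> (nat \<Rightarrow> 'k::field) set set \<Rightarrow> nat \<Rightarrow> bool" where
  "has_dim N X r \<longleftrightarrow> irreducible_chain N X r \<and> (\<forall>q>r. \<not> irreducible_chain N X q)"

text \<open>\<open>H\<^sup>0(\<I>\<^sub>X(s))\<close> for a reduced \<open>X\<close>, and \<open>I\<^sub>X\<close> as the direct sum of these spaces inside \<open>R\<close>.\<close>

definition vanishing_forms :: "nat \<Rightarrow> (nat \<Rightarrow> 'k::field) set set \<Rightarrow> int \<Rightarrow> (nat, 'k) mpoly set" where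
  "vanishing_forms N X s = {f \<in> forms N s. \<forall>L\<in>X. vanishes_at f L}"

definition defining_ideal :: "nat \<Rightarrow> (nat \<Rightarrow> 'k::field) set set \<Rightarrow> (nat, 'k) mpoly set" where
  "defining_ideal N X =
     {p. \<exists>t f. (\<forall>s. f s \<in> vanishing_forms N X (int s)) \<and> p = (\<Sum>s\<le>t. f s)}"

section \<open>Condition ND\<close>

text \<open>
  Forms of degree \<open>l\<close> that are local sections of the ideal sheaf of the subscheme \<open>Proj (R/J)\<close>:
  on the chart \<open>x\<^sub>i \<noteq> 0\<close> the fraction \<open>f / x\<^sub>i\<^sup>l\<close> lies in the degree-zero part of \<open>J\<close> localised at
  \<open>x\<^sub>i\<close> iff \<open>x\<^sub>i\<^sup>k f \<in> J\<close> for some \<open>k\<close>.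
\<close>

definition sheaf_sections :: "nat \<Rightarrow> (nat, 'k::field) mpoly set \<Rightarrow> int \<Rightarrow> (nat, 'k) mpoly set" where
  "sheaf_sections N J l = {f \<in> forms N l. \<forall>i\<le>N. \<exists>k::nat. var i ^ k * f \<in> J}"

text \<open>
  \<open>H\<^sup>0(\<I>(l)) = 0\<close> for the ideal sheaf, in \<open>\<Lambda>\<close>, of the scheme-theoretic intersection of \<open>\<Lambda>\<close> with the
  closed subscheme defined by the ideal \<open>I\<close>. Here \<open>H\<^sup>0(\<O>\<^sub>\<Lambda>(l))\<close> is \<open>R\<^sub>l\<close> modulo the forms vanishing
  on \<open>\<Lambda>\<close>, and the intersection is defined by \<open>I + I\<^sub>\<Lambda>\<close>.
\<close>

definition no_sections_on ::
    "nat \<Rightarrow> (nat, 'k::field) mpoly set \<Rightarrow> int \<Rightarrow> (nat \<Rightarrow> 'k) set \<Rightarrow> bool" where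
  "no_sections_on N I l W \<longleftrightarrow>
     sheaf_sections N (ideal_gen N (I \<union> defining_ideal N (points_of N W))) l
       \<subseteq> defining_ideal N (points_of N W)"

text \<open>
  The Zariski topology on the Grassmannian is the quotient topology from the space of
  \<open>(m+1) \<times> (N+1)\<close> matrices of full rank, which is open in the affine space of all such matrices;
  a matrix is sent to its row space.
\<close>

definition row_space :: "nat \<Rightarrow> nat \<Rightarrow> (nat \<times> nat \<Rightarrow> 'k::field) \<Rightarrow> (nat \<Rightarrow> 'k) set" where
  "row_space N m a = vec.span ((\<lambda>i j. if j \<le> N then a (i, j) else 0) ` {..m})"

definition open_in_grass :: "nat \<Rightarrow> nat \<Rightarrow> (nat \<Rightarrow> 'k::field) set set \<Rightarrow> bool" where
  "open_in_grass N m U \<longleftrightarrow> U \<subseteq> grass N m \<and>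
     (\<exists>S. S \<subseteq> polys ({..m} \<times> {..N}) \<and>
        (\<forall>a. row_space N m a \<in> grass N m \<longrightarrow>
           (row_space N m a \<in> U \<longleftrightarrow> (\<exists>F\<in>S. mpoly_eval F a \<noteq> 0))))"

definition for_general_subspace ::
    "nat \<Rightarrow> nat \<Rightarrow> ((nat \<Rightarrow> 'k::field) set \<Rightarrow> bool) \<Rightarrow> bool" where
  "for_general_subspace N m P \<longleftrightarrow> (\<exists>U. open_in_grass N m U \<and> U \<noteq> {} \<and> (\<forall>W\<in>U. P W))"

definition condition_ND :: "nat \<Rightarrow> nat \<Rightarrow> (nat, 'k::field) mpoly set \<Rightarrow> int \<Rightarrow> bool" where
  "condition_ND N e I l \<longleftrightarrow>
     (\<forall>m. e \<le> m \<and> m \<le> N \<longrightarrow> for_general_subspace N m (no_sections_on N I l))"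

section \<open>Tor and graded Betti numbers\<close>

text \<open>
  A complex of finite graded free modules \<open>\<dots> \<rightarrow> F\<^sub>1 \<rightarrow> F\<^sub>0 \<rightarrow> R/I\<close>: the module \<open>F\<^sub>i\<close> has basis elements
  \<open>b < gen_count i\<close> of degree \<open>gen_degree i b\<close>; \<open>bdry i\<close> is the matrix (row index first) of
  \<open>F\<^sub>i\<^sub>+\<^sub>1 \<rightarrow> F\<^sub>i\<close>; and \<open>aug b\<close> represents the image of the \<open>b\<close>-th basis element of \<open>F\<^sub>0\<close> in \<open>R/I\<close>.
\<close>

record (overloaded) 'k free_complex =
  gen_count :: "nat \<Rightarrow> nat"
  gen_degree :: "nat \<Rightarrow> nat \<Rightarrow> int"
  aug :: "nat \<Rightarrow> (nat, 'k) mpoly"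
  bdry :: "nat \<Rightarrow> nat \<Rightarrow> nat \<Rightarrow> (nat, 'k) mpoly"

definition free_module :: "nat \<Rightarrow> nat \<Rightarrow> (nat \<Rightarrow> (nat, 'k::field) mpoly) set" where
  "free_module N r = {v. (\<forall>b<r. v b \<in> polyring N) \<and> (\<forall>b\<ge>r. v b = 0)}"

definition aug_map ::
    "'k::field free_complex \<Rightarrow> (nat \<Rightarrow> (nat, 'k) mpoly) \<Rightarrow> (nat, 'k) mpoly" where
  "aug_map F v = (\<Sum>b<gen_count F 0. v b * aug F b)"

definition bdry_map ::
    "'k::field free_complex \<Rightarrow> nat \<Rightarrow> (nat \<Rightarrow> (nat, 'k) mpoly) \<Rightarrow> nat \<Rightarrow> (nat, 'k) mpoly" where
  "bdry_map F i v = (\<lambda>a.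
     if a < gen_count F i then \<Sum>b<gen_count F (Suc i). bdry F i a b * v b else 0)"

definition graded_free_resolution ::
    "nat \<Rightarrow> (nat, 'k::field) mpoly set \<Rightarrow> 'k free_complex \<Rightarrow> bool" where
  "graded_free_resolution N I F \<longleftrightarrow>
     (\<forall>b<gen_count F 0. aug F b \<in> forms N (gen_degree F 0 b)) \<and>
     (\<forall>i. \<forall>a<gen_count F i. \<forall>b<gen_count F (Suc i).
        bdry F i a b \<in> forms N (gen_degree F (Suc i) b - gen_degree F i a)) \<and>
     (\<forall>g\<in>polyring N. \<exists>v\<in>free_module N (gen_count F 0). g - aug_map F v \<in> I) \<and>
     {v \<in> free_module N (gen_count F 0). aug_map F v \<in> I}
       = bdry_map F 0 ` free_module N (gen_count F 1) \<and>
     (\<forall>i. {v \<in> free_module N (gen_count F (Suc i)). bdry_map F i v = 0}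
       = bdry_map F (Suc i) ` free_module N (gen_count F (Suc (Suc i))))"

text \<open>
  The complex \<open>F \<otimes>\<^sub>R \<k>\<close> in internal degree \<open>s\<close>, where \<open>\<k> = R/(x\<^sub>0,\<dots>,x\<^sub>N)\<close>: basis elements of degree
  \<open>s\<close> survive and matrix entries are replaced by their constant coefficients.
\<close>

definition tensor_part :: "'k::field free_complex \<Rightarrow> nat \<Rightarrow> int \<Rightarrow> (nat \<Rightarrow> 'k) set" where
  "tensor_part F i s = {v. \<forall>b. v b \<noteq> 0 \<longrightarrow> b < gen_count F i \<and> gen_degree F i b = s}"

definition tensor_bdry :: "'k::field free_complex \<Rightarrow> nat \<Rightarrow> (nat \<Rightarrow> 'k) \<Rightarrow> nat \<Rightarrow> 'k" where
  "tensor_bdry F i v = (\<lambda>a. if a < gen_count F i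
     then \<Sum>b<gen_count F (Suc i). Poly_Mapping.lookup (bdry F i a b) 0 * v b else 0)"

fun tensor_cycles :: "'k::field free_complex \<Rightarrow> nat \<Rightarrow> int \<Rightarrow> (nat \<Rightarrow> 'k) set" where
  "tensor_cycles F 0 s = tensor_part F 0 s"
| "tensor_cycles F (Suc i) s = {v \<in> tensor_part F (Suc i) s. tensor_bdry F i v = 0}"

definition tensor_boundaries :: "'k::field free_complex \<Rightarrow> nat \<Rightarrow> int \<Rightarrow> (nat \<Rightarrow> 'k) set" where
  "tensor_boundaries F i s = tensor_bdry F i ` tensor_part F (Suc i) s"

text \<open>The dimension of \<open>Tor\<^sub>i(R/I, \<k>)\<^sub>s\<close>, the homology of \<open>F \<otimes>\<^sub>R \<k>\<close> for a graded free resolution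
  \<open>F\<close> of \<open>R/I\<close>; it does not depend on the resolution chosen.\<close>

definition tor_dim :: "nat \<Rightarrow> (nat, 'k::field) mpoly set \<Rightarrow> nat \<Rightarrow> int \<Rightarrow> nat" where
  "tor_dim N I i s = (let F = (SOME F. graded_free_resolution N I F) in
     vec.dim (tensor_cycles F i s) - vec.dim (tensor_boundaries F i s))"

definition betti :: "nat \<Rightarrow> (nat \<Rightarrow> 'k::field) set set \<Rightarrow> nat \<Rightarrow> int \<Rightarrow> nat" where
  "betti N X i j = tor_dim N (defining_ideal N X) i (int i + j)"

definition property_N :: "nat \<Rightarrow> (nat \<Rightarrow> 'k::field) set set \<Rightarrow> nat \<Rightarrow> nat \<Rightarrow> bool" where
  "property_N N X d p \<longleftrightarrow> (\<forall>i\<le>p. \<forall>j\<ge>int d. betti N X i j = 0)"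

definition CM_regular :: "nat \<Rightarrow> (nat \<Rightarrow> 'k::field) set set \<Rightarrow> nat \<Rightarrow> bool" where
  "CM_regular N X d \<longleftrightarrow> (\<forall>i. \<forall>j\<ge>int d. betti N X i j = 0)"

definition linear_resolution :: "nat \<Rightarrow> (nat \<Rightarrow> 'k::field) set set \<Rightarrow> nat \<Rightarrow> bool" where
  "linear_resolution N X d \<longleftrightarrow> (\<forall>i\<ge>1. \<forall>j. j \<noteq> int d - 1 \<longrightarrow> betti N X i j = 0)"

section \<open>Depth\<close>

definition regular_sequence ::
    "nat \<Rightarrow> (nat, 'k::field) mpoly set \<Rightarrow> (nat, 'k) mpoly list \<Rightarrow> bool" where
  "regular_sequence N I fs \<longleftrightarrow>
     (\<forall>i<length fs. \<forall>g\<in>polyring N.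
        fs ! i * g \<in> ideal_gen N (I \<union> set (take i fs)) \<longrightarrow>
        g \<in> ideal_gen N (I \<union> set (take i fs))) \<and>
     ideal_gen N (I \<union> set fs) \<noteq> polyring N"

text \<open>Depth of \<open>R/I\<close> with respect to the maximal ideal \<open>(x\<^sub>0,\<dots>,x\<^sub>N)\<close>.\<close>

definition quotient_depth :: "nat \<Rightarrow> (nat, 'k::field) mpoly set \<Rightarrow> enat" where
  "quotient_depth N I = Sup {enat (length fs) | fs.
     set fs \<subseteq> ideal_gen N (var ` {..N}) \<and> regular_sequence N I fs}"

definition arithmetically_CM :: "nat \<Rightarrow> (nat \<Rightarrow> 'k::field) set set \<Rightarrow> bool" where
  "arithmetically_CM N X \<longleftrightarrow>
     (\<exists>r. has_dim N X r \<and> quotient_depth N (defining_ideal N X) = enat (r + 1))"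

end

theory Submission
  imports Defs "HOL-Library.Product_Lexorder"
begin

text \<open>
  Let \<open>R/I\<close> be the coordinate ring of \<open>X\<close>, choose a general linear space \<open>E\<close> of dimension \<open>e - 1\<close>,
  which is disjoint from \<open>X\<close>, and coordinates \<open>y\<^sub>0,\<dots>,y\<^sub>n\<close>, \<open>z\<^sub>1,\<dots>,z\<^sub>e\<close> such that \<open>E\<close> is given by \<open>y = 0\<close>.
  Then \<open>B = R/(I + (y))\<close> has finite length by the Nullstellensatz.

  If \<open>B\<close> were nonzero in a degree \<open>s \<ge> d\<close>, then killing \<open>z\<^sub>1,\<dots>,z\<^sub>e\<close> one after the other and following
  connecting maps would produce from a class in \<open>B\<^sub>s\<close> nonzero classes in \<open>Tor\<^sub>i(R/I, R/(y,z\<^sub>1,\<dots>,z\<^sub>i))\<close>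
  of degree at least \<open>s + i\<close>, and finally one in \<open>Tor\<^sub>e(R/I, \<k>)\<close>, against \<open>N\<^sub>d\<^sub>,\<^sub>e\<close>. So \<open>R/I\<close> is generated
  over \<open>S = \<k>[y]\<close> by the monomials of degree less than \<open>d\<close> in \<open>z\<close>. These monomials are independent over
  \<open>S\<close>: a relation, restricted to the space \<open>\<Lambda>\<close> spanned by \<open>E\<close> and a general point, becomes a power of
  the coordinate \<open>t\<close> of \<open>\<Lambda>\<close> with \<open>y = c t\<close> times a form of degree \<open>d - 1\<close>, and since \<open>t\<close> does not vanish on
  \<open>X \<inter> \<Lambda>\<close>, this form contradicts \<open>ND(d-1)\<close>.

  Hence \<open>R/I\<close> is free over \<open>S\<close>. So \<open>y\<^sub>0,\<dots>,y\<^sub>n\<close> is a regular sequence, which gives the vanishing of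
  \<open>Tor\<^sub>i\<close> for \<open>i > e\<close>, and the lower strands vanish because \<open>I\<close> has no forms of degree less than \<open>d\<close>.
  A longer regular sequence does not exist, because its monomials would be linearly independent in
  \<open>R/I\<close>, more than the growth of \<open>R/I\<close> allows.
\<close>

text \<open>Two demands compete for \<open>E\<close>. It has to miss \<open>X\<close>, and together
  with one more point it has to span a space in the open set that ND provides, which amounts to the
  nonvanishing of one fixed polynomial in the matrix entries. So \<open>E\<close> starts inside a
  space of that open set while \<open>X\<close> is cut down by n + 1 hyperplanes through
  \<open>E\<close>; at every cut, \<open>E\<close> and the hyperplane move in a one-parameter
  family, in which each demand excludes finitely many parameters. The connecting maps can be
  followed because the forms \<open>z\<close> act nilpotently on the Tor modules: a power of each is
  congruent modulo the preceding linear forms to an element of \<open>I\<close>, and elements of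
  \<open>I\<close> act nilpotently there. Multiplying a class by the last power that does not kill
  it raises the degree by an unknown amount, so vanishing is propagated in all degrees above a bound
  at once. No quotient modules are formed: every Tor group is described by vectors over one
  resolution of \<open>R/I\<close>, with equations read modulo the ideal of the linear forms killed
  so far.\<close>

abbreviation lookup where "lookup \<equiv> Poly_Mapping.lookup"
abbreviation keys where "keys \<equiv> Poly_Mapping.keys"
abbreviation single where "single \<equiv> Poly_Mapping.single"

section \<open>Polynomials\<close>

lemma mpoly_as_sum: "p = (\<Sum>m\<in>keys p. single m (lookup p m))"
proof (rule poly_mapping_eqI)
  fix k
  have "lookup (\<Sum>m\<in>keys p. single m (lookup p m)) k = (\<Sum>m\<in>keys p. if m = k then lookup p k else 0)"
    by (auto simp: lookup_sum lookup_single when_def intro!: sum.cong)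
  also have "\<dots> = lookup p k"
    by (simp add: in_keys_iff)
  finally show "lookup p k = lookup (\<Sum>m\<in>keys p. single m (lookup p m)) k" by simp
qed

lemma lookup_single_mult:
  fixes p :: "('v \<Rightarrow>\<^sub>0 nat) \<Rightarrow>\<^sub>0 'k::comm_ring_1"
  shows "lookup (single m c * p) (m + k) = c * lookup p k"
proof -
  have "single m c * p = (\<Sum>k'\<in>keys p. single (m + k') (c * lookup p k'))"
    by (subst mpoly_as_sum) (simp add: sum_distrib_left mult_single)
  then have "lookup (single m c * p) (m + k) = (\<Sum>k'\<in>keys p. if k' = k then c * lookup p k else 0)"
    by (auto simp: lookup_sum lookup_single when_def intro!: sum.cong)
  also have "\<dots> = c * lookup p k"
    by (simp add: in_keys_iff)
  finally show ?thesis .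
qed

lemma keys_single_mult:
  fixes p :: "('v \<Rightarrow>\<^sub>0 nat) \<Rightarrow>\<^sub>0 'k::comm_ring_1"
  shows "keys (single m c * p) \<subseteq> (+) m ` keys p"
  using keys_mult[of "single m c" p] by (auto split: if_splits)

lemma keys_nat_add: "keys (m + k) = keys m \<union> keys (k :: 'v \<Rightarrow>\<^sub>0 nat)"
  by (auto simp: in_keys_iff lookup_add)

definition monv :: "('v \<Rightarrow> 'b::comm_ring_1) \<Rightarrow> ('v \<Rightarrow>\<^sub>0 nat) \<Rightarrow> 'b" where
  "monv l m = (\<Prod>i\<in>keys m. l i ^ lookup m i)"

lemma monv_superset: "finite A \<Longrightarrow> keys m \<subseteq> A \<Longrightarrow> monv l m = (\<Prod>i\<in>A. l i ^ lookup m i)"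
  unfolding monv_def by (rule prod.mono_neutral_left) (auto simp: in_keys_iff)

lemma monv_0 [simp]: "monv l 0 = 1"
  by (simp add: monv_def)

lemma monv_add: "monv l (m + k) = monv l m * monv l k"
  by (simp add: monv_superset[of "keys m \<union> keys k"] lookup_add power_add prod.distrib keys_nat_add)

lemma monv_single [simp]: "monv l (single i j) = l i ^ j"
  by (cases "j = 0") (auto simp: monv_def)

lemma monv_cong: "(\<And>i. i \<in> keys m \<Longrightarrow> l i = l' i) \<Longrightarrow> monv l m = monv l' m"
  unfolding monv_def by (rule prod.cong) auto

definition ring_hom :: "('a::comm_ring_1 \<Rightarrow> 'b::comm_ring_1) \<Rightarrow> bool" where
  "ring_hom h \<longleftrightarrow> h 0 = 0 \<and> h 1 = 1 \<and> (\<forall>a b. h (a + b) = h a + h b) \<and> (\<forall>a b. h (a * b) = h a * h b)"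

lemma ring_hom_sum: "ring_hom h \<Longrightarrow> h (sum f A) = (\<Sum>a\<in>A. h (f a))"
  by (induction A rule: infinite_finite_induct) (auto simp: ring_hom_def)

lemma ring_hom_power: "ring_hom h \<Longrightarrow> h (a ^ n) = h a ^ n"
  by (induction n) (auto simp: ring_hom_def)

lemma ring_hom_prod: "ring_hom h \<Longrightarrow> h (prod f A) = (\<Prod>a\<in>A. h (f a))"
  by (induction A rule: infinite_finite_induct) (auto simp: ring_hom_def)

lemma ring_hom_monv: "ring_hom h \<Longrightarrow> h (monv l m) = monv (h \<circ> l) m"
  by (simp add: monv_def ring_hom_prod ring_hom_power)

text \<open>The coefficient map \<open>h\<close> is a parameter because one formula has to serve
  three purposes: values at a point, restriction to a line with univariate coefficients, and
  substitution of polynomials.\<close>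

definition insertion :: "('a::comm_ring_1 \<Rightarrow> 'b::comm_ring_1) \<Rightarrow> ('v \<Rightarrow> 'b) \<Rightarrow> (('v \<Rightarrow>\<^sub>0 nat) \<Rightarrow>\<^sub>0 'a) \<Rightarrow> 'b"
  where "insertion h l p = (\<Sum>m\<in>keys p. h (lookup p m) * monv l m)"

lemma insertion_superset:
  assumes "ring_hom h" "finite A" "keys p \<subseteq> A"
  shows "insertion h l p = (\<Sum>m\<in>A. h (lookup p m) * monv l m)"
  unfolding insertion_def
  by (rule sum.mono_neutral_left) (use assms in \<open>auto simp: in_keys_iff ring_hom_def\<close>)

lemma insertion_add:
  assumes "ring_hom h"
  shows "insertion h l (p + q) = insertion h l p + insertion h l q"
  using assms keys_add[of p q]
  by (simp add: insertion_superset[of h "keys p \<union> keys q"] lookup_add sum.distrib[symmetric])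
     (auto simp: ring_hom_def algebra_simps intro!: sum.cong)

lemma insertion_single: "ring_hom h \<Longrightarrow> insertion h l (single m c) = h c * monv l m"
  by (cases "c = 0") (auto simp: insertion_def ring_hom_def)

lemma insertion_0 [simp]: "insertion h l 0 = 0"
  by (simp add: insertion_def)

lemma insertion_sum: "ring_hom h \<Longrightarrow> insertion h l (sum f A) = (\<Sum>a\<in>A. insertion h l (f a))"
  by (induction A rule: infinite_finite_induct) (auto simp: insertion_add)

lemma insertion_mult:
  assumes "ring_hom h"
  shows "insertion h l (p * q) = insertion h l p * insertion h l q"
proof -
  have "p * q = (\<Sum>m\<in>keys p. \<Sum>k\<in>keys q. single (m + k) (lookup p m * lookup q k))"
    by (subst mpoly_as_sum[of p], subst mpoly_as_sum[of q])
       (simp add: sum_product mult_single)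
  then have "insertion h l (p * q) =
      (\<Sum>m\<in>keys p. \<Sum>k\<in>keys q. h (lookup p m * lookup q k) * monv l (m + k))"
    using assms by (simp add: insertion_sum insertion_single)
  also have "\<dots> = insertion h l p * insertion h l q"
    using assms by (simp add: insertion_def sum_product monv_add ring_hom_def algebra_simps)
  finally show ?thesis .
qed

lemma ring_hom_insertion: "ring_hom h \<Longrightarrow> ring_hom (insertion h l)"
  using insertion_single[of h l 0 1]
  by (auto simp: ring_hom_def insertion_add insertion_mult)

lemma insertion_var: "ring_hom h \<Longrightarrow> insertion h l (var i) = l i"
  by (simp add: var_def insertion_single) (simp add: ring_hom_def)

lemma ring_hom_id: "ring_hom (\<lambda>c. c)"
  by (simp add: ring_hom_def)

lemma ring_hom_const: "ring_hom (\<lambda>c. single 0 c :: ('v \<Rightarrow>\<^sub>0 nat) \<Rightarrow>\<^sub>0 'k::comm_ring_1)"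
  by (auto simp: ring_hom_def single_add mult_single)

lemma ring_hom_pCons: "ring_hom (\<lambda>c::'k::comm_ring_1. [:c:])"
  by (auto simp: ring_hom_def)

lemma mpoly_eval_insertion: "mpoly_eval p v = insertion (\<lambda>c. c) v p"
  by (simp add: mpoly_eval_def insertion_def monv_def)

lemma ring_hom_eval: "ring_hom (\<lambda>p. mpoly_eval p v)"
  using ring_hom_insertion[OF ring_hom_id, of v] by (simp add: mpoly_eval_insertion[abs_def])

lemma mpoly_eval_simps [simp]:
  "mpoly_eval 0 v = 0" "mpoly_eval 1 v = 1"
  "mpoly_eval (p + q) v = mpoly_eval p v + mpoly_eval q v"
  "mpoly_eval (p * q) v = mpoly_eval p v * mpoly_eval q v"
  "mpoly_eval (single m c) v = c * monv v m"
  "mpoly_eval (var i) v = v i"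
  using ring_hom_eval[of v] insertion_single[OF ring_hom_id, of v m c]
    insertion_var[OF ring_hom_id, of v i]
  by (auto simp: ring_hom_def mpoly_eval_insertion)

lemma mpoly_eval_uminus [simp]: "mpoly_eval (- p) v = - mpoly_eval p v"
  by (metis add_eq_0_iff mpoly_eval_simps(1,3) add.right_inverse)

lemma mpoly_eval_diff [simp]: "mpoly_eval (p - q) v = mpoly_eval p v - mpoly_eval q v"
  by (metis add_uminus_conv_diff mpoly_eval_simps(3) mpoly_eval_uminus)

lemma mpoly_eval_sum [simp]: "mpoly_eval (sum f A) v = (\<Sum>a\<in>A. mpoly_eval (f a) v)"
  by (rule ring_hom_sum[OF ring_hom_eval])

lemma mpoly_eval_power [simp]: "mpoly_eval (p ^ n) v = mpoly_eval p v ^ n"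
  by (rule ring_hom_power[OF ring_hom_eval])

lemma ring_hom_comp_insertion:
  assumes "ring_hom g" "ring_hom h"
  shows "g (insertion h l p) = insertion (g \<circ> h) (g \<circ> l) p"
  using assms by (simp add: insertion_def ring_hom_sum ring_hom_monv) (simp add: ring_hom_def ring_hom_monv[OF assms(1), symmetric])

lemma insertion_cong:
  assumes "p \<in> polys V" "\<And>i. i \<in> V \<Longrightarrow> l i = l' i"
  shows "insertion h l p = insertion h l' p"
  unfolding insertion_def
proof (rule sum.cong[OF refl])
  fix m assume "m \<in> keys p"
  then have "keys m \<subseteq> V" using assms(1) by (auto simp: polys_def)
  then have "monv l m = monv l' m" using assms(2) by (intro monv_cong) auto
  then show "h (lookup p m) * monv l m = h (lookup p m) * monv l' m" by simp
qed

definition subst_poly :: "('v \<Rightarrow> ('w, 'k::field) mpoly) \<Rightarrow> ('v, 'k) mpoly \<Rightarrow> ('w, 'k) mpoly" where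
  "subst_poly l = insertion (single 0) l"

lemma ring_hom_subst_poly: "ring_hom (subst_poly l)"
  unfolding subst_poly_def by (rule ring_hom_insertion[OF ring_hom_const])

lemma mpoly_eval_subst_poly: "mpoly_eval (subst_poly l p) v = mpoly_eval p (\<lambda>i. mpoly_eval (l i) v)"
  unfolding subst_poly_def mpoly_eval_insertion[of p]
  using ring_hom_comp_insertion[OF ring_hom_eval ring_hom_const, where p = p and l = l] by (simp add: comp_def)

text \<open>On a line, an open condition becomes the nonvanishing of a univariate polynomial, so it
  fails at finitely many parameters only, provided that it holds somewhere on the line.\<close>

lemma mpoly_eval_on_line:
  "\<exists>P :: 'k::field poly. \<forall>s. poly P s = mpoly_eval p (\<lambda>i. a i + s * u i)"
proof (intro exI allI)
  fix s
  have "ring_hom (\<lambda>q::'k poly. poly q s)" by (simp add: ring_hom_def)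
  from ring_hom_comp_insertion[OF this ring_hom_pCons, where l = "\<lambda>i. [:a i, u i:]" and p = p]
  show "poly (insertion (\<lambda>c. [:c:]) (\<lambda>i. [:a i, u i:]) p) s = mpoly_eval p (\<lambda>i. a i + s * u i)"
    by (simp add: comp_def mpoly_eval_insertion mult.commute)
qed

lemma infinite_field_nonroots:
  fixes S :: "'k::field_char_0 poly set"
  assumes "finite S" "0 \<notin> S"
  obtains s where "\<And>P. P \<in> S \<Longrightarrow> poly P s \<noteq> 0"
proof -
  have "finite (\<Union>P\<in>S. {s. poly P s = 0})"
    using assms by (auto intro!: poly_roots_finite)
  then obtain s where "s \<notin> (\<Union>P\<in>S. {s. poly P s = 0})"
    using ex_new_if_finite[OF infinite_UNIV_char_0] by blast
  then show thesis using that by auto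
qed

text \<open>The restriction of \<open>p\<close> to the line is nonzero at parameter 0 and that of
  \<open>q\<close> at parameter 1, so some parameter avoids the roots of both.\<close>

lemma common_nonzero_point:
  fixes p q :: "('v, 'k::field_char_0) mpoly"
  assumes "mpoly_eval p a \<noteq> 0" "mpoly_eval q b \<noteq> 0"
  obtains s where "mpoly_eval p (\<lambda>i. a i + s * (b i - a i)) \<noteq> 0"
    "mpoly_eval q (\<lambda>i. a i + s * (b i - a i)) \<noteq> 0"
proof -
  obtain P where P: "\<And>s. poly P s = mpoly_eval p (\<lambda>i. a i + s * (b i - a i))"
    using mpoly_eval_on_line[of p a "\<lambda>i. b i - a i"] by auto
  obtain Q where Q: "\<And>s. poly Q s = mpoly_eval q (\<lambda>i. a i + s * (b i - a i))"
    using mpoly_eval_on_line[of q a "\<lambda>i. b i - a i"] by auto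
  have "P \<noteq> 0" using P[of 0] assms(1) by auto
  moreover have "Q \<noteq> 0" using Q[of 1] assms(2) by auto
  ultimately obtain s where "\<And>R. R \<in> {P, Q} \<Longrightarrow> poly R s \<noteq> 0"
    using infinite_field_nonroots[of "{P, Q}"] by auto
  then have "poly P s \<noteq> 0" "poly Q s \<noteq> 0" by blast+
  then show thesis using that[of s] P Q by auto
qed

text \<open>Induction on the set of variables: with the other variables fixed, the sum is a
  univariate polynomial in \<open>x\<close> with infinitely many roots, and its coefficient at the
  exponent of \<open>x\<close> in \<open>m\<close> is a relation between monomials in fewer
  variables.\<close>

lemma monomials_independent:
  fixes c :: "('v \<Rightarrow>\<^sub>0 nat) \<Rightarrow> 'k::field_char_0"
  assumes "finite V" "finite K" "\<And>m. m \<in> K \<Longrightarrow> keys m \<subseteq> V"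
    and "\<And>v. (\<Sum>m\<in>K. c m * monv v m) = 0"
  shows "m \<in> K \<Longrightarrow> c m = 0"
  using assms
proof (induction V arbitrary: K c m rule: finite_induct)
  case empty
  then have "K \<subseteq> {0}" by (force simp: keys_eq_empty)
  with empty have "K = {0}" "m = 0" by auto
  then show ?case using empty(4)[of undefined] by simp
next
  case (insert x V)
  define rm where "rm m = Poly_Mapping.update x 0 m" for m :: "'v \<Rightarrow>\<^sub>0 nat"
  have rm: "m = rm m + single x (lookup m x)" for m
    by (rule poly_mapping_eqI) (auto simp: rm_def lookup_update lookup_add lookup_single when_def)
  have key_rm: "keys (rm m) = keys m - {x}" for m
    by (auto simp: rm_def in_keys_iff lookup_update split: if_splits)
  define K' where "K' = {m'\<in>K. lookup m' x = lookup m x}"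
  have inj: "inj_on rm K'"
    by (intro inj_onI) (metis (mono_tags, lifting) K'_def mem_Collect_eq rm)
  have "(\<Sum>m'\<in>rm ` K'. c (m' + single x (lookup m x)) * monv v m') = 0" for v
  proof -
    define P where "P = (\<Sum>m'\<in>K. monom (c m' * monv v (rm m')) (lookup m' x))"
    have "poly P t = 0" for t
    proof -
      have "monv (v(x := t)) m' = monv v (rm m') * t ^ lookup m' x" for m'
      proof -
        have "monv (v(x := t)) (rm m') = monv v (rm m')"
          by (rule monv_cong) (auto simp: key_rm)
        then show ?thesis by (subst rm) (simp add: monv_add)
      qed
      then have "poly P t = (\<Sum>m'\<in>K. c m' * monv (v(x := t)) m')"
        by (simp add: P_def poly_sum poly_monom mult.assoc)
      then show ?thesis using insert.prems(4) by simp
    qed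
    then have "P = 0" using poly_all_0_iff_0 by blast
    then have "0 = coeff P (lookup m x)" by simp
    also have "\<dots> = (\<Sum>m'\<in>K. if lookup m' x = lookup m x then c m' * monv v (rm m') else 0)"
      unfolding P_def coeff_sum by (rule sum.cong) auto
    also have "\<dots> = (\<Sum>m'\<in>K'. c m' * monv v (rm m'))"
      unfolding K'_def using insert.prems(2) by (simp add: sum.inter_filter)
    also have "\<dots> = (\<Sum>m'\<in>K'. c (rm m' + single x (lookup m x)) * monv v (rm m'))"
      
    proof (rule sum.cong[OF refl])
      fix a assume "a \<in> K'"
      then have "lookup a x = lookup m x" by (simp add: K'_def)
      then have "rm a + single x (lookup m x) = a" using rm[of a] by metis
      then show "c a * monv v (rm a) = c (rm a + single x (lookup m x)) * monv v (rm a)" by simp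
    qed
    also have "\<dots> = (\<Sum>m'\<in>rm ` K'. c (m' + single x (lookup m x)) * monv v m')"
      using inj by (simp add: sum.reindex)
    finally show ?thesis by simp
  qed
  moreover have "rm m \<in> rm ` K'" "finite (rm ` K')"
    using insert.prems(1,2) by (auto simp: K'_def)
  moreover have "keys m' \<subseteq> V" if "m' \<in> rm ` K'" for m'
    using that insert.prems(3) key_rm unfolding K'_def by blast
  ultimately have "c (rm m + single x (lookup m x)) = 0"
    using insert.IH[of "rm m" "rm ` K'" "\<lambda>m'. c (m' + single x (lookup m x))"] by blast
  then show ?case using rm[of m] by metis
qed

lemma mpoly_eq_0_if_eval_0:
  fixes p :: "('v, 'k::field_char_0) mpoly"
  assumes "finite V" "p \<in> polys V" "\<And>v. mpoly_eval p v = 0"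
  shows "p = 0"
proof -
  have "lookup p m = 0" if "m \<in> keys p" for m
    by (rule monomials_independent[of V "keys p" "lookup p"])
       (use assms that in \<open>auto simp: polys_def mpoly_eval_def monv_def\<close>)
  then have "keys p = {}" by (meson all_not_in_conv in_keys_iff)
  then show ?thesis by (simp add: keys_eq_empty)
qed

lemma eval_restrict:
  "p \<in> polys V \<Longrightarrow> mpoly_eval p (\<lambda>i. if i \<in> V then v i else 0) = mpoly_eval p v"
  unfolding mpoly_eval_insertion by (rule insertion_cong) auto

lemma polyring_eq_0_if_eval_0:
  fixes p :: "(nat, 'k::field_char_0) mpoly"
  assumes "p \<in> polyring N" "\<And>v. v \<in> coords N \<Longrightarrow> mpoly_eval p v = 0"
  shows "p = 0"
proof (rule mpoly_eq_0_if_eval_0[OF _ assms(1)])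
  fix v
  show "mpoly_eval p v = 0"
    using assms(2)[of "\<lambda>i. if i \<in> {..N} then v i else 0"] eval_restrict[OF assms(1), of v]
    by (auto simp: coords_def)
qed simp

section \<open>Gradings and ideals\<close>

lemma polys_0 [simp]: "0 \<in> polys V"
  by (simp add: polys_def)

lemma polys_single: "keys m \<subseteq> V \<Longrightarrow> single m c \<in> polys V"
  by (auto simp: polys_def split: if_splits)

lemma polys_1 [simp]: "1 \<in> polys V"
  using polys_single[of 0 V 1] by simp

lemma polys_add: "p \<in> polys V \<Longrightarrow> q \<in> polys V \<Longrightarrow> p + q \<in> polys V"
  using keys_add[of p q] by (fastforce simp: polys_def)

lemma polys_uminus: "p \<in> polys V \<Longrightarrow> - p \<in> polys V"
  by (auto simp: polys_def in_keys_iff)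

lemma polys_diff: "p \<in> polys V \<Longrightarrow> q \<in> polys V \<Longrightarrow> p - q \<in> polys V"
  using polys_add[of p V "- q"] polys_uminus[of q V] by simp

lemma polys_mult: "p \<in> polys V \<Longrightarrow> q \<in> polys V \<Longrightarrow> p * q \<in> polys V"
  using keys_mult[of p q] by (fastforce simp: polys_def keys_nat_add)

lemma polys_sum: "(\<And>a. a \<in> A \<Longrightarrow> f a \<in> polys V) \<Longrightarrow> sum f A \<in> polys V"
  by (induction A rule: infinite_finite_induct) (auto intro: polys_add)

lemma polys_power: "p \<in> polys V \<Longrightarrow> p ^ n \<in> polys V"
  by (induction n) (auto intro: polys_mult)

lemma polys_prod: "(\<And>a. a \<in> A \<Longrightarrow> f a \<in> polys V) \<Longrightarrow> prod f A \<in> polys V"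
  by (induction A rule: infinite_finite_induct) (auto intro: polys_mult)

lemma polys_var: "i \<in> V \<Longrightarrow> var i \<in> polys V"
  unfolding var_def by (rule polys_single) auto

lemmas polys_intros = polys_0 polys_1 polys_add polys_uminus polys_diff polys_mult polys_sum
  polys_power polys_prod polys_var

lemma mon_degree_superset: "finite A \<Longrightarrow> keys m \<subseteq> A \<Longrightarrow> mon_degree m = (\<Sum>i\<in>A. lookup m i)"
  unfolding mon_degree_def by (rule sum.mono_neutral_left) (auto simp: in_keys_iff)

lemma mon_degree_0 [simp]: "mon_degree 0 = 0"
  by (simp add: mon_degree_def)

lemma mon_degree_add: "mon_degree (m + k) = mon_degree m + mon_degree k"
  by (simp add: mon_degree_superset[of "keys m \<union> keys k"] lookup_add sum.distrib keys_nat_add)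

lemma mon_degree_single [simp]: "mon_degree (single i j) = j"
  by (cases "j = 0") (auto simp: mon_degree_def)

lemma mon_degree_eq_0_iff: "mon_degree m = 0 \<longleftrightarrow> m = 0"
  by (auto simp: mon_degree_def in_keys_iff intro!: poly_mapping_eqI)

lemma forms_polyring: "p \<in> forms N s \<Longrightarrow> p \<in> polyring N"
  by (simp add: forms_def)

lemma forms_0 [simp]: "0 \<in> forms N s"
  by (simp add: forms_def)

lemma forms_add: "p \<in> forms N s \<Longrightarrow> q \<in> forms N s \<Longrightarrow> p + q \<in> forms N s"
  using keys_add[of p q] polys_add[of p "{..N}" q] by (fastforce simp: forms_def)

lemma forms_uminus: "p \<in> forms N s \<Longrightarrow> - p \<in> forms N s"
  using polys_uminus[of p] by (auto simp: forms_def in_keys_iff)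

lemma forms_diff: "p \<in> forms N s \<Longrightarrow> q \<in> forms N s \<Longrightarrow> p - q \<in> forms N s"
  using forms_add[of p N s "- q"] forms_uminus[of q N s] by simp

lemma forms_sum: "(\<And>a. a \<in> A \<Longrightarrow> f a \<in> forms N s) \<Longrightarrow> sum f A \<in> forms N s"
  by (induction A rule: infinite_finite_induct) (auto intro: forms_add)

lemma forms_mult: "p \<in> forms N s \<Longrightarrow> q \<in> forms N t \<Longrightarrow> p * q \<in> forms N (s + t)"
  using keys_mult[of p q] polys_mult[of p "{..N}" q]
  by (fastforce simp: forms_def mon_degree_add)

lemma forms_single: "keys m \<subseteq> {..N} \<Longrightarrow> s = int (mon_degree m) \<Longrightarrow> single m c \<in> forms N s"
  by (auto simp: forms_def polys_single split: if_splits)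

lemma forms_var: "i \<le> N \<Longrightarrow> var i \<in> forms N 1"
  unfolding var_def by (rule forms_single) auto

lemma forms_const: "single 0 c \<in> forms N 0"
  by (rule forms_single) auto

lemma forms_1: "1 \<in> forms N 0"
  using forms_const[of 1] by simp

lemma forms_power: "p \<in> forms N s \<Longrightarrow> p ^ k \<in> forms N (int k * s)"
proof (induction k)
  case (Suc k)
  then have "p * p ^ k \<in> forms N (s + int k * s)" by (intro forms_mult) auto
  then show ?case by (simp add: algebra_simps)
qed (simp add: forms_1)

lemma forms_prod: "(\<And>a. a \<in> A \<Longrightarrow> f a \<in> forms N (s a)) \<Longrightarrow> prod f A \<in> forms N (sum s A)"
  by (induction A rule: infinite_finite_induct) (auto intro: forms_mult forms_1)

lemma forms_neg: "s < 0 \<Longrightarrow> p \<in> forms N s \<Longrightarrow> p = 0"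
  by (auto simp: forms_def simp flip: keys_eq_empty)

definition filter_monomials :: "(('v \<Rightarrow>\<^sub>0 nat) \<Rightarrow> bool) \<Rightarrow> ('v, 'k::field) mpoly \<Rightarrow> ('v, 'k) mpoly" where
  "filter_monomials P p = (\<Sum>m\<in>{m\<in>keys p. P m}. single m (lookup p m))"

lemma lookup_filter_monomials: "lookup (filter_monomials P p) m = (if P m then lookup p m else 0)"
proof -
  have "lookup (filter_monomials P p) m = (\<Sum>m'\<in>{m'\<in>keys p. P m'}. if m' = m then lookup p m else 0)"
    by (auto simp: filter_monomials_def lookup_sum lookup_single when_def intro!: sum.cong)
  then show ?thesis by (auto simp: in_keys_iff)
qed

lemma keys_filter_monomials: "keys (filter_monomials P p) = {m\<in>keys p. P m}"
  by (auto simp: in_keys_iff lookup_filter_monomials split: if_splits)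

lemma filter_monomials_add: "filter_monomials P (p + q) = filter_monomials P p + filter_monomials P q"
  by (rule poly_mapping_eqI) (simp add: lookup_filter_monomials lookup_add)

lemma filter_monomials_diff: "filter_monomials P (p - q) = filter_monomials P p - filter_monomials P q"
  by (rule poly_mapping_eqI) (simp add: lookup_filter_monomials lookup_minus)

lemma filter_monomials_0 [simp]: "filter_monomials P 0 = 0"
  by (rule poly_mapping_eqI) (simp add: lookup_filter_monomials)

lemma filter_monomials_sum: "filter_monomials P (sum f A) = (\<Sum>a\<in>A. filter_monomials P (f a))"
  by (induction A rule: infinite_finite_induct) (auto simp: filter_monomials_add)

lemma polys_filter_monomials: "p \<in> polys V \<Longrightarrow> filter_monomials P p \<in> polys V"
  by (auto simp: polys_def keys_filter_monomials)

text \<open>Degrees are integers, so a shift such as \<open>s - a\<close> may become negative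
  without a side condition; the component is then 0.\<close>

definition hcomp :: "int \<Rightarrow> ('v, 'k::field) mpoly \<Rightarrow> ('v, 'k) mpoly" where
  "hcomp s p = filter_monomials (\<lambda>m. int (mon_degree m) = s) p"

lemma hcomp_forms: "p \<in> polyring N \<Longrightarrow> hcomp s p \<in> forms N s"
  by (auto simp: forms_def hcomp_def polys_filter_monomials keys_filter_monomials)

lemma hcomp_polyring: "p \<in> polyring N \<Longrightarrow> hcomp s p \<in> polyring N"
  using hcomp_forms forms_polyring by blast

lemma hcomp_add: "hcomp s (p + q) = hcomp s p + hcomp s q"
  by (simp add: hcomp_def filter_monomials_add)

lemma hcomp_diff: "hcomp s (p - q) = hcomp s p - hcomp s q"
  by (simp add: hcomp_def filter_monomials_diff)

lemma hcomp_0 [simp]: "hcomp s 0 = 0"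
  by (simp add: hcomp_def)

lemma hcomp_sum: "hcomp s (sum f A) = (\<Sum>a\<in>A. hcomp s (f a))"
  by (simp add: hcomp_def filter_monomials_sum)

lemma hcomp_form: "p \<in> forms N t \<Longrightarrow> hcomp s p = (if s = t then p else 0)"
  by (rule poly_mapping_eqI) (auto simp: hcomp_def lookup_filter_monomials forms_def in_keys_iff)

lemma hcomp_decompose:
  assumes "finite D" "\<And>m. m \<in> keys p \<Longrightarrow> int (mon_degree m) \<in> D"
  shows "p = (\<Sum>s\<in>D. hcomp s p)"
proof (rule poly_mapping_eqI)
  fix m
  show "lookup p m = lookup (\<Sum>s\<in>D. hcomp s p) m"
    using assms by (cases "m \<in> keys p") (auto simp: lookup_sum hcomp_def lookup_filter_monomials in_keys_iff)
qed

lemma hcomp_decompose_keys: "p = (\<Sum>s\<in>(\<lambda>m. int (mon_degree m)) ` keys p. hcomp s p)"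
  by (rule hcomp_decompose) auto

lemma hcomp_mult_form:
  assumes "f \<in> forms N a" "p \<in> polyring N"
  shows "hcomp s (f * p) = f * hcomp (s - a) p"
proof -
  \<comment> \<open>\<open>s - a\<close> is added because it need not occur among the degrees of
    \<open>p\<close>.\<close>
  let ?D = "insert (s - a) ((\<lambda>m. int (mon_degree m)) ` keys p)"
  have "f * p = (\<Sum>t\<in>?D. f * hcomp t p)"
    by (subst hcomp_decompose[of ?D p]) (auto simp: sum_distrib_left)
  then have "hcomp s (f * p) = (\<Sum>t\<in>?D. hcomp s (f * hcomp t p))"
    by (simp add: hcomp_sum)
  also have "\<dots> = (\<Sum>t\<in>?D. if t = s - a then f * hcomp (s - a) p else 0)"
  proof (rule sum.cong[OF refl])
    fix t
    have "f * hcomp t p \<in> forms N (a + t)"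
      using assms by (intro forms_mult hcomp_forms)
    then show "hcomp s (f * hcomp t p) = (if t = s - a then f * hcomp (s - a) p else 0)"
      by (auto simp: hcomp_form)
  qed
  also have "\<dots> = f * hcomp (s - a) p" by simp
  finally show ?thesis .
qed

lemma ideal_0: "is_ideal N J \<Longrightarrow> 0 \<in> J"
  by (simp add: is_ideal_def)

lemma ideal_add: "is_ideal N J \<Longrightarrow> p \<in> J \<Longrightarrow> q \<in> J \<Longrightarrow> p + q \<in> J"
  by (simp add: is_ideal_def)

lemma ideal_mult: "is_ideal N J \<Longrightarrow> g \<in> polyring N \<Longrightarrow> p \<in> J \<Longrightarrow> g * p \<in> J"
  by (simp add: is_ideal_def)

lemma ideal_polyring: "is_ideal N J \<Longrightarrow> p \<in> J \<Longrightarrow> p \<in> polyring N"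
  by (auto simp: is_ideal_def)

lemma ideal_uminus: "is_ideal N J \<Longrightarrow> p \<in> J \<Longrightarrow> - p \<in> J"
  using ideal_mult[of N J "- 1" p] polys_uminus[OF polys_1, of "{..N}"] by simp

lemma ideal_diff: "is_ideal N J \<Longrightarrow> p \<in> J \<Longrightarrow> q \<in> J \<Longrightarrow> p - q \<in> J"
  using ideal_add[of N J p "- q"] ideal_uminus[of N J q] by simp

lemma ideal_sum: "is_ideal N J \<Longrightarrow> (\<And>a. a \<in> A \<Longrightarrow> f a \<in> J) \<Longrightarrow> sum f A \<in> J"
  by (induction A rule: infinite_finite_induct) (auto intro: ideal_add ideal_0)

lemma ideal_cong: "is_ideal N J \<Longrightarrow> p - q \<in> J \<Longrightarrow> p \<in> J \<longleftrightarrow> q \<in> J"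
  using ideal_add[of N J "p - q" q] ideal_diff[of N J p "p - q"] by auto

lemma is_ideal_polyring: "is_ideal N (polyring N)"
  by (auto simp: is_ideal_def intro: polys_intros)

lemma ideal_gen_superset: "S \<subseteq> ideal_gen N S"
  by (auto simp: ideal_gen_def)

lemma ideal_gen_least: "is_ideal N J \<Longrightarrow> S \<subseteq> J \<Longrightarrow> ideal_gen N S \<subseteq> J"
  by (auto simp: ideal_gen_def)

lemma is_ideal_ideal_gen: "S \<subseteq> polyring N \<Longrightarrow> is_ideal N (ideal_gen N S)"
  using is_ideal_polyring[of N]
  unfolding is_ideal_def[of N "ideal_gen N S"]
  by (auto simp: ideal_gen_def intro: ideal_0 ideal_add ideal_mult dest: ideal_polyring)

definition homogeneous_set :: "('v, 'k::field) mpoly set \<Rightarrow> bool" where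
  "homogeneous_set J \<longleftrightarrow> (\<forall>p\<in>J. \<forall>s. hcomp s p \<in> J)"

text \<open>The sum of two ideals as a set of sums, which hands out a decomposition of each element;
  \<open>ideal_gen\<close>, being an intersection, does not.\<close>

definition set_sum :: "'a::plus set \<Rightarrow> 'a set \<Rightarrow> 'a set" where
  "set_sum I J = {p + q | p q. p \<in> I \<and> q \<in> J}"

lemma is_ideal_set_sum:
  fixes I J :: "(nat, 'a::field) mpoly set"
  assumes "is_ideal N I" "is_ideal N J"
  shows "is_ideal N (set_sum I J)"
  unfolding is_ideal_def
proof (intro conjI ballI)
  show "set_sum I J \<subseteq> polyring N"
    using assms by (auto simp: set_sum_def intro: polys_add dest: ideal_polyring)
  show "0 \<in> set_sum I J"
    using assms ideal_0 by (force simp: set_sum_def)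
next
  fix p q assume "p \<in> set_sum I J" "q \<in> set_sum I J"
  then obtain a b a' b' where "p = a + b" "q = a' + b'" "a \<in> I" "a' \<in> I" "b \<in> J" "b' \<in> J"
    by (auto simp: set_sum_def)
  then have "p + q = (a + a') + (b + b')" "a + a' \<in> I" "b + b' \<in> J"
    using assms by (auto intro: ideal_add)
  then show "p + q \<in> set_sum I J" by (auto simp: set_sum_def)
next
  fix g p :: "(nat, 'a) mpoly" assume "g \<in> polyring N" "p \<in> set_sum I J"
  then obtain a b where "p = a + b" "g * a \<in> I" "g * b \<in> J"
    using assms by (auto simp: set_sum_def intro: ideal_mult)
  then show "g * p \<in> set_sum I J" by (auto simp: set_sum_def algebra_simps)
qed

lemma set_sum_left: "is_ideal N J \<Longrightarrow> p \<in> I \<Longrightarrow> p \<in> set_sum I J"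
  using ideal_0 by (force simp: set_sum_def)

lemma set_sum_right: "is_ideal N I \<Longrightarrow> p \<in> J \<Longrightarrow> p \<in> set_sum I J"
  using ideal_0 by (force simp: set_sum_def)

lemma homogeneous_set_sum:
  "homogeneous_set I \<Longrightarrow> homogeneous_set J \<Longrightarrow> homogeneous_set (set_sum I J)"
  unfolding homogeneous_set_def set_sum_def by (clarsimp simp: hcomp_add) blast

lemma finite_exponents: "finite {m :: nat \<Rightarrow>\<^sub>0 nat. keys m \<subseteq> {..N} \<and> mon_degree m \<le> t}"
proof (rule finite_imageD)
  define A where "A = {m :: nat \<Rightarrow>\<^sub>0 nat. keys m \<subseteq> {..N} \<and> mon_degree m \<le> t}"
  have "lookup m i \<le> t" if "m \<in> A" for m i
  proof (cases "i \<in> keys m")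
    case True
    then have "lookup m i \<le> mon_degree m"
      unfolding mon_degree_def by (intro member_le_sum) simp_all
    moreover have "mon_degree m \<le> t" using that by (simp add: A_def)
    ultimately show ?thesis by (rule order_trans)
  qed (simp add: in_keys_iff)
  moreover have "lookup m i = 0" if "m \<in> A" "i \<notin> {..N}" for m i
  proof -
    have "i \<notin> keys m" using that by (auto simp: A_def)
    then show ?thesis by (simp add: in_keys_iff)
  qed
  ultimately have sub: "lookup ` A \<subseteq> {f. \<forall>x. (x \<in> {..N} \<longrightarrow> f x \<in> {..t}) \<and> (x \<notin> {..N} \<longrightarrow> f x = 0)}"
    by auto
  have "finite {f. \<forall>x. (x \<in> {..N} \<longrightarrow> f x \<in> {..t}) \<and> (x \<notin> {..N} \<longrightarrow> f x = (0::nat))}"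
    by (rule finite_set_of_finite_funs[OF finite_atMost finite_atMost])
  from finite_subset[OF sub this]
  show "finite (lookup ` {m :: nat \<Rightarrow>\<^sub>0 nat. keys m \<subseteq> {..N} \<and> mon_degree m \<le> t})"
    unfolding A_def .
  show "inj_on lookup {m :: nat \<Rightarrow>\<^sub>0 nat. keys m \<subseteq> {..N} \<and> mon_degree m \<le> t}"
    by (rule inj_onI, rule poly_mapping_eq_iff[THEN iffD2])
qed

section \<open>Vanishing of homology modulo linear forms\<close>

text \<open>Read as evaluation at the origin, the constant term inherits additivity and
  multiplicativity.\<close>

lemma lookup_0_eval: "lookup p 0 = mpoly_eval p (\<lambda>_. 0)"
proof -
  have "monv (\<lambda>_. 0 :: 'a) m = (if m = 0 then 1 else 0)" for m :: "'b \<Rightarrow>\<^sub>0 nat"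
  proof (cases "m = 0")
    case False
    then obtain i where "i \<in> keys m" by (metis all_not_in_conv keys_eq_empty)
    then show ?thesis using False unfolding monv_def by (auto simp: in_keys_iff intro!: prod_zero)
  qed simp
  then have "mpoly_eval p (\<lambda>_. 0) = (\<Sum>m\<in>keys p. if m = 0 then lookup p 0 else 0)"
    unfolding mpoly_eval_insertion insertion_def by (intro sum.cong) simp_all
  then show ?thesis by (simp add: in_keys_iff)
qed

lemma power_diff_ideal:
  assumes "is_ideal N J" "a \<in> polyring N" "b \<in> polyring N" "a - b \<in> J"
  shows "a ^ q - b ^ q \<in> J"
proof (induction q)
  case (Suc q)
  have "a ^ Suc q - b ^ Suc q = a * (a ^ q - b ^ q) + b ^ q * (a - b)"
    by (simp add: algebra_simps)
  then show ?case
    using ideal_add[OF assms(1) ideal_mult[OF assms(1,2) Suc] ideal_mult[OF assms(1) polys_power[OF assms(3)] assms(4)]]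
    by simp
qed (use ideal_0[OF assms(1)] in simp)

text \<open>\<open>A k\<close> stands for the ideal \<open>(l\<^sub>0,\<dots>,l\<^sub>k\<^sub>-\<^sub>1)\<close>, where \<open>l\<^sub>0,\<dots>,l\<^sub>N\<close> is a basis of the linear forms.\<close>

locale linear_flag =
  fixes N :: nat and l :: "nat \<Rightarrow> (nat, 'k::field) mpoly" and A :: "nat \<Rightarrow> (nat, 'k) mpoly set"
  assumes A_ideal: "is_ideal N (A k)"
    and A_homogeneous: "homogeneous_set (A k)"
    and A_0: "A 0 = {0}"
    and A_Suc: "A k \<subseteq> A (Suc k)"
    and l_form: "k \<le> N \<Longrightarrow> l k \<in> forms N 1"
    and l_in_A: "k \<le> N \<Longrightarrow> l k \<in> A (Suc k)"
    and A_split: "k \<le> N \<Longrightarrow> p \<in> A (Suc k) \<Longrightarrow> \<exists>u\<in>polyring N. p - l k * u \<in> A k"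
    and l_nonzerodivisor: "k \<le> N \<Longrightarrow> u \<in> polyring N \<Longrightarrow> l k * u \<in> A k \<Longrightarrow> u \<in> A k"
    and A_top: "p \<in> A (Suc N) \<longleftrightarrow> p \<in> polyring N \<and> lookup p 0 = 0"
begin

lemma l_polyring: "k \<le> N \<Longrightarrow> l k \<in> polyring N"
  using l_form forms_polyring by blast

lemma A_mono: "j \<le> k \<Longrightarrow> A j \<subseteq> A k"
  using A_Suc by (rule lift_Suc_mono_le)

end

definition smult_vec :: "'a::times \<Rightarrow> (nat \<Rightarrow> 'a) \<Rightarrow> nat \<Rightarrow> 'a" where
  "smult_vec p v = (\<lambda>b. p * v b)"

lemma smult_vec_apply [simp]: "smult_vec p v b = p * v b"
  by (simp add: smult_vec_def)

lemma free_module_intros: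
  "0 \<in> free_module N r"
  "v \<in> free_module N r \<Longrightarrow> w \<in> free_module N r \<Longrightarrow> v + w \<in> free_module N r"
  "v \<in> free_module N r \<Longrightarrow> w \<in> free_module N r \<Longrightarrow> v - w \<in> free_module N r"
  "p \<in> polyring N \<Longrightarrow> v \<in> free_module N r \<Longrightarrow> smult_vec p v \<in> free_module N r"
  by (auto simp: free_module_def intro: polys_intros)

lemma free_module_polyring: "v \<in> free_module N r \<Longrightarrow> v b \<in> polyring N"
  by (cases "b < r") (auto simp: free_module_def)

locale resolution = linear_flag N l A
  for N :: nat and l :: "nat \<Rightarrow> (nat, 'k::field) mpoly" and A :: "nat \<Rightarrow> (nat, 'k) mpoly set" +
  fixes I :: "(nat, 'k) mpoly set" and F :: "'k free_complex"
  assumes I_ideal: "is_ideal N I" and I_homogeneous: "homogeneous_set I"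
    and F_resolution: "graded_free_resolution N I F"
begin

abbreviation "rk \<equiv> gen_count F"
abbreviation "dg \<equiv> gen_degree F"
abbreviation "FM i \<equiv> free_module N (rk i)"
abbreviation "d \<equiv> bdry_map F"

text \<open>Vectors in \<open>VA k\<close> are those that become 0 in the tensor product of
  \<open>F\<close> with \<open>R/A k\<close>, so congruence modulo \<open>VA k\<close> is equality
  there.\<close>

definition VA :: "nat \<Rightarrow> (nat \<Rightarrow> (nat, 'k) mpoly) set" where
  "VA k = {v. \<forall>b. v b \<in> A k}"

text \<open>The graded piece of degree \<open>s\<close>: the basis element \<open>b\<close> has
  degree \<open>dg i b\<close>, and its coefficient supplies the rest.\<close>

definition HV :: "nat \<Rightarrow> int \<Rightarrow> (nat \<Rightarrow> (nat, 'k) mpoly) set" where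
  "HV i s = {v \<in> FM i. \<forall>b. v b \<in> forms N (s - dg i b)}"

lemma VA_add: "v \<in> VA k \<Longrightarrow> w \<in> VA k \<Longrightarrow> v + w \<in> VA k"
  by (auto simp: VA_def intro: ideal_add[OF A_ideal])

lemma VA_diff: "v \<in> VA k \<Longrightarrow> w \<in> VA k \<Longrightarrow> v - w \<in> VA k"
  by (auto simp: VA_def intro: ideal_diff[OF A_ideal])

lemma VA_smult: "p \<in> polyring N \<Longrightarrow> v \<in> VA k \<Longrightarrow> smult_vec p v \<in> VA k"
  by (auto simp: VA_def intro: ideal_mult[OF A_ideal])

lemma VA_0: "0 \<in> VA k"
  by (auto simp: VA_def intro: ideal_0[OF A_ideal])

lemma VA_mono: "j \<le> k \<Longrightarrow> v \<in> VA j \<Longrightarrow> v \<in> VA k"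
  using A_mono by (force simp: VA_def)

lemma VA_l_cancel:
  assumes "k \<le> N" "v \<in> FM i" "smult_vec (l k) v \<in> VA k"
  shows "v \<in> VA k"
  using assms by (auto simp: VA_def intro: l_nonzerodivisor free_module_polyring)

lemma VA_l: "k \<le> N \<Longrightarrow> v \<in> FM i \<Longrightarrow> smult_vec (l k) v \<in> VA (Suc k)"
  using ideal_mult[OF A_ideal free_module_polyring l_in_A, of v "rk i" k]
  by (auto simp: VA_def mult.commute)

lemma bdry_forms: "a < rk i \<Longrightarrow> b < rk (Suc i) \<Longrightarrow> bdry F i a b \<in> forms N (dg (Suc i) b - dg i a)"
  using F_resolution by (auto simp: graded_free_resolution_def)

lemma bdry_polyring: "a < rk i \<Longrightarrow> b < rk (Suc i) \<Longrightarrow> bdry F i a b \<in> polyring N"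
  using bdry_forms forms_polyring by blast

lemma aug_forms: "b < rk 0 \<Longrightarrow> aug F b \<in> forms N (dg 0 b)"
  using F_resolution by (auto simp: graded_free_resolution_def)

lemma d_diff: "d i (v - w) = d i v - d i w"
  by (auto simp: bdry_map_def fun_eq_iff algebra_simps sum_subtractf)

lemma d_smult: "d i (smult_vec p v) = smult_vec p (d i v)"
  by (auto simp: bdry_map_def fun_eq_iff sum_distrib_left mult.left_commute intro!: sum.cong)

lemma d_FM: "v \<in> FM (Suc i) \<Longrightarrow> d i v \<in> FM i"
  by (auto simp: free_module_def bdry_map_def intro!: polys_sum polys_mult bdry_polyring)

lemma d_VA: "v \<in> VA k \<Longrightarrow> d i v \<in> VA k"
  by (auto simp: VA_def bdry_map_def intro!: ideal_sum[OF A_ideal] ideal_mult[OF A_ideal] bdry_polyring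
      ideal_0[OF A_ideal])

lemma d_HV: "v \<in> HV (Suc i) s \<Longrightarrow> d i v \<in> HV i s"
proof -
  assume v: "v \<in> HV (Suc i) s"
  have "bdry F i a b * v b \<in> forms N (s - dg i a)" if "a < rk i" "b < rk (Suc i)" for a b
    using forms_mult[OF bdry_forms[OF that], of "v b" "s - dg (Suc i) b"] v by (simp add: HV_def)
  then show ?thesis using v d_FM by (auto simp: HV_def bdry_map_def intro!: forms_sum)
qed

lemmas F_parts = F_resolution[unfolded graded_free_resolution_def]

lemma image_eq_kernel: "{v \<in> FM (Suc i). d i v = 0} = d (Suc i) ` FM (Suc (Suc i))"
  using F_parts[THEN conjunct2, THEN conjunct2, THEN conjunct2, THEN conjunct2] by (rule spec)

lemma image_eq_kernel_0: "{v \<in> FM 0. aug_map F v \<in> I} = d 0 ` FM (Suc 0)"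
  using F_parts[THEN conjunct2, THEN conjunct2, THEN conjunct2, THEN conjunct1] by simp

lemma exact: "v \<in> FM (Suc i) \<Longrightarrow> d i v = 0 \<Longrightarrow> \<exists>w\<in>FM (Suc (Suc i)). v = d (Suc i) w"
  using image_eq_kernel[of i] by blast

lemma d_d: "v \<in> FM (Suc (Suc i)) \<Longrightarrow> d i (d (Suc i) v) = 0"
  using image_eq_kernel[of i] by blast

lemma exact_0: "v \<in> FM 0 \<Longrightarrow> aug_map F v \<in> I \<Longrightarrow> \<exists>w\<in>FM (Suc 0). v = d 0 w"
  using image_eq_kernel_0 by blast

lemma aug_d: "v \<in> FM (Suc 0) \<Longrightarrow> aug_map F (d 0 v) \<in> I"
  using image_eq_kernel_0 by blast

lemma aug_surj: "g \<in> polyring N \<Longrightarrow> \<exists>v\<in>FM 0. g - aug_map F v \<in> I"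
  using F_parts[THEN conjunct2, THEN conjunct2, THEN conjunct1] by (rule bspec)

lemma aug_diff: "aug_map F (v - w) = aug_map F v - aug_map F w"
  by (auto simp: aug_map_def algebra_simps sum_subtractf)

lemma aug_smult: "aug_map F (smult_vec p v) = p * aug_map F v"
  by (auto simp: aug_map_def sum_distrib_left mult.assoc)

lemma aug_polyring: "v \<in> FM 0 \<Longrightarrow> aug_map F v \<in> polyring N"
  by (auto simp: aug_map_def free_module_def intro!: polys_sum polys_mult forms_polyring[OF aug_forms])

lemma aug_VA: "v \<in> VA k \<Longrightarrow> aug_map F v \<in> A k"
  unfolding aug_map_def VA_def mult.commute[of _ "aug F _"]
  by (auto intro!: ideal_sum[OF A_ideal] ideal_mult[OF A_ideal] forms_polyring[OF aug_forms])

lemma aug_HV: "v \<in> HV 0 s \<Longrightarrow> aug_map F v \<in> forms N s"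
proof -
  assume v: "v \<in> HV 0 s"
  have "v b * aug F b \<in> forms N s" if "b < rk 0" for b
    using forms_mult[OF _ aug_forms[OF that], of "v b" "s - dg 0 b"] v by (simp add: HV_def)
  then show ?thesis by (auto simp: aug_map_def intro!: forms_sum)
qed

definition vcomp :: "nat \<Rightarrow> int \<Rightarrow> (nat \<Rightarrow> (nat, 'k) mpoly) \<Rightarrow> nat \<Rightarrow> (nat, 'k) mpoly" where
  "vcomp i s v = (\<lambda>b. hcomp (s - dg i b) (v b))"

lemma vcomp_HV: "v \<in> FM i \<Longrightarrow> vcomp i s v \<in> HV i s"
  by (auto simp: vcomp_def HV_def free_module_def intro: hcomp_forms hcomp_polyring)
     (metis forms_0 hcomp_0 hcomp_forms not_le)

lemma vcomp_id: "v \<in> HV i s \<Longrightarrow> vcomp i s v = v"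
proof (rule ext)
  fix b assume "v \<in> HV i s"
  then have "v b \<in> forms N (s - dg i b)" by (simp add: HV_def)
  then show "vcomp i s v b = v b" by (simp add: vcomp_def hcomp_form)
qed

lemma vcomp_diff: "vcomp i s (v - w) = vcomp i s v - vcomp i s w"
  by (auto simp: vcomp_def hcomp_diff)

lemma vcomp_VA: "v \<in> VA k \<Longrightarrow> vcomp i s v \<in> VA k"
  using A_homogeneous by (auto simp: vcomp_def VA_def homogeneous_set_def)

lemma d_vcomp: "v \<in> FM (Suc i) \<Longrightarrow> d i (vcomp (Suc i) s v) = vcomp i s (d i v)"
proof
  fix a assume v: "v \<in> FM (Suc i)"
  show "d i (vcomp (Suc i) s v) a = vcomp i s (d i v) a"
  proof (cases "a < rk i")
    case True
    have "hcomp (s - dg i a) (bdry F i a b * v b) = bdry F i a b * hcomp (s - dg (Suc i) b) (v b)"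
      if "b < rk (Suc i)" for b
      using hcomp_mult_form[OF bdry_forms[OF True that] free_module_polyring[OF v]] by simp
    then show ?thesis using True by (auto simp: bdry_map_def vcomp_def hcomp_sum intro!: sum.cong)
  qed (simp add: bdry_map_def vcomp_def)
qed

lemma aug_vcomp: "v \<in> FM 0 \<Longrightarrow> aug_map F (vcomp 0 s v) = hcomp s (aug_map F v)"
proof -
  assume v: "v \<in> FM 0"
  have "hcomp s (v b * aug F b) = hcomp (s - dg 0 b) (v b) * aug F b" if "b < rk 0" for b
    using hcomp_mult_form[OF aug_forms[OF that] free_module_polyring[OF v], of s b]
    by (simp add: mult.commute)
  then show ?thesis by (auto simp: aug_map_def vcomp_def hcomp_sum intro!: sum.cong)
qed

lemma HV_FM: "v \<in> HV i s \<Longrightarrow> v \<in> FM i"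
  by (simp add: HV_def)

lemma HV_diff: "v \<in> HV i s \<Longrightarrow> w \<in> HV i s \<Longrightarrow> v - w \<in> HV i s"
  by (auto simp: HV_def intro: free_module_intros forms_diff)

lemma HV_smult:
  assumes "p \<in> forms N t" "v \<in> HV i s" shows "smult_vec p v \<in> HV i (t + s)"
proof -
  have "p * v b \<in> forms N (t + s - dg i b)" for b
    using forms_mult[OF assms(1), of "v b" "s - dg i b"] assms(2) by (simp add: HV_def algebra_simps)
  then show ?thesis
    using assms by (auto simp: HV_def intro!: free_module_intros forms_polyring)
qed

lemma VA_Suc_split:
  assumes "k \<le> N" "v \<in> VA (Suc k)" "v \<in> FM i"
  shows "\<exists>u\<in>FM i. v - smult_vec (l k) u \<in> VA k"
proof -
  have "\<exists>u. u \<in> polyring N \<and> (b \<ge> rk i \<longrightarrow> u = 0) \<and> v b - l k * u \<in> A k" for b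
  proof (cases "b < rk i")
    case True
    then show ?thesis using A_split[OF assms(1), of "v b"] assms(2) by (auto simp: VA_def)
  next
    case False
    then have "v b = 0" using assms(3) by (simp add: free_module_def)
    then show ?thesis using ideal_0[OF A_ideal] by (intro exI[of _ 0]) auto
  qed
  then obtain u where "\<And>b. u b \<in> polyring N \<and> (b \<ge> rk i \<longrightarrow> u b = 0) \<and> v b - l k * u b \<in> A k"
    by metis
  then show ?thesis by (intro bexI[of _ u]) (auto simp: VA_def free_module_def)
qed

lemma VA_Suc_split_HV:
  assumes "k \<le> N" "v \<in> VA (Suc k)" "v \<in> HV i s"
  shows "\<exists>u\<in>HV i (s - 1). v - smult_vec (l k) u \<in> VA k"
proof -
  obtain u where u: "u \<in> FM i" "v - smult_vec (l k) u \<in> VA k"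
    using VA_Suc_split[OF assms(1,2)] assms(3) by (auto simp: HV_def)
  have "vcomp i s (smult_vec (l k) u) = smult_vec (l k) (vcomp i (s - 1) u)"
    using hcomp_mult_form[OF l_form[OF assms(1)] free_module_polyring[OF u(1)]]
    by (auto simp: vcomp_def fun_eq_iff algebra_simps)
  then have "v - smult_vec (l k) (vcomp i (s - 1) u) \<in> VA k"
    using vcomp_VA[OF u(2), of i s] vcomp_id[OF assms(3)] by (simp add: vcomp_diff)
  then show ?thesis using vcomp_HV[OF u(1)] by auto
qed

text \<open>\<open>homology_vanishes k i s\<close> says that \<open>H\<^sub>i(F \<otimes> R/A k)\<^sub>s = 0\<close>, which for \<open>k = N + 1\<close> is the vanishing
  of \<open>Tor\<^sub>i(R/I, \<k>)\<^sub>s\<close>.\<close>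

fun cycle :: "nat \<Rightarrow> nat \<Rightarrow> (nat \<Rightarrow> (nat, 'k) mpoly) \<Rightarrow> bool" where
  "cycle k 0 v = True"
| "cycle k (Suc i) v = (d i v \<in> VA k)"

definition boundary :: "nat \<Rightarrow> nat \<Rightarrow> (nat \<Rightarrow> (nat, 'k) mpoly) \<Rightarrow> bool" where
  "boundary k i v \<longleftrightarrow> (\<exists>w\<in>FM (Suc i). v - d i w \<in> VA k)"

definition homology_vanishes :: "nat \<Rightarrow> nat \<Rightarrow> int \<Rightarrow> bool" where
  "homology_vanishes k i s \<longleftrightarrow> (\<forall>v\<in>HV i s. cycle k i v \<longrightarrow> boundary k i v)"

text \<open>\<open>d\<close> and \<open>A k\<close> are graded, so the degree \<open>s\<close> part
  of any preimage is again a preimage.\<close>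

lemma boundary_HV:
  assumes "boundary k i v" "v \<in> HV i s"
  obtains w where "w \<in> HV (Suc i) s" "v - d i w \<in> VA k"
proof -
  obtain w where w: "w \<in> FM (Suc i)" "v - d i w \<in> VA k"
    using assms(1) by (auto simp: boundary_def)
  have "v - d i (vcomp (Suc i) s w) \<in> VA k"
    using vcomp_VA[OF w(2), of i s] vcomp_id[OF assms(2)] d_vcomp[OF w(1)] by (simp add: vcomp_diff)
  then show thesis using that vcomp_HV[OF w(1)] by blast
qed

lemma boundary_cong: "boundary k i v \<Longrightarrow> v - v' \<in> VA k \<Longrightarrow> boundary k i v'"
proof -
  assume "boundary k i v" and v': "v - v' \<in> VA k"
  then obtain w where w: "w \<in> FM (Suc i)" "v - d i w \<in> VA k" by (auto simp: boundary_def)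
  have "v' - d i w = (v - d i w) - (v - v')" by simp
  then show ?thesis using VA_diff[OF w(2) v'] w(1) by (auto simp: boundary_def)
qed

text \<open>\<open>u\<close> represents the image of the class of \<open>v\<close> under the
  connecting map. Another application of \<open>d\<close> removes \<open>d i v\<close>, and the
  remaining factor \<open>l k\<close> cancels modulo \<open>A k\<close>.\<close>

lemma cycle_cancel_l:
  assumes "k \<le> N" "v \<in> FM (Suc i)" "u \<in> FM i" "d i v - smult_vec (l k) u \<in> VA k"
  shows "cycle k i u"
proof (cases i)
  case (Suc j)
  have "d j (d i v - smult_vec (l k) u) \<in> VA k" by (rule d_VA[OF assms(4)])
  moreover have "d j (d i v) = 0" using d_d assms(2) Suc by simp
  ultimately have "0 - smult_vec (l k) (d j u) \<in> VA k" by (simp add: d_diff d_smult)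
  then have "smult_vec (l k) (d j u) \<in> VA k" using VA_diff[OF VA_0] by fastforce
  then show ?thesis using VA_l_cancel[OF assms(1) d_FM] assms(3) Suc by simp
qed simp

text \<open>Exactness at the middle term in the long exact sequence of \<open>0 \<rightarrow> R/A k
  \<rightarrow> R/A k \<rightarrow> R/A (Suc k) \<rightarrow> 0\<close>, whose first map is
  multiplication by \<open>l k\<close>: \<open>van\<close> is the vanishing of the left neighbour,
  and \<open>inj\<close> says that \<open>l k\<close> is injective on \<open>H\<^sub>i\<close> in
  degree \<open>s - 1\<close>.\<close>

lemma homology_vanishes_Suc:
  assumes k: "k \<le> N" and van: "homology_vanishes k (Suc i) s"
    and inj: "\<And>u. u \<in> HV i (s - 1) \<Longrightarrow> cycle k i u \<Longrightarrow> boundary k i (smult_vec (l k) u) \<Longrightarrow> boundary k i u"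
  shows "homology_vanishes (Suc k) (Suc i) s"
  unfolding homology_vanishes_def
proof (intro ballI impI)
  fix v assume v: "v \<in> HV (Suc i) s" "cycle (Suc k) (Suc i) v"
  obtain u where u: "u \<in> HV i (s - 1)" "d i v - smult_vec (l k) u \<in> VA k"
    using VA_Suc_split_HV[OF k _ d_HV[OF v(1)]] v(2) by auto
  have "cycle k i u" by (rule cycle_cancel_l[OF k HV_FM HV_FM]) (use u v in auto)
  moreover have "boundary k i (smult_vec (l k) u)"
    unfolding boundary_def
    by (rule bexI[OF _ HV_FM[OF v(1)]]) (use VA_diff[OF VA_0 u(2)] in simp)
  ultimately have "boundary k i u" using inj u(1) by blast
  then obtain w where w: "w \<in> HV (Suc i) (s - 1)" "u - d i w \<in> VA k"
    using boundary_HV u(1) by blast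
  \<comment> \<open>Correcting \<open>v\<close> by a multiple of \<open>l k\<close> does not change
    it modulo \<open>A (Suc k)\<close> and makes it a cycle modulo \<open>A k\<close>, to which
    \<open>van\<close> applies.\<close>
  define v' where "v' = v - smult_vec (l k) w"
  have "v' \<in> HV (Suc i) s"
    using HV_diff[OF v(1)] HV_smult[OF l_form[OF k] w(1)] by (simp add: v'_def)
  moreover have "cycle k (Suc i) v'"
  proof -
    have "d i v' = (d i v - smult_vec (l k) u) + smult_vec (l k) (u - d i w)"
      by (auto simp: v'_def d_diff d_smult fun_eq_iff algebra_simps)
    then show ?thesis
      using VA_add[OF u(2) VA_smult[OF l_polyring[OF k] w(2)]] by simp
  qed
  ultimately obtain w' where w': "w' \<in> FM (Suc (Suc i))" "v' - d (Suc i) w' \<in> VA k"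
    using van by (auto simp: homology_vanishes_def boundary_def)
  have "(v' - d (Suc i) w') + smult_vec (l k) w = v - d (Suc i) w'"
    by (simp add: v'_def)
  then have "v - d (Suc i) w' \<in> VA (Suc k)"
    using VA_add[OF VA_mono[OF _ w'(2), of "Suc k"] VA_l[OF k HV_FM[OF w(1)]]] by (metis le_SucI order_refl)
  then show "boundary (Suc k) (Suc i) v" using w'(1) by (auto simp: boundary_def)
qed

lemma homology_vanishes_Suc_Suc:
  assumes "k \<le> N" "homology_vanishes k (Suc i) s" "homology_vanishes k i (s - 1)"
  shows "homology_vanishes (Suc k) (Suc i) s"
  using assms homology_vanishes_Suc by (auto simp: homology_vanishes_def)

definition annihilates :: "(nat, 'k) mpoly \<Rightarrow> nat \<Rightarrow> nat \<Rightarrow> bool" where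
  "annihilates f k i \<longleftrightarrow> (\<forall>v\<in>FM i. cycle k i v \<longrightarrow> boundary k i (smult_vec f v))"

lemma boundary_smult: "f \<in> polyring N \<Longrightarrow> boundary k i v \<Longrightarrow> boundary k i (smult_vec f v)"
proof -
  assume f: "f \<in> polyring N" and "boundary k i v"
  then obtain w where w: "w \<in> FM (Suc i)" "v - d i w \<in> VA k" by (auto simp: boundary_def)
  have "smult_vec f v - d i (smult_vec f w) = smult_vec f (v - d i w)"
    by (auto simp: d_smult fun_eq_iff algebra_simps)
  then show ?thesis
    using VA_smult[OF f w(2)] free_module_intros(4)[OF f w(1)] unfolding boundary_def by metis
qed

lemma boundary_mono: "j \<le> k \<Longrightarrow> boundary j i v \<Longrightarrow> boundary k i v"
  using VA_mono by (auto simp: boundary_def)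

text \<open>In the long exact sequence for \<open>l k\<close>, the homology modulo
  \<open>A (Suc k)\<close> lies between two homology groups modulo \<open>A k\<close>. One factor
  \<open>f\<close> kills the image under the connecting map, the other kills the class that
  remains.\<close>

lemma annihilates_Suc:
  assumes k: "k \<le> N" and f: "f \<in> polyring N" and ann: "\<And>i. annihilates f k i"
  shows "annihilates (f * f) (Suc k) i"
proof (cases i)
  case 0
  have "boundary (Suc k) 0 (smult_vec (f * f) v)" if "v \<in> FM 0" for v
  proof -
    have "boundary k 0 (smult_vec f v)" using ann[of 0] that by (simp add: annihilates_def)
    from boundary_mono[OF _ boundary_smult[OF f this], of "Suc k"]
    show ?thesis by (simp add: smult_vec_def mult.assoc)
  qed
  then show ?thesis using 0 by (simp add: annihilates_def)
next
  case (Suc j)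
  have "boundary (Suc k) (Suc j) (smult_vec (f * f) v)"
    if v: "v \<in> FM (Suc j)" "cycle (Suc k) (Suc j) v" for v
  proof -
    obtain u where u: "u \<in> FM j" "d j v - smult_vec (l k) u \<in> VA k"
      using VA_Suc_split[OF k _ d_FM[OF v(1)]] v(2) by auto
    have "cycle k j u" by (rule cycle_cancel_l[OF k v(1) u])
    then obtain w where w: "w \<in> FM (Suc j)" "smult_vec f u - d j w \<in> VA k"
      using ann[of j] u(1) by (auto simp: annihilates_def boundary_def)
    define v' where "v' = smult_vec f v - smult_vec (l k) w"
    have "v' \<in> FM (Suc j)"
      unfolding v'_def by (intro free_module_intros f v l_polyring k w)
    moreover have "cycle k (Suc j) v'"
    proof -
      have "d j v' = smult_vec f (d j v - smult_vec (l k) u) + smult_vec (l k) (smult_vec f u - d j w)"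
        by (auto simp: v'_def d_diff d_smult fun_eq_iff algebra_simps)
      then show ?thesis
        using VA_add[OF VA_smult[OF f u(2)] VA_smult[OF l_polyring[OF k] w(2)]] by simp
    qed
    ultimately obtain w' where w': "w' \<in> FM (Suc (Suc j))" "smult_vec f v' - d (Suc j) w' \<in> VA k"
      using ann[of "Suc j"] by (auto simp: annihilates_def boundary_def)
    have "(smult_vec f v' - d (Suc j) w') + smult_vec (l k) (smult_vec f w) =
        smult_vec (f * f) v - d (Suc j) w'"
      by (auto simp: v'_def fun_eq_iff algebra_simps)
    then have "smult_vec (f * f) v - d (Suc j) w' \<in> VA (Suc k)"
      using VA_add[OF VA_mono[OF _ w'(2), of "Suc k"] VA_l[OF k free_module_intros(4)[OF f w(1)]]]
      by (metis le_SucI order_refl)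
    then show ?thesis using w'(1) by (auto simp: boundary_def)
  qed
  then show ?thesis using Suc by (simp add: annihilates_def)
qed

text \<open>Modulo \<open>A 0\<close>, the zero ideal, the only homology is \<open>R/I\<close>,
  which \<open>f\<close> kills; each further linear form squares the multiplier, whence the exponent
  \<open>2 ^ k\<close>.\<close>

lemma annihilates_ideal:
  assumes "f \<in> I" "k \<le> Suc N"
  shows "annihilates (f ^ 2 ^ k) k i"
  using assms(2)
proof (induction k arbitrary: i)
  case (0 i)
  have "boundary 0 i (smult_vec f v)" if v: "v \<in> FM i" "cycle 0 i v" for v
  proof (cases i)
    case 0
    have "f \<in> polyring N" using assms(1) I_ideal ideal_polyring by blast
    moreover have "aug_map F (smult_vec f v) \<in> I"
      using ideal_mult[OF I_ideal aug_polyring assms(1), of v] v 0 by (simp add: aug_smult mult.commute)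
    moreover have "smult_vec f v \<in> FM 0"
      using v(1) 0 calculation(1) by (intro free_module_intros) auto
    ultimately obtain w where "w \<in> FM (Suc 0)" "smult_vec f v = d 0 w"
      using exact_0 by blast
    then show ?thesis using VA_0[of 0] 0 by (auto simp: boundary_def intro!: bexI[of _ w])
  next
    case (Suc j)
    have "d j v = 0" using v(2) Suc by (auto simp: VA_def A_0)
    then obtain w where "w \<in> FM (Suc i)" "v = d i w" using exact v(1) Suc by blast
    then have "boundary 0 i v" using VA_0[of 0] by (auto simp: boundary_def intro!: bexI[of _ w])
    then show ?thesis using boundary_smult assms(1) I_ideal ideal_polyring by blast
  qed
  then show ?case by (simp add: annihilates_def)
next
  case (Suc k i)
  have "annihilates (f ^ 2 ^ k * f ^ 2 ^ k) (Suc k) i"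
    using Suc assms(1) I_ideal ideal_polyring by (intro annihilates_Suc polys_power) auto
  then show ?case by (simp add: power_add[symmetric] mult_2)
qed

text \<open>A nonzero class of \<open>H\<^sub>i\<close> modulo \<open>A k\<close>, multiplied by the last power of \<open>l k\<close> that does not kill it,
  lies in the image of \<open>H\<^sub>i\<^sub>+\<^sub>1\<close> modulo \<open>A (Suc k)\<close> under the connecting map.\<close>

lemma homology_vanishes_descend:
  assumes k: "k \<le> N" and van: "\<And>t. t \<ge> s + 1 \<Longrightarrow> homology_vanishes (Suc k) (Suc i) t"
    and nil: "\<And>v. v \<in> FM i \<Longrightarrow> cycle k i v \<Longrightarrow> \<exists>q. boundary k i (smult_vec (l k ^ q) v)"
  shows "homology_vanishes k i s"
  unfolding homology_vanishes_def
proof (intro ballI impI)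
  fix v assume v: "v \<in> HV i s" "cycle k i v"
  show "boundary k i v"
  proof (rule ccontr)
    assume nb: "\<not> boundary k i v"
    define q where "q = (LEAST q. boundary k i (smult_vec (l k ^ q) v))"
    have q: "boundary k i (smult_vec (l k ^ q) v)"
      unfolding q_def by (rule LeastI_ex[OF nil[OF HV_FM[OF v(1)] v(2)]])
    have "q \<noteq> 0" using q nb by (metis (no_types, lifting) ext mult_1 power_0 smult_vec_apply)
    then obtain a where a: "q = Suc a" by (cases q) auto
    define u where "u = smult_vec (l k ^ a) v"
    have u: "u \<in> HV i (int a + s)"
      using HV_smult[OF forms_power[OF l_form[OF k], of a] v(1)] by (simp add: u_def)
    have "\<not> boundary k i u"
      unfolding u_def by (rule not_less_Least[of a "\<lambda>q. boundary k i (smult_vec (l k ^ q) v)"])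
        (metis a lessI q_def)
    moreover have "boundary k i u"
    proof -
      have lu: "smult_vec (l k) u = smult_vec (l k ^ q) v" by (simp add: u_def a smult_vec_def mult.assoc)
      have "smult_vec (l k) u \<in> HV i (1 + (int a + s))" by (rule HV_smult[OF l_form[OF k] u])
      then obtain w where w: "w \<in> HV (Suc i) (1 + (int a + s))" "smult_vec (l k) u - d i w \<in> VA k"
        using boundary_HV[of k i "smult_vec (l k) u"] q lu by metis
      \<comment> \<open>Modulo \<open>A (Suc k)\<close> the product of \<open>l k\<close> and
        \<open>u\<close> vanishes too, so \<open>w\<close> is a cycle there. Its degree
        \<open>1 + (int a + s)\<close> is in the range where the homology is known to be 0.\<close>
      have "d i w = smult_vec (l k) u - (smult_vec (l k) u - d i w)" by simp
      then have "d i w \<in> VA (Suc k)"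
        using VA_diff[OF VA_l[OF k HV_FM[OF u]] VA_mono[OF _ w(2)]] by simp
      then obtain y where y: "y \<in> FM (Suc (Suc i))" "w - d (Suc i) y \<in> VA (Suc k)"
        using van[of "1 + (int a + s)"] w(1) by (auto simp: homology_vanishes_def boundary_def)
      have "w - d (Suc i) y \<in> FM (Suc i)"
        using HV_FM[OF w(1)] d_FM[OF y(1)] by (rule free_module_intros)
      then obtain r where r: "r \<in> FM (Suc i)" "(w - d (Suc i) y) - smult_vec (l k) r \<in> VA k"
        using VA_Suc_split[OF k y(2)] by blast
      \<comment> \<open>\<open>d\<close> kills the boundary subtracted from \<open>w\<close>, so the
        product of \<open>l k\<close> and \<open>r\<close> may replace \<open>w\<close>, and
        \<open>l k\<close> cancels: \<open>u\<close> itself is a boundary.\<close>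
      have "smult_vec (l k) (u - d i r) =
          (smult_vec (l k) u - d i w) + d i ((w - d (Suc i) y) - smult_vec (l k) r)"
        using d_d[OF y(1)] by (simp add: d_diff d_smult) (auto simp: fun_eq_iff algebra_simps)
      then have "smult_vec (l k) (u - d i r) \<in> VA k"
        using VA_add[OF w(2) d_VA[OF r(2)]] by simp
      then have "u - d i r \<in> VA k"
        using VA_l_cancel[OF k free_module_intros(3)[OF HV_FM[OF u] d_FM[OF r(1)]]] by blast
      then show ?thesis using r(1) by (auto simp: boundary_def)
    qed
    ultimately show False by simp
  qed
qed

text \<open>\<open>M\<close> expresses that \<open>R/(I + A n1)\<close> has finite length and makes
  the remaining linear forms nilpotent; the bound \<open>s0\<close> on the degrees comes from the
  Tor module with index \<open>e\<close>.\<close>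

lemma generation_bound:
  assumes n1: "n1 + e = Suc N" and fin: "\<And>p. p \<in> forms N (int M) \<Longrightarrow> p \<in> set_sum I (A n1)"
    and van: "\<And>s. s \<ge> int e + s0 \<Longrightarrow> homology_vanishes (Suc N) e s"
    and s: "s \<ge> s0" and p: "p \<in> forms N s"
  shows "p \<in> set_sum I (A n1)"
proof -
  have nil: "\<exists>q. boundary k i (smult_vec (l k ^ q) v)"
    if k: "n1 \<le> k" "k \<le> N" and v: "v \<in> FM i" "cycle k i v" for k i v
  proof -
    \<comment> \<open>Modulo \<open>A n1\<close> this power of \<open>l k\<close> equals an element
      \<open>f\<close> of \<open>I\<close>, and a power of \<open>f\<close> kills the
      homology.\<close>
    have "l k ^ M \<in> forms N (int M)" using forms_power[OF l_form[OF k(2)], of M] by simp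
    then obtain f where f: "f \<in> I" "l k ^ M - f \<in> A n1"
      using fin by (fastforce simp: set_sum_def)
    have fp: "f \<in> polyring N" using f(1) I_ideal ideal_polyring by blast
    have "(l k ^ M) ^ 2 ^ k - f ^ 2 ^ k \<in> A k"
      using A_mono[OF k(1)] f(2)
      by (intro power_diff_ideal[where N = N] A_ideal polys_power l_polyring k fp) auto
    then have "f ^ 2 ^ k - (l k ^ M) ^ 2 ^ k \<in> A k" using ideal_uminus[OF A_ideal] by fastforce
    then have "smult_vec (f ^ 2 ^ k) v - smult_vec ((l k ^ M) ^ 2 ^ k) v \<in> VA k"
      using ideal_mult[OF A_ideal free_module_polyring[OF v(1)], of "f ^ 2 ^ k - (l k ^ M) ^ 2 ^ k" k]
      by (auto simp: VA_def algebra_simps)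
    moreover have "boundary k i (smult_vec (f ^ 2 ^ k) v)"
      using annihilates_ideal[OF f(1), of k i] k v by (simp add: annihilates_def)
    ultimately show ?thesis using boundary_cong by (metis power_mult)
  qed
  \<comment> \<open>From index \<open>e\<close> modulo all linear forms down to index 0 modulo
    \<open>A n1\<close>: each step drops one linear form and lowers the index and the degree bound
    by one.\<close>
  have "homology_vanishes (n1 + j) j t" if "j \<le> e" "t \<ge> int j + s0" for j t
    using that
  proof (induction j arbitrary: t rule: inc_induct)
    case base
    then show ?case using van n1 by simp
  next
    case (step j)
    show ?case
    proof (rule homology_vanishes_descend)
      show "homology_vanishes (Suc (n1 + j)) (Suc j) t'" if "t' \<ge> t + 1" for t'
        using step.IH[of t'] step.prems that by simp
      show "\<exists>q. boundary (n1 + j) j (smult_vec (l (n1 + j) ^ q) v)" if "v \<in> FM j" "cycle (n1 + j) j v" for v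
        using nil[OF _ _ that] n1 step.hyps by simp
    qed (use n1 step.hyps in simp)
  qed
  from this[of 0 s] have van0: "homology_vanishes n1 0 s" using s by simp
  \<comment> \<open>Back to ideals: \<open>p\<close> is lifted to \<open>F\<^sub>0\<close>, the lift
    is made homogeneous, and a boundary is subtracted from it.\<close>
  obtain v where v: "v \<in> FM 0" "p - aug_map F v \<in> I"
    using aug_surj forms_polyring[OF p] by blast
  define v' where "v' = vcomp 0 s v"
  have v': "v' \<in> HV 0 s" using v(1) by (simp add: v'_def vcomp_HV)
  have "p - aug_map F v' \<in> I"
  proof -
    have "hcomp s (p - aug_map F v) \<in> I" using I_homogeneous v(2) by (simp add: homogeneous_set_def)
    then show ?thesis using p v(1) by (simp add: v'_def aug_vcomp hcomp_diff hcomp_form)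
  qed
  moreover obtain w where w: "w \<in> FM (Suc 0)" "v' - d 0 w \<in> VA n1"
    using van0 v' by (auto simp: homology_vanishes_def boundary_def)
  ultimately have "(p - aug_map F v') + aug_map F (d 0 w) \<in> I"
    using aug_d I_ideal ideal_add by blast
  moreover have "aug_map F v' - aug_map F (d 0 w) \<in> A n1"
    using aug_VA[OF w(2)] by (simp add: aug_diff)
  moreover have "p = ((p - aug_map F v') + aug_map F (d 0 w)) + (aug_map F v' - aug_map F (d 0 w))"
    by simp
  ultimately show ?thesis unfolding set_sum_def by blast
qed

end

lemma sum_fun_apply: "(sum f A) x = (\<Sum>a\<in>A. f a x)"
  for f :: "'a \<Rightarrow> 'b \<Rightarrow> 'c::comm_monoid_add"
  by (induction A rule: infinite_finite_induct) auto

text \<open>\<open>tor_dim\<close> is a truncated difference of dimensions, so its vanishing gives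
  an inequality only. With a finite spanning set this forces the larger space into the smaller
  one.\<close>

lemma subspace_eq_if_dim_le:
  fixes B Z :: "('v \<Rightarrow> 'k::field) set"
  assumes "vec.subspace B" "B \<subseteq> Z" "finite T" "Z \<subseteq> vec.span T" "vec.dim Z \<le> vec.dim B"
  shows "Z \<subseteq> B"
proof
  fix z assume z: "z \<in> Z"
  obtain bs where bs: "bs \<subseteq> B" "vec.independent bs" "B \<subseteq> vec.span bs" "card bs = vec.dim B"
    using vec.maximal_independent_subset[of B] vec.basis_card_eq_dim by metis
  show "z \<in> B"
  proof (rule ccontr)
    assume "z \<notin> B"
    then have zn: "z \<notin> vec.span bs" using vec.span_minimal[OF bs(1) assms(1)] by blast
    then have ind: "vec.independent (insert z bs)" using bs(2) vec.independent_insertI by blast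
    have sub: "insert z bs \<subseteq> Z" using z bs(1) assms(2) by blast
    obtain cs where cs: "insert z bs \<subseteq> cs" "cs \<subseteq> Z" "vec.independent cs" "Z \<subseteq> vec.span cs"
      using vec.maximal_independent_subset_extend[OF sub ind] by blast
    have "finite cs"
      using vec.independent_span_bound[OF assms(3) cs(3)] cs(2) assms(4) by blast
    then have "card (insert z bs) \<le> card cs" "finite bs"
      using cs(1) by (auto intro: card_mono finite_subset)
    moreover have "z \<notin> bs" using zn vec.span_base by blast
    moreover have "card cs = vec.dim Z" using vec.basis_card_eq_dim[OF cs(2,4,3)] .
    ultimately show False using bs(4) assms(5) by simp
  qed
qed

section \<open>Homology modulo all linear forms and graded Betti numbers\<close>

context resolution
begin

lemma aug_add: "aug_map F (v + w) = aug_map F v + aug_map F w"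
  by (auto simp: aug_map_def algebra_simps sum.distrib)

lemma tensor_part_subspace: "vec.subspace (tensor_part F i s)"
proof (rule vec.subspaceI)
  show "v + w \<in> tensor_part F i s" if "v \<in> tensor_part F i s" "w \<in> tensor_part F i s" for v w
    using that unfolding tensor_part_def mem_Collect_eq by (metis add_0 plus_fun_apply)
qed (auto simp: tensor_part_def scale_vec_def)

lemma tensor_part_finite_span: "\<exists>T. finite T \<and> tensor_part F i s \<subseteq> vec.span T"
proof -
  define \<delta> where "\<delta> b = (\<lambda>c. if c = b then 1 else 0 :: 'k)" for b :: nat
  have "v \<in> vec.span (\<delta> ` {..<rk i})" if "v \<in> tensor_part F i s" for v
  proof -
    have "v = (\<Sum>b<rk i. scale_vec (v b) (\<delta> b))"
    proof
      fix c
      have "(\<Sum>b<rk i. scale_vec (v b) (\<delta> b)) c = (\<Sum>b<rk i. if b = c then v c else 0)"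
        unfolding sum_fun_apply by (rule sum.cong) (auto simp: scale_vec_def \<delta>_def)
      then show "v c = (\<Sum>b<rk i. scale_vec (v b) (\<delta> b)) c"
        using that by (auto simp: tensor_part_def)
    qed
    then show ?thesis
      by (metis (no_types, lifting) imageI vec.span_base vec.span_scale vec.span_sum)
  qed
  then show ?thesis by (intro exI[of _ "\<delta> ` {..<rk i}"]) auto
qed

definition constants :: "nat \<Rightarrow> (nat \<Rightarrow> 'k) \<Rightarrow> nat \<Rightarrow> (nat, 'k) mpoly" where
  "constants i v = (\<lambda>b. if b < rk i then single 0 (v b) else 0)"

lemma constants_FM: "constants i v \<in> FM i"
  by (auto simp: constants_def free_module_def intro: polys_single)

lemma constants_HV: "v \<in> tensor_part F i s \<Longrightarrow> constants i v \<in> HV i s"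
proof -
  assume v: "v \<in> tensor_part F i s"
  have "constants i v b \<in> forms N (s - dg i b)" for b
    using v forms_const[of "v b" N] by (cases "v b = 0") (auto simp: constants_def tensor_part_def)
  then show ?thesis using constants_FM by (simp add: HV_def)
qed

lemma VA_top_iff: "v \<in> FM i \<Longrightarrow> v \<in> VA (Suc N) \<longleftrightarrow> (\<forall>b<rk i. lookup (v b) 0 = 0)"
  unfolding VA_def A_top mem_Collect_eq
  using free_module_polyring[of v N "rk i"] by (auto simp: free_module_def) (metis lookup_zero not_le)

lemma lookup_d_0: "a < rk i \<Longrightarrow> lookup (d i v a) 0 =
    (\<Sum>b<rk (Suc i). lookup (bdry F i a b) 0 * lookup (v b) 0)"
  by (simp add: bdry_map_def lookup_0_eval)

lemma lookup_d_constants: "a < rk i \<Longrightarrow> lookup (d i (constants (Suc i) v) a) 0 = tensor_bdry F i v a"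
  by (simp add: lookup_d_0 tensor_bdry_def constants_def)

text \<open>A form has a nonzero constant term only in degree 0, that is for
  \<open>dg i b = s\<close>.\<close>

lemma lookup_HV_tensor_part: "v \<in> HV i s \<Longrightarrow> (\<lambda>b. lookup (v b) 0) \<in> tensor_part F i s"
proof -
  assume v: "v \<in> HV i s"
  have "b < rk i \<and> dg i b = s" if "lookup (v b) 0 \<noteq> 0" for b
  proof -
    have "0 \<in> keys (v b)" using that by (simp add: in_keys_iff)
    moreover have "v b \<in> forms N (s - dg i b)" using v by (simp add: HV_def)
    ultimately have "dg i b = s" by (auto simp: forms_def)
    moreover have "b < rk i" using v that by (auto simp: HV_def free_module_def) (metis lookup_zero not_le)
    ultimately show ?thesis by simp
  qed
  then show ?thesis by (simp add: tensor_part_def)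
qed

lemma tensor_bdry_lookup:
  "tensor_bdry F i (\<lambda>b. lookup (v b) 0) = (\<lambda>a. if a < rk i then lookup (d i v a) 0 else 0)"
  by (auto simp: tensor_bdry_def lookup_d_0 fun_eq_iff)

lemma boundaries_subset_cycles: "tensor_boundaries F (Suc i) s \<subseteq> tensor_cycles F (Suc i) s"
proof
  fix v assume "v \<in> tensor_boundaries F (Suc i) s"
  then obtain w where w: "w \<in> tensor_part F (Suc (Suc i)) s" "v = tensor_bdry F (Suc i) w"
    by (auto simp: tensor_boundaries_def)
  define W where "W = d (Suc i) (constants (Suc (Suc i)) w)"
  have W: "W \<in> HV (Suc i) s" unfolding W_def by (intro d_HV constants_HV w)
  have v: "v = (\<lambda>b. lookup (W b) 0)"
  proof
    fix b show "v b = lookup (W b) 0"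
      by (cases "b < rk (Suc i)")
        (simp add: w(2) W_def lookup_d_constants, simp add: w(2) W_def tensor_bdry_def bdry_map_def)
  qed
  have "d i W = 0" unfolding W_def by (intro d_d constants_FM)
  then have "tensor_bdry F i v = 0" by (auto simp: v tensor_bdry_lookup fun_eq_iff)
  then show "v \<in> tensor_cycles F (Suc i) s" using lookup_HV_tensor_part[OF W] by (simp add: v)
qed

text \<open>\<open>A (Suc N)\<close> consists of the polynomials without constant term, so
  congruence modulo \<open>VA (Suc N)\<close> compares constant terms, and \<open>constants\<close>
  lifts vectors over the field back to \<open>F\<close>.\<close>

lemma homology_vanishes_iff:
  "homology_vanishes (Suc N) (Suc i) s \<longleftrightarrow> tensor_cycles F (Suc i) s \<subseteq> tensor_boundaries F (Suc i) s"
proof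
  assume van: "homology_vanishes (Suc N) (Suc i) s"
  show "tensor_cycles F (Suc i) s \<subseteq> tensor_boundaries F (Suc i) s"
  proof
    fix v assume "v \<in> tensor_cycles F (Suc i) s"
    then have v: "v \<in> tensor_part F (Suc i) s" "tensor_bdry F i v = 0" by auto
    have "cycle (Suc N) (Suc i) (constants (Suc i) v)"
      using VA_top_iff[OF d_FM[OF constants_FM]] v(2) by (simp add: lookup_d_constants)
    then have "boundary (Suc N) (Suc i) (constants (Suc i) v)"
      using van constants_HV[OF v(1)] by (simp add: homology_vanishes_def)
    then obtain w where w: "w \<in> HV (Suc (Suc i)) s" "constants (Suc i) v - d (Suc i) w \<in> VA (Suc N)"
      using boundary_HV constants_HV[OF v(1)] by blast
    have "v b = tensor_bdry F (Suc i) (\<lambda>b. lookup (w b) 0) b" for b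
    proof (cases "b < rk (Suc i)")
      case True
      then have "lookup (constants (Suc i) v b - d (Suc i) w b) 0 = 0"
        using VA_top_iff[OF free_module_intros(3)[OF constants_FM d_FM[OF HV_FM[OF w(1)]]]] w(2) by auto
      then show ?thesis using True by (simp add: tensor_bdry_lookup lookup_minus constants_def)
    next
      case False
      then show ?thesis using v(1) by (auto simp: tensor_part_def tensor_bdry_def)
    qed
    then show "v \<in> tensor_boundaries F (Suc i) s"
      using lookup_HV_tensor_part[OF w(1)] by (auto simp: tensor_boundaries_def fun_eq_iff)
  qed
next
  assume sub: "tensor_cycles F (Suc i) s \<subseteq> tensor_boundaries F (Suc i) s"
  show "homology_vanishes (Suc N) (Suc i) s"
    unfolding homology_vanishes_def
  proof (intro ballI impI)
    fix v assume v: "v \<in> HV (Suc i) s" "cycle (Suc N) (Suc i) v"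
    have "tensor_bdry F i (\<lambda>b. lookup (v b) 0) = 0"
      using v VA_top_iff[OF d_FM[OF HV_FM[OF v(1)]]] by (auto simp: tensor_bdry_lookup fun_eq_iff)
    then have "(\<lambda>b. lookup (v b) 0) \<in> tensor_boundaries F (Suc i) s"
      using lookup_HV_tensor_part[OF v(1)] sub by auto
    then obtain w where w: "w \<in> tensor_part F (Suc (Suc i)) s"
        "(\<lambda>b. lookup (v b) 0) = tensor_bdry F (Suc i) w"
      by (auto simp: tensor_boundaries_def)
    have "lookup ((v - d (Suc i) (constants (Suc (Suc i)) w)) b) 0 = 0" if "b < rk (Suc i)" for b
      using fun_cong[OF w(2), of b] that by (simp add: lookup_minus lookup_d_constants)
    then have "v - d (Suc i) (constants (Suc (Suc i)) w) \<in> VA (Suc N)"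
      using VA_top_iff[OF free_module_intros(3)[OF HV_FM[OF v(1)] d_FM[OF constants_FM]]] by blast
    then show "boundary (Suc N) (Suc i) v" using constants_FM by (auto simp: boundary_def)
  qed
qed

lemma tensor_bdry_add: "tensor_bdry F i (v + w) = tensor_bdry F i v + tensor_bdry F i w"
  by (auto simp: tensor_bdry_def fun_eq_iff algebra_simps sum.distrib)

lemma tensor_bdry_scale: "tensor_bdry F i (scale_vec c v) = scale_vec c (tensor_bdry F i v)"
  by (auto simp: tensor_bdry_def scale_vec_def fun_eq_iff sum_distrib_left mult.left_commute intro!: sum.cong)

lemma tensor_boundaries_subspace: "vec.subspace (tensor_boundaries F i s)"
proof (rule vec.subspaceI)
  note sub = tensor_part_subspace[of "Suc i" s]
  have "tensor_bdry F i 0 = 0" by (auto simp: tensor_bdry_def fun_eq_iff)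
  then show "0 \<in> tensor_boundaries F i s"
    using vec.subspace_0[OF sub] unfolding tensor_boundaries_def by (metis imageI)
  show "v + w \<in> tensor_boundaries F i s"
    if "v \<in> tensor_boundaries F i s" "w \<in> tensor_boundaries F i s" for v w
    using that vec.subspace_add[OF sub] unfolding tensor_boundaries_def
    by (auto simp flip: tensor_bdry_add)
  show "scale_vec c v \<in> tensor_boundaries F i s" if "v \<in> tensor_boundaries F i s" for c v
    using that vec.subspace_scale[OF sub] unfolding tensor_boundaries_def
    by (auto simp flip: tensor_bdry_scale)
qed

lemma tor_vanishes_iff:
  "vec.dim (tensor_cycles F (Suc i) s) - vec.dim (tensor_boundaries F (Suc i) s) = 0
    \<longleftrightarrow> homology_vanishes (Suc N) (Suc i) s"
proof
  assume "vec.dim (tensor_cycles F (Suc i) s) - vec.dim (tensor_boundaries F (Suc i) s) = 0"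
  moreover obtain T where T: "finite T" "tensor_part F (Suc i) s \<subseteq> vec.span T"
    using tensor_part_finite_span by blast
  moreover have "tensor_cycles F (Suc i) s \<subseteq> vec.span T" using T(2) by auto
  ultimately show "homology_vanishes (Suc N) (Suc i) s"
    unfolding homology_vanishes_iff
    by (intro subspace_eq_if_dim_le[OF tensor_boundaries_subspace boundaries_subset_cycles]) auto
next
  assume "homology_vanishes (Suc N) (Suc i) s"
  then have "tensor_cycles F (Suc i) s = tensor_boundaries F (Suc i) s"
    using boundaries_subset_cycles homology_vanishes_iff by blast
  then show "vec.dim (tensor_cycles F (Suc i) s) - vec.dim (tensor_boundaries F (Suc i) s) = 0"
    by simp
qed

text \<open>The identification of \<open>H\<^sub>0\<close> modulo \<open>A k\<close> with
  \<open>R/(I + A k)\<close>.\<close>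

lemma boundary_0_iff:
  assumes "v \<in> FM 0" "k \<le> Suc N"
  shows "boundary k 0 v \<longleftrightarrow> aug_map F v \<in> set_sum I (A k)"
proof
  assume "boundary k 0 v"
  then obtain w where w: "w \<in> FM (Suc 0)" "v - d 0 w \<in> VA k" by (auto simp: boundary_def)
  have "aug_map F v = aug_map F (d 0 w) + (aug_map F v - aug_map F (d 0 w))" by simp
  then show "aug_map F v \<in> set_sum I (A k)"
    using aug_d[OF w(1)] aug_VA[OF w(2)] unfolding set_sum_def aug_diff by blast
next
  \<comment> \<open>Every element of \<open>A k\<close> is hit, up to \<open>I\<close>, by a vector
    with all entries in \<open>A k\<close>. As \<open>aug\<close> is surjective modulo
    \<open>I\<close> only, the vector is built one linear form at a time and the errors are
    collected in \<open>I\<close>.\<close>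
  have *: "\<exists>w. w \<in> VA k \<and> w \<in> FM 0 \<and> q - aug_map F w \<in> I" if "q \<in> A k" "k \<le> Suc N" for q k
    using that
  proof (induction k arbitrary: q)
    case 0
    then show ?case
      using VA_0 free_module_intros(1) ideal_0[OF I_ideal]
      by (intro exI[of _ "0 :: nat \<Rightarrow> (nat, 'k) mpoly"] conjI VA_0 free_module_intros)
        (simp add: A_0 aug_map_def)
  next
    case (Suc k)
    then obtain u where u: "u \<in> polyring N" "q - l k * u \<in> A k" using A_split by force
    obtain w where w: "w \<in> VA k" "w \<in> FM 0" "(q - l k * u) - aug_map F w \<in> I"
      using Suc u by auto
    obtain v where v: "v \<in> FM 0" "u - aug_map F v \<in> I" using aug_surj u(1) by blast
    have lv: "smult_vec (l k) v \<in> VA (Suc k)" "smult_vec (l k) v \<in> FM 0"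
      using VA_l[OF _ v(1)] Suc.prems(2) by (auto intro!: free_module_intros l_polyring v)
    have "((q - l k * u) - aug_map F w) + l k * (u - aug_map F v) = q - aug_map F (w + smult_vec (l k) v)"
      by (simp add: aug_add aug_smult algebra_simps)
    then have "q - aug_map F (w + smult_vec (l k) v) \<in> I"
      using ideal_add[OF I_ideal w(3) ideal_mult[OF I_ideal l_polyring v(2)]] Suc.prems(2)
      by (metis Suc_le_mono)
    moreover have "w \<in> VA (Suc k)" by (rule VA_mono[OF _ w(1)]) simp
    ultimately show ?case
      using VA_add[OF _ lv(1)] free_module_intros(2)[OF w(2) lv(2)] by blast
  qed
  assume "aug_map F v \<in> set_sum I (A k)"
  then obtain p q where pq: "aug_map F v = p + q" "p \<in> I" "q \<in> A k" by (auto simp: set_sum_def)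
  obtain w where w: "w \<in> VA k" "w \<in> FM 0" "q - aug_map F w \<in> I" using *[OF pq(3) assms(2)] by blast
  have "aug_map F (v - w) = p + (q - aug_map F w)" by (simp add: aug_diff pq(1))
  then have "aug_map F (v - w) \<in> I" using ideal_add[OF I_ideal pq(2) w(3)] by simp
  then obtain y where "y \<in> FM (Suc 0)" "v - w = d 0 y"
    using exact_0 free_module_intros(3)[OF assms(1) w(2)] by blast
  moreover from this(2) have "v - d 0 y = w" by (metis diff_diff_eq2 add_diff_cancel_left')
  ultimately show "boundary k 0 v" using w(1) by (auto simp: boundary_def)
qed

section \<open>Vanishing beyond index e and below the linear strand\<close>

lemma homology_vanishes_0: "homology_vanishes 0 (Suc i) s"
  unfolding homology_vanishes_def
proof (intro ballI impI)
  fix v assume v: "v \<in> HV (Suc i) s" "cycle 0 (Suc i) v"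
  have "d i v = 0" using v(2) by (auto simp: VA_def A_0)
  then obtain w where "w \<in> FM (Suc (Suc i))" "v = d (Suc i) w" using exact HV_FM[OF v(1)] by blast
  then show "boundary 0 (Suc i) v" using VA_0[of 0] by (auto simp: boundary_def intro!: bexI[of _ w])
qed

text \<open>While the linear forms are regular on \<open>R/I\<close>, all homology of positive index
  stays 0. After that, each of the other \<open>e\<close> forms can make at most one more index
  nonzero.\<close>

lemma high_homology_vanishes:
  assumes n1: "n1 + e = Suc N"
    and reg: "\<And>k u. k < n1 \<Longrightarrow> u \<in> polyring N \<Longrightarrow> l k * u \<in> set_sum I (A k) \<Longrightarrow> u \<in> set_sum I (A k)"
    and i: "e < i"
  shows "homology_vanishes (Suc N) i s"
proof -
  have 1: "homology_vanishes k (Suc i) s" if "k \<le> n1" for k i s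
    using that
  proof (induction k arbitrary: i s)
    case 0
    then show ?case by (simp add: homology_vanishes_0)
  next
    case (Suc k i s)
    show ?case
    proof (rule homology_vanishes_Suc)
      show "k \<le> N" using Suc.prems n1 i by simp
      then have kN: "k \<le> Suc N" by simp
      show "homology_vanishes k (Suc i) s" using Suc by simp
      fix u assume u: "u \<in> HV i (s - 1)" "cycle k i u" "boundary k i (smult_vec (l k) u)"
      show "boundary k i u"
      proof (cases i)
        case 0
        have "smult_vec (l k) u \<in> FM 0"
          using HV_FM[OF u(1)] 0 \<open>k \<le> N\<close> by (auto intro!: free_module_intros l_polyring)
        then have "l k * aug_map F u \<in> set_sum I (A k)"
          using boundary_0_iff[OF _ kN] u(3) 0 by (auto simp: aug_smult)
        then have "aug_map F u \<in> set_sum I (A k)"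
          using reg aug_polyring HV_FM[OF u(1)] Suc.prems 0 by simp
        then show ?thesis using boundary_0_iff[OF _ kN] HV_FM[OF u(1)] 0 by auto
      next
        case (Suc j)
        then have "homology_vanishes k i (s - 1)" using Suc.IH Suc.prems by simp
        then show ?thesis using u by (simp add: homology_vanishes_def)
      qed
    qed
  qed
  have "homology_vanishes (n1 + j) i s" if "j \<le> e" "j < i" for j i s
    using that
  proof (induction j arbitrary: i s)
    case (0 i s)
    then show ?case using 1[of n1 "i - 1"] by simp
  next
    case (Suc j i s)
    then obtain i' where i': "i = Suc i'" by (cases i) auto
    show ?case
      using homology_vanishes_Suc_Suc[of "n1 + j" i' s] Suc i' n1 by simp
  qed
  from this[of e i] show ?thesis using i n1 by simp
qed

text \<open>The bound on \<open>s\<close> drops with the index, so the question reduces to a class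
  of index 0 whose product with \<open>l k\<close> has degree less than \<open>d0\<close>. There
  \<open>I\<close> contributes nothing: a congruence modulo \<open>I + A k\<close> is one modulo
  \<open>A k\<close>, and \<open>l k\<close> cancels.\<close>

lemma low_homology_vanishes:
  assumes low: "\<And>t p. p \<in> I \<Longrightarrow> p \<in> forms N t \<Longrightarrow> t < d0 \<Longrightarrow> p = 0"
    and s: "s < int (Suc i) + d0 - 1"
  shows "homology_vanishes (Suc N) (Suc i) s"
proof -
  have "homology_vanishes k (Suc i) s" if "k \<le> Suc N" "s < int (Suc i) + d0 - 1" for k i s
    using that
  proof (induction k arbitrary: i s)
    case 0
    then show ?case by (simp add: homology_vanishes_0)
  next
    case (Suc k i s)
    then have k: "k \<le> N" "k \<le> Suc N" by auto
    show ?case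
    proof (rule homology_vanishes_Suc[OF k(1)])
      show "homology_vanishes k (Suc i) s" using Suc by simp
      fix u assume u: "u \<in> HV i (s - 1)" "cycle k i u" "boundary k i (smult_vec (l k) u)"
      show "boundary k i u"
      proof (cases i)
        case 0
        have "smult_vec (l k) u \<in> FM 0"
          using HV_FM[OF u(1)] 0 k by (auto intro!: free_module_intros l_polyring)
        then have "l k * aug_map F u \<in> set_sum I (A k)"
          using boundary_0_iff[OF _ k(2)] u(3) 0 by (auto simp: aug_smult)
        then obtain p q where pq: "l k * aug_map F u = p + q" "p \<in> I" "q \<in> A k"
          by (auto simp: set_sum_def)
        have form: "l k * aug_map F u \<in> forms N s"
          using forms_mult[OF l_form[OF k(1)] aug_HV, of u "s - 1"] u(1) 0 by simp
        have "hcomp s p = 0"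
          using low[of "hcomp s p" s] pq(2) I_homogeneous I_ideal Suc.prems 0
          by (auto simp: homogeneous_set_def intro: hcomp_forms dest: ideal_polyring)
        then have "l k * aug_map F u = hcomp s q"
          using hcomp_form[OF form, of s] by (simp add: pq(1) hcomp_add)
        then have "l k * aug_map F u \<in> A k" using A_homogeneous pq(3) by (simp add: homogeneous_set_def)
        then have "aug_map F u \<in> A k"
          using l_nonzerodivisor[OF k(1) aug_polyring] HV_FM[OF u(1)] 0 by simp
        then have "aug_map F u \<in> set_sum I (A k)" by (rule set_sum_right[OF I_ideal])
        then show ?thesis using boundary_0_iff[OF _ k(2)] HV_FM[OF u(1)] 0 by auto
      next
        case (Suc j)
        then have "homology_vanishes k i (s - 1)" using Suc.IH Suc.prems by simp
        then show ?thesis using u by (simp add: homology_vanishes_def)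
      qed
    qed
  qed
  then show ?thesis using s by simp
qed

end

section \<open>Noetherianity and existence of graded free resolutions\<close>

text \<open>A decreasing sequence of naturals attains its minimum, and from there on it is constant,
  hence monotone.\<close>

lemma nat_mono_subseq:
  fixes g :: "nat \<Rightarrow> nat"
  shows "\<exists>\<phi> :: nat \<Rightarrow> nat. strict_mono \<phi> \<and> mono (\<lambda>i. g (\<phi> i))"
proof -
  obtain \<phi> :: "nat \<Rightarrow> nat" where \<phi>: "strict_mono \<phi>" "monoseq (\<lambda>i. g (\<phi> i))" using seq_monosub[of g] by blast
  show ?thesis
  proof (cases "mono (\<lambda>i. g (\<phi> i))")
    case False
    then have anti: "g (\<phi> j) \<le> g (\<phi> i)" if "i \<le> j" for i j
      using \<phi>(2) that by (auto simp: monoseq_def mono_def)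
    obtain i0 where i0: "\<And>j. g (\<phi> i0) \<le> g (\<phi> j)"
      using exists_least_lemma[of "\<lambda>y. \<exists>i. g (\<phi> i) \<le> y"] arg_min_nat_le[of "\<lambda>_. True" _ "\<lambda>i. g (\<phi> i)"]
      by metis
    have "g (\<phi> (i0 + j)) = g (\<phi> i0)" for j using i0 anti[of i0 "i0 + j"] by (simp add: le_antisym)
    moreover have "strict_mono (\<lambda>j. \<phi> (i0 + j))" using \<phi>(1) by (simp add: strict_mono_def)
    ultimately show ?thesis by (intro exI[of _ "\<lambda>j. \<phi> (i0 + j)"]) (simp add: mono_def)
  qed (use \<phi>(1) in blast)
qed

lemma nat_mono_subseq_multi:
  fixes g :: "nat \<Rightarrow> nat \<Rightarrow> nat"
  shows "\<exists>\<phi> :: nat \<Rightarrow> nat. strict_mono \<phi> \<and> (\<forall>c<C. mono (\<lambda>i. g c (\<phi> i)))"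
proof (induction C)
  case 0
  then show ?case by (intro exI[of _ id]) (auto simp: strict_mono_def)
next
  case (Suc C)
  then obtain \<phi> :: "nat \<Rightarrow> nat" where \<phi>: "strict_mono \<phi>" "\<forall>c<C. mono (\<lambda>i. g c (\<phi> i))" by blast
  obtain \<psi> :: "nat \<Rightarrow> nat" where \<psi>: "strict_mono \<psi>" "mono (\<lambda>i. g C (\<phi> (\<psi> i)))"
    using nat_mono_subseq[of "\<lambda>i. g C (\<phi> i)"] by blast
  have "mono (\<lambda>i. g c (\<phi> (\<psi> i)))" if "c < C" for c
    using \<phi>(2) that strict_mono_less_eq[OF \<psi>(1)] unfolding mono_def by blast
  then show ?case
    using \<phi>(1) \<psi> by (intro exI[of _ "\<phi> \<circ> \<psi>"]) (auto simp: strict_mono_def less_Suc_eq)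
qed

text \<open>A pair \<open>(b, m)\<close> stands for the monomial \<open>m\<close> times the basis
  vector \<open>b\<close> in a free module of rank \<open>r\<close>.\<close>

definition terms :: "nat \<Rightarrow> nat \<Rightarrow> (nat \<times> (nat \<Rightarrow>\<^sub>0 nat)) set" where
  "terms N r = {(b, m). b < r \<and> keys m \<subseteq> {..N}}"

definition term_dvd :: "nat \<Rightarrow> nat \<times> (nat \<Rightarrow>\<^sub>0 nat) \<Rightarrow> nat \<times> (nat \<Rightarrow>\<^sub>0 nat) \<Rightarrow> bool" where
  "term_dvd N t t' \<longleftrightarrow> fst t = fst t' \<and> (\<exists>k. keys k \<subseteq> {..N} \<and> snd t' = snd t + k)"

lemma term_dvd_trans: "term_dvd N s t \<Longrightarrow> term_dvd N t u \<Longrightarrow> term_dvd N s u"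
proof -
  assume "term_dvd N s t" "term_dvd N t u"
  then obtain k k' where "keys k \<subseteq> {..N}" "keys k' \<subseteq> {..N}" "fst s = fst u" "snd u = snd s + (k + k')"
    by (auto simp: term_dvd_def add.assoc)
  moreover from this have "keys (k + k') \<subseteq> {..N}" by (simp add: keys_nat_add)
  ultimately show ?thesis unfolding term_dvd_def by blast
qed

lemma dickson:
  fixes f :: "nat \<Rightarrow> nat \<times> (nat \<Rightarrow>\<^sub>0 nat)"
  assumes "\<And>i. f i \<in> terms N r"
  obtains i j where "i < j" "term_dvd N (f i) (f j)"
proof -
  \<comment> \<open>The first two coordinates are the basis index and its complement in
    \<open>r\<close>; they can both grow weakly only if the index stays the same. The others are the
    \<open>N + 1\<close> exponents.\<close>
  define g where "g c i = (if c = 0 then fst (f i) else if c = 1 then r - fst (f i)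
    else lookup (snd (f i)) (c - 2))" for c i
  obtain \<phi> :: "nat \<Rightarrow> nat" where \<phi>: "strict_mono \<phi>" "\<forall>c<N + 3. mono (\<lambda>i. g c (\<phi> i))"
    using nat_mono_subseq_multi by blast
  have le: "g c (\<phi> 0) \<le> g c (\<phi> 1)" if "c < N + 3" for c
    using \<phi>(2) that by (simp add: mono_def)
  have keys: "keys (snd (f i)) \<subseteq> {..N}" and bound: "fst (f i) < r" for i
    using assms[of i] by (auto simp: terms_def split_beta)
  have "fst (f (\<phi> 0)) = fst (f (\<phi> 1))"
    using le[of 0] le[of 1] bound[of "\<phi> 0"] bound[of "\<phi> 1"] by (simp add: g_def)
  moreover have "snd (f (\<phi> 1)) = snd (f (\<phi> 0)) + (snd (f (\<phi> 1)) - snd (f (\<phi> 0)))"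
  proof (rule poly_mapping_eqI)
    fix c
    have "lookup (snd (f (\<phi> 0))) c \<le> lookup (snd (f (\<phi> 1))) c"
    proof (cases "c \<le> N")
      case True
      then show ?thesis using le[of "c + 2"] by (simp add: g_def)
    next
      case False
      then have "c \<notin> keys (snd (f (\<phi> 0)))" using keys[of "\<phi> 0"] by auto
      then show ?thesis by (simp add: in_keys_iff)
    qed
    then show "lookup (snd (f (\<phi> 1))) c = lookup (snd (f (\<phi> 0)) + (snd (f (\<phi> 1)) - snd (f (\<phi> 0)))) c"
      by (simp add: lookup_add lookup_minus)
  qed
  moreover have "keys (snd (f (\<phi> 1)) - snd (f (\<phi> 0))) \<subseteq> {..N}"
  proof -
    have "keys (snd (f (\<phi> 1)) - snd (f (\<phi> 0))) \<subseteq> keys (snd (f (\<phi> 1)))"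
      by (auto simp: in_keys_iff lookup_minus)
    then show ?thesis using keys[of "\<phi> 1"] by blast
  qed
  moreover have "\<phi> 0 < \<phi> 1" using \<phi>(1) by (simp add: strict_mono_def)
  ultimately show thesis using that[of "\<phi> 0" "\<phi> 1"] unfolding term_dvd_def by blast
qed

text \<open>The order is lexicographic, first by basis index and then by exponent vectors. It
  respects divisibility because the first nonzero entry of an exponent vector is positive.\<close>

lemma term_dvd_le: "term_dvd N t t' \<Longrightarrow> t \<le> t'"
proof -
  assume "term_dvd N t t'"
  then obtain k where k: "fst t = fst t'" "snd t' = snd t + k" by (auto simp: term_dvd_def)
  have "0 \<le> k"
  proof (cases "k = 0")
    case False
    then have ne: "keys k \<noteq> {}" by (simp add: keys_eq_empty)
    define j where "j = Min (keys k)"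
    have "0 < lookup k j" using Min_in[OF finite_keys ne] by (simp add: j_def in_keys_iff)
    moreover have "lookup k j' = 0" if "j' < j" for j'
      using that by (metis Min_le finite_keys in_keys_iff leD j_def)
    ultimately have "less_fun (lookup 0) (lookup k)" unfolding less_fun_def by (intro exI[of _ j]) simp
    then show ?thesis by (simp add: less_eq_poly_mapping.rep_eq)
  qed simp
  then have "snd t \<le> snd t'" using add_left_mono[of 0 k "snd t"] k(2) by simp
  then show ?thesis using k(1) by (auto simp: less_eq_prod_def)
qed

text \<open>In any infinite descent, Dickson's lemma finds an earlier term that divides, and so does
  not exceed, a later one.\<close>

lemma wf_terms: "wf {(t, t'). t < t' \<and> t \<in> terms N r \<and> t' \<in> terms N r}"
  unfolding wf_iff_no_infinite_down_chain
proof
  assume "\<exists>f. \<forall>i. (f (Suc i), f i) \<in> {(t, t'). t < t' \<and> t \<in> terms N r \<and> t' \<in> terms N r}"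
  then obtain f where f: "\<And>i. f (Suc i) < f i" "\<And>i. f i \<in> terms N r" by blast
  obtain i j where "i < j" "term_dvd N (f i) (f j)" using dickson f(2) by blast
  moreover have "f j < f i" if "i < j" for i j
    using that by (induction j) (auto simp: less_Suc_eq intro: f(1) less_trans[OF f(1)])
  ultimately show False using term_dvd_le by (metis leD)
qed

definition vec_terms :: "(nat \<Rightarrow> (nat, 'k::field) mpoly) \<Rightarrow> (nat \<times> (nat \<Rightarrow>\<^sub>0 nat)) set" where
  "vec_terms v = {(b, m). m \<in> keys (v b)}"

lemma vec_terms_subset: "v \<in> free_module N r \<Longrightarrow> vec_terms v \<subseteq> terms N r"
proof
  fix t assume v: "v \<in> free_module N r" and t: "t \<in> vec_terms v"
  then obtain b m where bm: "t = (b, m)" "m \<in> keys (v b)" by (auto simp: vec_terms_def)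
  then have "b < r" using v by (auto simp: free_module_def) (metis keys_zero empty_iff not_le)
  moreover have "keys m \<subseteq> {..N}" using free_module_polyring[OF v, of b] bm(2) by (simp add: polys_def)
  ultimately show "t \<in> terms N r" by (simp add: bm(1) terms_def)
qed

lemma finite_vec_terms: "v \<in> free_module N r \<Longrightarrow> finite (vec_terms v)"
proof -
  assume v: "v \<in> free_module N r"
  have "vec_terms v \<subseteq> (\<Union>b<r. Pair b ` keys (v b))"
    using vec_terms_subset[OF v] by (auto simp: vec_terms_def terms_def)
  then show ?thesis by (rule finite_subset) auto
qed

lemma vec_terms_eq_empty: "vec_terms v = {} \<longleftrightarrow> v = 0"
  by (auto simp: vec_terms_def fun_eq_iff simp flip: keys_eq_empty)

definition leading :: "(nat \<Rightarrow> (nat, 'k::field) mpoly) \<Rightarrow> nat \<times> (nat \<Rightarrow>\<^sub>0 nat)" where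
  "leading v = Max (vec_terms v)"

lemma leading_in: "v \<in> free_module N r \<Longrightarrow> v \<noteq> 0 \<Longrightarrow> leading v \<in> vec_terms v"
  unfolding leading_def by (rule Max_in) (auto simp: finite_vec_terms vec_terms_eq_empty)

lemma leading_ge: "v \<in> free_module N r \<Longrightarrow> t \<in> vec_terms v \<Longrightarrow> t \<le> leading v"
  unfolding leading_def by (rule Max_ge[OF finite_vec_terms])

text \<open>One division step: the multiple of \<open>v\<close> is scaled such that the leading
  coefficients cancel.\<close>

lemma leading_reduce:
  fixes v w :: "nat \<Rightarrow> (nat, 'k::field) mpoly"
  assumes v: "v \<in> free_module N r" "v \<noteq> 0" and w: "w \<in> free_module N r" "w \<noteq> 0"
    and dvd: "term_dvd N (leading v) (leading w)"
  shows "\<exists>p\<in>polyring N. w - smult_vec p v = 0 \<or> leading (w - smult_vec p v) < leading w"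
proof -
  obtain b m where bm: "leading v = (b, m)" by (cases "leading v")
  obtain k where k: "keys k \<subseteq> {..N}" "leading w = (b, m + k)"
    using dvd bm by (auto simp: term_dvd_def) (metis prod.collapse)
  define c where "c = lookup (w b) (m + k) / lookup (v b) m"
  define p where "p = single k c"
  have p: "p \<in> polyring N" unfolding p_def by (rule polys_single[OF k(1)])
  let ?u = "w - smult_vec p v"
  have u: "?u \<in> free_module N r" by (intro free_module_intros v w p)
  have "t < leading w" if t: "t \<in> vec_terms ?u" for t
  proof -
    obtain b' m' where t': "t = (b', m')" by (cases t)
    have le: "t \<le> leading w"
    proof (cases "t \<in> vec_terms w")
      case False
      then have "m' \<in> keys (p * v b')"
        using t by (auto simp: t' vec_terms_def in_keys_iff lookup_minus)
      then obtain m'' where m'': "m' = k + m''" "m'' \<in> keys (v b')"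
        using keys_single_mult[of k c "v b'"] by (auto simp: p_def)
      then have "(b', m'') \<le> (b, m)" using leading_ge[OF v(1), of "(b', m'')"] bm by (simp add: vec_terms_def)
      then show ?thesis by (auto simp: t' k(2) m''(1) less_eq_prod_def add.commute[of k])
    qed (use leading_ge[OF w(1)] in blast)
    have "m \<in> keys (v b)" using leading_in[OF v] by (simp add: bm vec_terms_def)
    then have "lookup (?u b) (m + k) = 0"
      using lookup_single_mult[of k c "v b" m]
      by (simp add: p_def lookup_minus c_def in_keys_iff add.commute)
    then have "t \<noteq> leading w" using t by (auto simp: k(2) vec_terms_def in_keys_iff)
    with le show ?thesis by simp
  qed
  then have "?u = 0 \<or> leading ?u < leading w" using leading_in[OF u] by blast
  then show ?thesis using p by blast
qed

definition submodule :: "nat \<Rightarrow> nat \<Rightarrow> (nat \<Rightarrow> (nat, 'k::field) mpoly) set \<Rightarrow> bool" where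
  "submodule N r M \<longleftrightarrow> M \<subseteq> free_module N r \<and> 0 \<in> M \<and> (\<forall>v\<in>M. \<forall>w\<in>M. v + w \<in> M) \<and>
     (\<forall>p\<in>polyring N. \<forall>v\<in>M. smult_vec p v \<in> M)"

lemma submodule_diff: "submodule N r M \<Longrightarrow> v \<in> M \<Longrightarrow> w \<in> M \<Longrightarrow> v - w \<in> M"
proof -
  assume M: "submodule N r M" "v \<in> M" "w \<in> M"
  have "v - w = v + smult_vec (- 1) w" by (auto simp: smult_vec_def fun_eq_iff)
  moreover have "smult_vec (- 1) w \<in> M"
    using M polys_uminus[OF polys_1, of "{..N}"] unfolding submodule_def by blast
  ultimately show ?thesis using M unfolding submodule_def by metis
qed

definition module_span :: "nat \<Rightarrow> (nat \<Rightarrow> (nat, 'k::field) mpoly) set \<Rightarrow> (nat \<Rightarrow> (nat, 'k) mpoly) set" where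
  "module_span N G = {(\<Sum>g\<in>G. smult_vec (p g) g) | p. \<forall>g. p g \<in> polyring N}"

lemma module_spanI: "\<forall>g. p g \<in> polyring N \<Longrightarrow> v = (\<Sum>g\<in>G. smult_vec (p g) g) \<Longrightarrow> v \<in> module_span N G"
  unfolding module_span_def by blast

lemma module_span_0: "0 \<in> module_span N G"
  unfolding module_span_def
  by (rule CollectI, rule exI[of _ "\<lambda>_. 0"]) (auto simp: fun_eq_iff sum_fun_apply)

lemma module_span_add: "v \<in> module_span N G \<Longrightarrow> w \<in> module_span N G \<Longrightarrow> v + w \<in> module_span N G"
proof -
  assume "v \<in> module_span N G" "w \<in> module_span N G"
  then obtain p q where pq: "\<forall>g. p g \<in> polyring N" "\<forall>g. q g \<in> polyring N"
    "v = (\<Sum>g\<in>G. smult_vec (p g) g)" "w = (\<Sum>g\<in>G. smult_vec (q g) g)"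
    by (auto simp: module_span_def)
  then have "v + w = (\<Sum>g\<in>G. smult_vec (p g + q g) g)"
    by (auto simp: fun_eq_iff sum_fun_apply algebra_simps sum.distrib)
  moreover have "\<forall>g. p g + q g \<in> polyring N" using pq by (simp add: polys_add)
  ultimately show ?thesis by (rule module_spanI[rotated])
qed

lemma module_span_smult: "q \<in> polyring N \<Longrightarrow> v \<in> module_span N G \<Longrightarrow> smult_vec q v \<in> module_span N G"
proof -
  assume q: "q \<in> polyring N" and "v \<in> module_span N G"
  then obtain p where p: "\<forall>g. p g \<in> polyring N" "v = (\<Sum>g\<in>G. smult_vec (p g) g)"
    by (auto simp: module_span_def)
  then have "smult_vec q v = (\<Sum>g\<in>G. smult_vec (q * p g) g)"
    by (auto simp: fun_eq_iff sum_fun_apply sum_distrib_left mult.assoc)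
  moreover have "\<forall>g. q * p g \<in> polyring N" using p q by (simp add: polys_mult)
  ultimately show ?thesis by (rule module_spanI[rotated])
qed

lemma module_span_base: "finite G \<Longrightarrow> g \<in> G \<Longrightarrow> g \<in> module_span N G"
proof (rule module_spanI[of "\<lambda>h. if h = g then 1 else 0"])
  assume G: "finite G" "g \<in> G"
  have "(\<Sum>h\<in>G. smult_vec (if h = g then 1 else 0) h) = (\<Sum>h\<in>G. if h = g then g else 0)"
    by (rule sum.cong) (auto simp: fun_eq_iff)
  then show "g = (\<Sum>h\<in>G. smult_vec (if h = g then 1 else 0) h)" using G by simp
qed simp

text \<open>A Groebner basis argument: the leading terms that are minimal for divisibility are
  finite in number by Dickson's lemma, and elements of \<open>M\<close> with these leading terms
  reduce every element of \<open>M\<close> to 0 by well-founded induction.\<close>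

theorem submodule_finitely_generated:
  fixes M :: "(nat \<Rightarrow> (nat, 'k::field) mpoly) set"
  assumes M: "submodule N r M"
  shows "\<exists>G. finite G \<and> G \<subseteq> M \<and> M \<subseteq> module_span N G"
proof -
  have MF: "v \<in> free_module N r" if "v \<in> M" for v using M that by (auto simp: submodule_def)
  define LT where "LT = leading ` (M - {0})"
  have LT: "LT \<subseteq> terms N r"
    unfolding LT_def using leading_in vec_terms_subset MF by blast
  define B where "B = {t\<in>LT. \<forall>t'\<in>LT. term_dvd N t' t \<longrightarrow> t' = t}"
  have "finite B"
  proof (rule ccontr)
    assume "infinite B"
    then obtain f :: "nat \<Rightarrow> _" where f: "inj f" "range f \<subseteq> B"
      using infinite_countable_subset by blast
    obtain i j where ij: "i < j" "term_dvd N (f i) (f j)"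
      using dickson[of f N r] f(2) LT unfolding B_def by blast
    then have "f i = f j" using f(2) unfolding B_def by blast
    then show False using f(1) ij(1) by (simp add: inj_eq)
  qed
  have minimal: "\<exists>t'\<in>B. term_dvd N t' t" if "t \<in> LT" for t
    using that
  proof (induction t rule: wf_induct_rule[OF wf_terms[of N r]])
    case (1 t)
    show ?case
    proof (cases "t \<in> B")
      case True
      moreover have "term_dvd N t t" by (auto simp: term_dvd_def intro!: exI[of _ 0])
      ultimately show ?thesis by blast
    next
      case False
      then obtain t' where t': "t' \<in> LT" "term_dvd N t' t" "t' \<noteq> t" using 1(2) by (auto simp: B_def)
      then have "t' < t" using term_dvd_le by fastforce
      then obtain t'' where "t'' \<in> B" "term_dvd N t'' t'" using 1 t'(1) LT by blast
      moreover from this(2) t'(2) have "term_dvd N t'' t" by (rule term_dvd_trans)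
      ultimately show ?thesis by blast
    qed
  qed
  have "\<forall>t\<in>B. \<exists>v. v \<in> M - {0} \<and> leading v = t" by (auto simp: B_def LT_def)
  then obtain g where g: "\<And>t. t \<in> B \<Longrightarrow> g t \<in> M - {0} \<and> leading (g t) = t" by metis
  have "v \<in> module_span N (g ` B)" if "v \<in> M" "v \<noteq> 0 \<longrightarrow> leading v = t" for v t
    using that
  proof (induction t arbitrary: v rule: wf_induct_rule[OF wf_terms[of N r]])
    case (1 t)
    show ?case
    proof (cases "v = 0")
      case False
      then have t: "leading v = t" "t \<in> LT" using 1 by (auto simp: LT_def)
      then obtain s where s: "s \<in> B" "term_dvd N s t" using minimal by blast
      have gs: "g s \<in> M" "g s \<noteq> 0" "leading (g s) = s" using g[OF s(1)] by auto
      obtain p where p: "p \<in> polyring N"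
        "v - smult_vec p (g s) = 0 \<or> leading (v - smult_vec p (g s)) < t"
        using leading_reduce[OF MF[OF gs(1)] gs(2) MF[OF 1(2)] False] gs(3) s(2) t(1) by auto
      let ?u = "v - smult_vec p (g s)"
      have u: "?u \<in> M" using M gs(1) p(1) 1(2) by (intro submodule_diff) (auto simp: submodule_def)
      have "?u \<in> module_span N (g ` B)"
      proof (cases "?u = 0")
        case False
        then have "leading ?u < t" "leading ?u \<in> LT" using p(2) u by (auto simp: LT_def)
        then show ?thesis using 1(1)[of "leading ?u" ?u] u t(2) LT by blast
      qed (simp add: module_span_0)
      moreover have "smult_vec p (g s) \<in> module_span N (g ` B)"
        using \<open>finite B\<close> s(1) by (intro module_span_smult module_span_base p(1)) auto
      ultimately have "?u + smult_vec p (g s) \<in> module_span N (g ` B)" by (rule module_span_add)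
      then show ?thesis by simp
    qed (simp only: module_span_0)
  qed
  then have "M \<subseteq> module_span N (g ` B)" by blast
  then show ?thesis using \<open>finite B\<close> g by (intro exI[of _ "g ` B"]) auto
qed

text \<open>The union of the chain is finitely generated as a submodule of the free module of rank
  one, and its generators already lie in one member.\<close>

lemma ideal_chain_stabilises:
  fixes J :: "nat \<Rightarrow> (nat, 'k::field) mpoly set"
  assumes J: "\<And>i. is_ideal N (J i)" and inc: "\<And>i. J i \<subseteq> J (Suc i)"
  shows "\<exists>m. J (Suc m) = J m"
proof -
  have mono: "J i \<subseteq> J j" if "i \<le> j" for i j using inc that by (rule lift_Suc_mono_le)
  define M where "M = {v \<in> free_module N 1. v 0 \<in> (\<Union>i. J i)}"
  have "submodule N 1 M"
    unfolding submodule_def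
  proof (intro conjI ballI)
    show "0 \<in> M" using free_module_intros(1) ideal_0[OF J] by (auto simp: M_def)
    show "v + w \<in> M" if vw: "v \<in> M" "w \<in> M" for v w
    proof -
      obtain i j where "v 0 \<in> J i" "w 0 \<in> J j" using vw by (auto simp: M_def)
      then have "v 0 + w 0 \<in> J (max i j)"
        using mono[of i "max i j"] mono[of j "max i j"] by (intro ideal_add[OF J]) auto
      then show ?thesis using vw free_module_intros(2) by (auto simp: M_def)
    qed
    show "smult_vec p v \<in> M" if p: "p \<in> polyring N" and v: "v \<in> M" for p v
    proof -
      obtain i where "v 0 \<in> J i" using v by (auto simp: M_def)
      then have "smult_vec p v 0 \<in> J i" using ideal_mult[OF J p] by simp
      moreover have "smult_vec p v \<in> free_module N 1"
        using v p by (intro free_module_intros) (simp_all add: M_def)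
      ultimately show ?thesis unfolding M_def by blast
    qed
  qed (simp add: M_def)
  from submodule_finitely_generated[OF this]
  obtain G where G: "finite G" "G \<subseteq> M" "M \<subseteq> module_span N G" by blast
  have "\<forall>g\<in>G. \<exists>i. g 0 \<in> J i" using G(2) by (auto simp: M_def)
  then obtain i where i: "\<And>g. g \<in> G \<Longrightarrow> g 0 \<in> J (i g)" by metis
  define m where "m = Max (insert 0 (i ` G))"
  have m: "g 0 \<in> J m" if "g \<in> G" for g
  proof -
    have "i g \<le> m" using that G(1) by (auto simp: m_def)
    then show ?thesis using mono i[OF that] by blast
  qed
  have "J (Suc m) \<subseteq> J m"
  proof
    fix p assume p: "p \<in> J (Suc m)"
    define v where "v = (\<lambda>b. if b = (0::nat) then p else 0)"
    have "v \<in> M" using p J ideal_polyring by (auto simp: v_def M_def free_module_def)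
    then obtain q where q: "\<forall>g. q g \<in> polyring N" "v = (\<Sum>g\<in>G. smult_vec (q g) g)"
      using G(3) by (auto simp: module_span_def)
    then have "v 0 = (\<Sum>g\<in>G. q g * g 0)" by (simp add: sum_fun_apply)
    also have "\<dots> \<in> J m" using q m by (intro ideal_sum[OF J] ideal_mult[OF J]) auto
    finally show "p \<in> J m" by (simp add: v_def)
  qed
  then show ?thesis using inc[of m] by blast
qed

text \<open>The homogeneous components of a finite set of generators generate as well, and they lie
  in \<open>M\<close> because \<open>M\<close> is graded.\<close>

lemma graded_generators:
  fixes M :: "(nat \<Rightarrow> (nat, 'k::field) mpoly) set" and dg :: "nat \<Rightarrow> int"
  assumes M: "submodule N r M"
    and graded: "\<And>v s. v \<in> M \<Longrightarrow> (\<lambda>b. hcomp (s - dg b) (v b)) \<in> M"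
  shows "\<exists>n g sd. (\<forall>i<n. g i \<in> M \<and> (\<forall>b. g i b \<in> forms N (sd i - dg b))) \<and>
    M = (\<lambda>p. \<lambda>a. if a < r then \<Sum>i<n. g i a * p i else 0) ` free_module N n"
proof -
  from submodule_finitely_generated[OF M]
  obtain G where G: "finite G" "G \<subseteq> M" "M \<subseteq> module_span N G" by blast
  have MF: "v \<in> free_module N r" if "v \<in> M" for v using M that by (auto simp: submodule_def)
  define hc where "hc s v = (\<lambda>b. hcomp (s - dg b) (v b))" for s and v :: "nat \<Rightarrow> (nat, 'k) mpoly"
  define D where "D = (\<lambda>(v, b, m). int (mon_degree m) + dg b) ` (SIGMA v:G. vec_terms v)"
  have "finite D"
    unfolding D_def by (intro finite_imageI finite_SigmaI G(1) finite_vec_terms[OF MF[OF subsetD[OF G(2)]]])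
  \<comment> \<open>The degree is stored beside the component because a component that is 0 does not
    determine it.\<close>
  define H where "H = (\<lambda>(s, v). (s, hc s v)) ` (D \<times> G)"
  have "finite H" unfolding H_def using \<open>finite D\<close> G(1) by simp
  define n where "n = card H"
  obtain h where h: "bij_betw h {..<n} H"
    using ex_bij_betw_nat_finite[OF \<open>finite H\<close>] by (auto simp: n_def lessThan_atLeast0)
  define sd where "sd i = fst (h i)" for i
  define g where "g i = snd (h i)" for i
  have gi: "g i \<in> M \<and> (\<forall>b. g i b \<in> forms N (sd i - dg b))" if "i < n" for i
  proof -
    have "h i \<in> H" using h that by (auto simp: bij_betw_def)
    then obtain s v where sv: "v \<in> G" "h i = (s, hc s v)" by (auto simp: H_def)
    have "hcomp (s - dg b) (v b) \<in> forms N (s - dg b)" for b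
      by (rule hcomp_forms[OF free_module_polyring[OF MF[OF subsetD[OF G(2) sv(1)]]]])
    then show ?thesis
      using graded[of v s] G(2) sv by (auto simp: sd_def g_def hc_def)
  qed
  have gz: "g i a = 0" if "i < n" "\<not> a < r" for i a
    using MF[of "g i"] gi that by (simp add: free_module_def)
  have comb_eq: "(\<lambda>a. if a < r then \<Sum>i<n. g i a * p i else 0) = (\<Sum>i<n. smult_vec (p i) (g i))" for p
    by (auto simp: fun_eq_iff sum_fun_apply mult.commute gz intro!: sum.cong sum.neutral[symmetric])
  have "M = (\<lambda>p. \<lambda>a. if a < r then \<Sum>i<n. g i a * p i else 0) ` free_module N n"
  proof (intro equalityI subsetI)
    fix v assume "v \<in> M"
    define T where "T = {(\<lambda>a. if a < r then \<Sum>i<n. g i a * p i else 0) | p. p \<in> free_module N n}"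
    have Tadd: "u + w \<in> T" if uw: "u \<in> T" "w \<in> T" for u w
    proof -
      obtain p q where "p \<in> free_module N n" "q \<in> free_module N n"
        "u = (\<lambda>a. if a < r then \<Sum>i<n. g i a * p i else 0)"
        "w = (\<lambda>a. if a < r then \<Sum>i<n. g i a * q i else 0)"
        using uw unfolding T_def by blast
      then show ?thesis unfolding T_def using free_module_intros(2)[of p N n q]
        by (intro CollectI exI[of _ "p + q"]) (auto simp: fun_eq_iff algebra_simps sum.distrib)
    qed
    have Tsm: "smult_vec q u \<in> T" if qu: "q \<in> polyring N" "u \<in> T" for q u
    proof -
      obtain p where "p \<in> free_module N n" "u = (\<lambda>a. if a < r then \<Sum>i<n. g i a * p i else 0)"
        using qu(2) unfolding T_def by blast
      then show ?thesis unfolding T_def using free_module_intros(4)[OF qu(1)]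
        by (intro CollectI exI[of _ "smult_vec q p"])
           (auto simp: fun_eq_iff sum_distrib_left algebra_simps intro!: sum.cong)
    qed
    have T0: "0 \<in> T" unfolding T_def using free_module_intros(1)
      by (intro CollectI exI[of _ "0 :: nat \<Rightarrow> (nat, 'k) mpoly"] conjI) (auto simp: fun_eq_iff)
    have Tsum: "sum f B \<in> T" if "\<And>x. x \<in> B \<Longrightarrow> f x \<in> T" for f and B :: "'x set"
      using that
    proof (induction B rule: infinite_finite_induct)
      case (insert x B)
      then have "f x + sum f B \<in> T" by (intro Tadd) blast+
      then show ?case using insert(1,2) by (simp only: sum.insert not_False_eq_True)
    qed (simp_all only: sum.infinite sum.empty T0 not_False_eq_True)
    have Tg: "g i \<in> T" if "i < n" for i
    proof -
      have mem: "(\<lambda>j. if j = i then 1 else 0) \<in> free_module N n" using that by (auto simp: free_module_def)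
      have eq: "(\<lambda>a. if a < r then \<Sum>j<n. g j a * (if j = i then 1 else 0) else 0) = g i"
        using gi[OF that] MF that by (auto simp: fun_eq_iff free_module_def if_distrib[of "\<lambda>x. _ * x"] cong: if_cong)
      show ?thesis
        unfolding T_def by (rule CollectI, rule exI, rule conjI[OF eq[symmetric] mem])
    qed
    have TG: "w \<in> T" if w: "w \<in> G" for w
    proof -
      have "w = (\<Sum>s\<in>D. hc s w)"
      proof
        fix b
        have "w b = (\<Sum>s\<in>(\<lambda>s. s - dg b) ` D. hcomp s (w b))"
        proof (rule hcomp_decompose)
          fix m assume "m \<in> keys (w b)"
          then have "int (mon_degree m) + dg b \<in> D"
            using w by (force simp: D_def vec_terms_def)
          then show "int (mon_degree m) \<in> (\<lambda>s. s - dg b) ` D" by force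
        qed (simp add: \<open>finite D\<close>)
        also have "\<dots> = (\<Sum>s\<in>D. hcomp (s - dg b) (w b))" by (subst sum.reindex) (auto simp: inj_on_def)
        finally show "w b = (\<Sum>s\<in>D. hc s w) b" by (simp add: sum_fun_apply hc_def)
      qed
      moreover have "hc s w \<in> T" if "s \<in> D" for s
      proof -
        have "(s, hc s w) \<in> h ` {..<n}" using h w that by (auto simp: bij_betw_def H_def)
        then obtain i where "i < n" "h i = (s, hc s w)" by (metis imageE lessThan_iff)
        then show ?thesis using Tg[of i] by (simp add: g_def)
      qed
      ultimately show ?thesis using Tsum by metis
    qed
    obtain q where q: "\<forall>g. q g \<in> polyring N" "v = (\<Sum>g\<in>G. smult_vec (q g) g)"
      using G(3) \<open>v \<in> M\<close> by (auto simp: module_span_def)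
    have "v \<in> T" unfolding q(2) using q(1) TG by (intro Tsum Tsm) auto
    then show "v \<in> (\<lambda>p. \<lambda>a. if a < r then \<Sum>i<n. g i a * p i else 0) ` free_module N n"
      by (auto simp: T_def)
  next
    fix v assume "v \<in> (\<lambda>p. \<lambda>a. if a < r then \<Sum>i<n. g i a * p i else 0) ` free_module N n"
    then obtain p where p: "p \<in> free_module N n" "v = (\<lambda>a. if a < r then \<Sum>i<n. g i a * p i else 0)" by blast
    have "v = (\<Sum>i<n. smult_vec (p i) (g i))"
      unfolding p(2) by (rule comb_eq)
    moreover have "(\<Sum>i\<in>B. smult_vec (p i) (g i)) \<in> M" if "B \<subseteq> {..<n}" for B
      using finite_subset[OF that finite_lessThan] that
    proof (induction B rule: finite_induct)
      case (insert i B)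
      then have "smult_vec (p i) (g i) \<in> M"
        using M gi free_module_polyring[OF p(1)] unfolding submodule_def by auto
      moreover have "(\<Sum>i\<in>B. smult_vec (p i) (g i)) \<in> M" using insert by blast
      ultimately have "smult_vec (p i) (g i) + (\<Sum>i\<in>B. smult_vec (p i) (g i)) \<in> M"
        using M unfolding submodule_def by blast
      then show ?case using insert(1,2) by (simp only: sum.insert not_False_eq_True)
    qed (use M in \<open>simp only: sum.empty submodule_def\<close>)
    ultimately show "v \<in> M" by simp
  qed
  with gi show ?thesis by blast
qed

text \<open>\<open>tor_dim\<close> selects a resolution by \<open>SOME\<close>, so nothing can be
  said about Betti numbers before one is known to exist. Starting from generators of
  \<open>I\<close>, each matrix generates the kernel of the preceding one.\<close>

lemma graded_free_resolution_exists:
  fixes I :: "(nat, 'k::field) mpoly set"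
  assumes I: "is_ideal N I" "homogeneous_set I"
  shows "\<exists>F. graded_free_resolution N I F"
proof -
  define bm where "bm r n mat = (\<lambda>v. \<lambda>a::nat. if a < r then \<Sum>b<n. mat a b * v b else 0)"
    for r n :: nat and mat :: "nat \<Rightarrow> nat \<Rightarrow> (nat, 'k) mpoly" and v :: "nat \<Rightarrow> (nat, 'k) mpoly"
  \<comment> \<open>A state \<open>(r, dg, n, sd, mat)\<close> of the dependent choice is one map of
    the resolution: rank and degrees of its target, rank and degrees of its source, and its
    matrix.\<close>
  define ok where "ok x = (case x of (r, dg, n, sd, mat) \<Rightarrow>
      (\<forall>a<r. \<forall>b<n. mat a b \<in> forms N (sd b - dg a)))"
    for x :: "nat \<times> (nat \<Rightarrow> int) \<times> nat \<times> (nat \<Rightarrow> int) \<times> (nat \<Rightarrow> nat \<Rightarrow> (nat, 'k) mpoly)"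
  define step where "step x y = (case x of (r, dg, n, sd, mat) \<Rightarrow> case y of (r', dg', n', sd', mat') \<Rightarrow>
      r' = n \<and> dg' = sd \<and> {v \<in> free_module N n. bm r n mat v = 0} = bm n n' mat' ` free_module N n')"
    for x y :: "nat \<times> (nat \<Rightarrow> int) \<times> nat \<times> (nat \<Rightarrow> int) \<times> (nat \<Rightarrow> nat \<Rightarrow> (nat, 'k) mpoly)"
  define init where "init x = (case x of (r, dg, n, sd, mat) \<Rightarrow> r = 1 \<and> dg = (\<lambda>_. 0) \<and>
      {v \<in> free_module N 1. v 0 \<in> I} = bm 1 n mat ` free_module N n)"
    for x :: "nat \<times> (nat \<Rightarrow> int) \<times> nat \<times> (nat \<Rightarrow> int) \<times> (nat \<Rightarrow> nat \<Rightarrow> (nat, 'k) mpoly)"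
  have 1: "\<exists>x. ok x \<and> init x"
  proof -
    define dg0 :: "nat \<Rightarrow> int" where "dg0 = (\<lambda>_. 0)"
    let ?M = "{v \<in> free_module N 1. v 0 \<in> I}"
    have "submodule N 1 ?M"
      unfolding submodule_def
      by (intro conjI ballI CollectI) (auto intro: free_module_intros ideal_add[OF I(1)] ideal_mult[OF I(1)] ideal_0[OF I(1)])
    moreover have "(\<lambda>b. hcomp (s - dg0 b) (v b)) \<in> ?M" if "v \<in> ?M" for v s
      using that I(2) by (auto simp: homogeneous_set_def free_module_def hcomp_polyring)
    ultimately have "\<exists>n g sd. (\<forall>i<n. g i \<in> ?M \<and> (\<forall>b. g i b \<in> forms N (sd i - dg0 b))) \<and>
      ?M = (\<lambda>p. \<lambda>a. if a < 1 then \<Sum>i<n. g i a * p i else 0) ` free_module N n"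
      by (rule graded_generators)
    then obtain n g sd where g: "\<forall>i<n. g i \<in> ?M \<and> (\<forall>b. g i b \<in> forms N (sd i - dg0 b))"
      "?M = (\<lambda>p. \<lambda>a. if a < 1 then \<Sum>i<n. g i a * p i else 0) ` free_module N n"
      by blast
    have "ok (1, dg0, n, sd, \<lambda>a b. g b a)" using g(1) by (auto simp: ok_def dg0_def)
    moreover have "init (1, dg0, n, sd, \<lambda>a b. g b a)" unfolding init_def bm_def prod.case using g(2) dg0_def by blast
    ultimately show ?thesis by blast
  qed
  have 2: "\<exists>y. ok y \<and> step x y" if "ok x" for x
  proof -
    obtain r dg n sd mat where x: "x = (r, dg, n, sd, mat)" by (cases x) auto
    have mat: "mat a b \<in> forms N (sd b - dg a)" if "a < r" "b < n" for a b
      using \<open>ok x\<close> that by (auto simp: ok_def x)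
    let ?M = "{v \<in> free_module N n. bm r n mat v = 0}"
    have add: "bm r n mat (v + w) = bm r n mat v + bm r n mat w" for v w
      by (auto simp: bm_def fun_eq_iff algebra_simps sum.distrib)
    have sm: "bm r n mat (smult_vec p v) = smult_vec p (bm r n mat v)" for p v
      by (auto simp: bm_def fun_eq_iff sum_distrib_left mult.left_commute intro!: sum.cong)
    have "submodule N n ?M"
      unfolding submodule_def
    proof (intro conjI ballI CollectI)
      show "bm r n mat 0 = 0" by (auto simp: bm_def fun_eq_iff)
      show "bm r n mat (smult_vec p v) = 0" if "v \<in> ?M" for p v
        using that by (auto simp: sm fun_eq_iff)
    qed (auto simp: add intro: free_module_intros)
    moreover have "(\<lambda>b. hcomp (s - sd b) (v b)) \<in> ?M" if v: "v \<in> ?M" for v s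
    proof -
      have "bm r n mat (\<lambda>b. hcomp (s - sd b) (v b)) a = 0" for a
      proof (cases "a < r")
        case True
        have "mat a b * hcomp (s - sd b) (v b) = hcomp (s - dg a) (mat a b * v b)" if "b < n" for b
          using hcomp_mult_form[OF mat[OF True that], of "v b" "s - dg a"] v free_module_polyring[of v N n b]
          by simp
        then have "bm r n mat (\<lambda>b. hcomp (s - sd b) (v b)) a = hcomp (s - dg a) (bm r n mat v a)"
          using True by (auto simp: bm_def hcomp_sum intro!: sum.cong)
        then show ?thesis using v by simp
      qed (simp add: bm_def)
      then show ?thesis using v by (auto simp: free_module_def hcomp_polyring fun_eq_iff)
    qed
    ultimately have "\<exists>n' g sd'. (\<forall>i<n'. g i \<in> ?M \<and> (\<forall>b. g i b \<in> forms N (sd' i - sd b))) \<and>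
      ?M = (\<lambda>p. \<lambda>a. if a < n then \<Sum>i<n'. g i a * p i else 0) ` free_module N n'"
      by (rule graded_generators)
    then obtain n' g sd' where g: "\<forall>i<n'. g i \<in> ?M \<and> (\<forall>b. g i b \<in> forms N (sd' i - sd b))"
      "?M = (\<lambda>p. \<lambda>a. if a < n then \<Sum>i<n'. g i a * p i else 0) ` free_module N n'"
      by blast
    have "ok (n, sd, n', sd', \<lambda>a b. g b a)" using g(1) by (auto simp: ok_def)
    moreover have "step x (n, sd, n', sd', \<lambda>a b. g b a)"
      unfolding step_def x prod.case using g(2) unfolding bm_def by blast
    ultimately show ?thesis by blast
  qed
  obtain f where f: "\<And>i. ok (f i) \<and> (i = 0 \<longrightarrow> init (f i)) \<and> step (f i) (f (Suc i))"
    using dependent_nat_choice[of "\<lambda>i x. ok x \<and> (i = 0 \<longrightarrow> init x)" "\<lambda>_. step"] 1 2 by auto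
  define F :: "'k free_complex" where "F = \<lparr>gen_count = (\<lambda>i. fst (f i)),
    gen_degree = (\<lambda>i. fst (snd (f i))), aug = (\<lambda>_. 1), bdry = (\<lambda>i. snd (snd (snd (snd (f i)))))\<rparr>"
  have nxt: "fst (snd (snd (f i))) = gen_count F (Suc i)" "fst (snd (snd (snd (f i)))) = gen_degree F (Suc i)" for i
    using f[of i] by (auto simp: F_def step_def split: prod.splits)
  have f_eq: "f i = (gen_count F i, gen_degree F i, gen_count F (Suc i), gen_degree F (Suc i), bdry F i)" for i
    unfolding nxt[symmetric] by (simp add: F_def)
  have bm_eq: "bm (gen_count F i) (gen_count F (Suc i)) (bdry F i) = bdry_map F i" for i
    by (simp add: bm_def bdry_map_def fun_eq_iff)
  have init: "gen_count F 0 = 1" "gen_degree F 0 = (\<lambda>_. 0)"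
    "{v \<in> free_module N 1. v 0 \<in> I} = bdry_map F 0 ` free_module N (gen_count F 1)"
    using f[of 0] bm_eq[of 0] unfolding init_def f_eq by auto
  have aug: "aug F b = 1" "aug_map F v = v 0" for b v
    using init(1) by (simp_all add: F_def aug_map_def)
  have "graded_free_resolution N I F"
    unfolding graded_free_resolution_def
  proof (intro conjI allI impI ballI)
    show "aug F b \<in> forms N (gen_degree F 0 b)" for b by (simp add: aug init(2) forms_1)
    show "bdry F i a b \<in> forms N (gen_degree F (Suc i) b - gen_degree F i a)"
      if "a < gen_count F i" "b < gen_count F (Suc i)" for i a b
      using f[of i] that unfolding ok_def f_eq by auto
    show "\<exists>v\<in>free_module N (gen_count F 0). g - aug_map F v \<in> I" if "g \<in> polyring N" for g
      using that ideal_0[OF I(1)]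
      by (intro bexI[of _ "\<lambda>b. if b = 0 then g else 0"]) (auto simp: aug free_module_def init(1))
    show "{v \<in> free_module N (gen_count F 0). aug_map F v \<in> I} = bdry_map F 0 ` free_module N (gen_count F 1)"
      using init(3) by (simp add: aug init(1))
    show "{v \<in> free_module N (gen_count F (Suc i)). bdry_map F i v = 0}
        = bdry_map F (Suc i) ` free_module N (gen_count F (Suc (Suc i)))" for i
      using f[of i] unfolding step_def f_eq prod.case bm_eq by auto
  qed
  then show ?thesis by blast
qed

section \<open>Algebraic sets\<close>

lemma eval_form_scale:
  assumes "f \<in> forms N s"
  shows "mpoly_eval f (scale_vec c v) = c ^ nat s * mpoly_eval f v"
proof -
  have "monv (scale_vec c v) m = c ^ nat s * monv v m" if "m \<in> keys f" for m
  proof -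
    have "int (mon_degree m) = s" using assms that by (auto simp: forms_def)
    then have "nat s = mon_degree m" by simp
    then show ?thesis
      by (simp add: monv_def scale_vec_def power_mult_distrib prod.distrib mon_degree_def power_sum)
  qed
  then show ?thesis
    unfolding mpoly_eval_insertion insertion_def sum_distrib_left by (intro sum.cong) (simp_all add: algebra_simps)
qed

lemma vanishes_at_span:
  assumes "f \<in> forms N s"
  shows "vanishes_at f (vec.span {v}) \<longleftrightarrow> mpoly_eval f v = 0"
proof
  assume "vanishes_at f (vec.span {v})"
  then show "mpoly_eval f v = 0" using vec.span_base[of v "{v}"] by (simp add: vanishes_at_def)
next
  assume "mpoly_eval f v = 0"
  then show "vanishes_at f (vec.span {v})"
    using eval_form_scale[OF assms] by (auto simp: vanishes_at_def vec.span_singleton)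
qed

lemma subspace_coords: "vec.subspace (coords N)"
  by (rule vec.subspaceI) (auto simp: coords_def scale_vec_def)

lemma proj_space_iff: "L \<in> proj_space N \<longleftrightarrow> (\<exists>v\<in>coords N. v \<noteq> 0 \<and> L = vec.span {v})"
proof
  assume "L \<in> proj_space N"
  then have L: "vec.subspace L" "L \<subseteq> coords N" "vec.dim L = 1"
    by (auto simp: proj_space_def grass_def)
  obtain B where B: "B \<subseteq> L" "vec.independent B" "L \<subseteq> vec.span B" "card B = 1"
    using vec.maximal_independent_subset[of L] vec.basis_card_eq_dim L(3) by metis
  then obtain v where v: "B = {v}" by (metis card_1_singletonE)
  have "L = vec.span {v}" using B(1,3) v vec.span_minimal[OF _ L(1)] by blast
  moreover have "v \<noteq> 0" using B(2) v vec.dependent_zero by blast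
  ultimately show "\<exists>v\<in>coords N. v \<noteq> 0 \<and> L = vec.span {v}" using B(1) L(2) v by blast
next
  assume "\<exists>v\<in>coords N. v \<noteq> 0 \<and> L = vec.span {v}"
  then obtain v where v: "v \<in> coords N" "v \<noteq> 0" "L = vec.span {v}" by blast
  have "vec.independent {v}" using v(2) by (simp add: vec.dependent_single)
  then have "vec.dim L = 1" using vec.dim_span_eq_card_independent[of "{v}"] v(3) by simp
  moreover have "L \<subseteq> coords N" using vec.span_minimal[OF _ subspace_coords] v by blast
  ultimately show "L \<in> proj_space N" using v(3) by (simp add: proj_space_def grass_def)
qed

lemma vanishing_forms_0: "0 \<in> vanishing_forms N X s"
  by (simp add: vanishing_forms_def vanishes_at_def)

lemma vanishing_forms_add:
  "f \<in> vanishing_forms N X s \<Longrightarrow> g \<in> vanishing_forms N X s \<Longrightarrow> f + g \<in> vanishing_forms N X s"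
  by (auto simp: vanishing_forms_def vanishes_at_def intro: forms_add)

lemma vanishing_forms_mult:
  "g \<in> forms N a \<Longrightarrow> f \<in> vanishing_forms N X s \<Longrightarrow> g * f \<in> vanishing_forms N X (a + s)"
  by (auto simp: vanishing_forms_def vanishes_at_def intro: forms_mult)

lemma vanishing_forms_sum:
  "(\<And>a. a \<in> A \<Longrightarrow> f a \<in> vanishing_forms N X s) \<Longrightarrow> sum f A \<in> vanishing_forms N X s"
  by (induction A rule: infinite_finite_induct) (auto simp: vanishing_forms_0 vanishing_forms_add)

text \<open>Trades the finite sum of vanishing forms for a condition on every homogeneous component,
  from which the ideal laws and the grading can be read off.\<close>

lemma defining_ideal_iff:
  "p \<in> defining_ideal N X \<longleftrightarrow> p \<in> polyring N \<and> (\<forall>s. hcomp s p \<in> vanishing_forms N X s)"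
proof
  assume "p \<in> defining_ideal N X"
  then obtain t f where f: "\<And>s. f s \<in> vanishing_forms N X (int s)" "p = (\<Sum>s\<le>t. f s)"
    by (auto simp: defining_ideal_def)
  have form: "f s \<in> forms N (int s)" for s using f(1)[of s] by (simp add: vanishing_forms_def)
  have "hcomp s p \<in> vanishing_forms N X s" for s
    unfolding f(2) hcomp_sum
    by (rule vanishing_forms_sum) (use f(1) vanishing_forms_0 in \<open>auto simp: hcomp_form[OF form]\<close>)
  moreover have "p \<in> polyring N" unfolding f(2) by (intro polys_sum forms_polyring[OF form])
  ultimately show "p \<in> polyring N \<and> (\<forall>s. hcomp s p \<in> vanishing_forms N X s)" by blast
next
  assume p: "p \<in> polyring N \<and> (\<forall>s. hcomp s p \<in> vanishing_forms N X s)"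
  define t where "t = Max (insert 0 (mon_degree ` keys p))"
  have "p = (\<Sum>s\<in>int ` {..t}. hcomp s p)"
  proof (rule hcomp_decompose)
    fix m assume "m \<in> keys p"
    then have "mon_degree m \<le> t" unfolding t_def by (intro Max_ge) auto
    then show "int (mon_degree m) \<in> int ` {..t}" by auto
  qed simp
  also have "\<dots> = (\<Sum>s\<le>t. hcomp (int s) p)" by (subst sum.reindex) auto
  finally show "p \<in> defining_ideal N X"
    unfolding defining_ideal_def using p by (intro CollectI exI[of _ t] exI[of _ "\<lambda>s. hcomp (int s) p"]) auto
qed

lemma is_ideal_defining_ideal: "is_ideal N (defining_ideal N X)"
  unfolding is_ideal_def
proof (intro conjI ballI)
  show "0 \<in> defining_ideal N X" by (simp add: defining_ideal_iff vanishing_forms_0)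
  fix g p :: "(nat, 'a) mpoly"
  assume g: "g \<in> polyring N" and p: "p \<in> defining_ideal N X"
  have "hcomp s (g * p) \<in> vanishing_forms N X s" for s
  proof -
    let ?D = "(\<lambda>m. int (mon_degree m)) ` keys g"
    have "hcomp s (g * p) = (\<Sum>a\<in>?D. hcomp s (hcomp a g * p))"
      by (subst hcomp_decompose_keys[of g]) (simp add: sum_distrib_right hcomp_sum)
    also have "\<dots> = (\<Sum>a\<in>?D. hcomp a g * hcomp (s - a) p)"
      using p by (intro sum.cong refl hcomp_mult_form[OF hcomp_forms[OF g]]) (simp add: defining_ideal_iff)
    also have "\<dots> \<in> vanishing_forms N X s"
    proof (rule vanishing_forms_sum)
      fix a
      have "hcomp a g * hcomp (s - a) p \<in> vanishing_forms N X (a + (s - a))"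
        using p by (intro vanishing_forms_mult hcomp_forms[OF g]) (simp add: defining_ideal_iff)
      then show "hcomp a g * hcomp (s - a) p \<in> vanishing_forms N X s" by simp
    qed
    finally show ?thesis .
  qed
  then show "g * p \<in> defining_ideal N X"
    using g p by (simp add: defining_ideal_iff polys_mult)
qed (auto simp: defining_ideal_iff hcomp_add intro: polys_add vanishing_forms_add)

lemma hcomp_hcomp: "p \<in> polyring N \<Longrightarrow> hcomp s (hcomp t p) = (if s = t then hcomp t p else 0)"
  using hcomp_form[OF hcomp_forms] by blast

lemma homogeneous_defining_ideal: "homogeneous_set (defining_ideal N X)"
  by (auto simp: homogeneous_set_def defining_ideal_iff hcomp_hcomp vanishing_forms_0 intro: hcomp_polyring)

lemma defining_ideal_form:
  "f \<in> forms N s \<Longrightarrow> f \<in> defining_ideal N X \<longleftrightarrow> f \<in> vanishing_forms N X s"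
  by (auto simp: defining_ideal_iff hcomp_form vanishing_forms_0 forms_polyring)

lemma vanishing_forms_eq: "vanishing_forms N X s = forms N s \<inter> defining_ideal N X"
proof (intro equalityI subsetI)
  fix f assume "f \<in> vanishing_forms N X s"
  moreover from this have "f \<in> forms N s" by (simp add: vanishing_forms_def)
  ultimately show "f \<in> forms N s \<inter> defining_ideal N X" by (simp add: defining_ideal_form)
qed (metis IntE defining_ideal_form)

lemma defining_ideal_antimono: "X \<subseteq> Y \<Longrightarrow> defining_ideal N Y \<subseteq> defining_ideal N X"
  unfolding defining_ideal_iff[abs_def] subset_iff vanishing_forms_def mem_Collect_eq by blast

lemma algebraic_set_iff_forms:
  assumes "algebraic_set N X"
  shows "L \<in> X \<longleftrightarrow> L \<in> proj_space N \<and> (\<forall>s. \<forall>f\<in>vanishing_forms N X s. vanishes_at f L)"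
proof
  obtain S where S: "S \<subseteq> (\<Union>s. forms N s)" "X = {L \<in> proj_space N. \<forall>f\<in>S. vanishes_at f L}"
    using assms by (auto simp: algebraic_set_def)
  show "L \<in> proj_space N \<and> (\<forall>s. \<forall>f\<in>vanishing_forms N X s. vanishes_at f L)" if "L \<in> X"
    using that S(2) unfolding vanishing_forms_def by blast
  assume L: "L \<in> proj_space N \<and> (\<forall>s. \<forall>f\<in>vanishing_forms N X s. vanishes_at f L)"
  have "vanishes_at f L" if "f \<in> S" for f
  proof -
    obtain s where "f \<in> forms N s" using S(1) \<open>f \<in> S\<close> by blast
    then have "f \<in> vanishing_forms N X s" using S(2) \<open>f \<in> S\<close> by (simp add: vanishing_forms_def)
    then show ?thesis using L by blast
  qed
  then show "L \<in> X" using S(2) L by blast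
qed

lemma algebraic_set_proj_space: "algebraic_set N X \<Longrightarrow> X \<subseteq> proj_space N"
  by (auto simp: algebraic_set_def)

text \<open>An algebraic set is cut out by its own vanishing forms, so strictly decreasing sets have
  strictly increasing ideals.\<close>

lemma algebraic_set_eqI:
  assumes "algebraic_set N X" "algebraic_set N Y" "defining_ideal N X = defining_ideal N Y"
  shows "X = Y"
proof -
  have "vanishing_forms N X s = vanishing_forms N Y s" for s
    unfolding vanishing_forms_eq assms(3) ..
  then show ?thesis
    using algebraic_set_iff_forms[OF assms(1)] algebraic_set_iff_forms[OF assms(2)] by auto
qed

lemma algebraic_set_empty: "algebraic_set N ({} :: (nat \<Rightarrow> 'k::field) set set)"
proof -
  have "\<not> vanishes_at (1 :: (nat, 'k) mpoly) L" if "L \<in> proj_space N" for L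
    using that vec.span_zero by (auto simp: proj_space_iff vanishes_at_def)
  moreover have "{1 :: (nat, 'k) mpoly} \<subseteq> (\<Union>s. forms N s)" using forms_1 by blast
  ultimately show ?thesis unfolding algebraic_set_def by (intro exI[of _ "{1}"]) auto
qed

lemma algebraic_set_Int: "algebraic_set N X \<Longrightarrow> algebraic_set N Y \<Longrightarrow> algebraic_set N (X \<inter> Y)"
  unfolding algebraic_set_def
proof (elim exE conjE)
  fix S T assume "S \<subseteq> (\<Union>s. forms N s)" "X = {L \<in> proj_space N. \<forall>f\<in>S. vanishes_at f L}"
    "T \<subseteq> (\<Union>s. forms N s)" "Y = {L \<in> proj_space N. \<forall>f\<in>T. vanishes_at f L}"
  then show "\<exists>S. S \<subseteq> (\<Union>s. forms N s) \<and> X \<inter> Y = {L \<in> proj_space N. \<forall>f\<in>S. vanishes_at f L}"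
    by (intro exI[of _ "S \<union> T"]) auto
qed

lemma algebraic_set_form: "f \<in> forms N s \<Longrightarrow> algebraic_set N {L \<in> proj_space N. vanishes_at f L}"
  unfolding algebraic_set_def by (intro exI[of _ "{f}"]) auto

lemma algebraic_set_Un:
  assumes "algebraic_set N X" "algebraic_set N Y"
  shows "algebraic_set N (X \<union> Y)"
proof -
  obtain S where S: "S \<subseteq> (\<Union>s. forms N s)" "X = {L \<in> proj_space N. \<forall>f\<in>S. vanishes_at f L}"
    using assms by (auto simp: algebraic_set_def)
  obtain T where T: "T \<subseteq> (\<Union>s. forms N s)" "Y = {L \<in> proj_space N. \<forall>f\<in>T. vanishes_at f L}"
    using assms by (auto simp: algebraic_set_def)
  let ?U = "{f * g | f g. f \<in> S \<and> g \<in> T}"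
  have "?U \<subseteq> (\<Union>s. forms N s)"
  proof
    fix h assume "h \<in> ?U"
    then obtain f g where fg: "f \<in> S" "g \<in> T" "h = f * g" by blast
    then obtain s t where "f \<in> forms N s" "g \<in> forms N t" using S(1) T(1) by blast
    then have "h \<in> forms N (s + t)" using forms_mult fg(3) by simp
    then show "h \<in> (\<Union>s. forms N s)" by (rule UN_I[OF UNIV_I])
  qed
  moreover have "X \<union> Y = {L \<in> proj_space N. \<forall>f\<in>?U. vanishes_at f L}"
  proof (intro equalityI subsetI)
    fix L assume "L \<in> X \<union> Y"
    then have L: "L \<in> proj_space N" "(\<forall>f\<in>S. vanishes_at f L) \<or> (\<forall>g\<in>T. vanishes_at g L)"
      unfolding S(2) T(2) by blast+
    have "vanishes_at (f * g) L" if "f \<in> S" "g \<in> T" for f g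
      using L(2) that by (auto simp: vanishes_at_def)
    then show "L \<in> {L \<in> proj_space N. \<forall>f\<in>?U. vanishes_at f L}" using L(1) by blast
  next
    fix L assume L: "L \<in> {L \<in> proj_space N. \<forall>f\<in>?U. vanishes_at f L}"
    show "L \<in> X \<union> Y"
    proof (rule ccontr)
      assume "L \<notin> X \<union> Y"
      then obtain f g where fg: "f \<in> S" "\<not> vanishes_at f L" "g \<in> T" "\<not> vanishes_at g L"
        using L S(2) T(2) by blast
      obtain v where v: "L = vec.span {v}" using L by (auto simp: proj_space_iff)
      obtain s t where st: "f \<in> forms N s" "g \<in> forms N t" using fg(1,3) S(1) T(1) by blast
      have "vanishes_at (f * g) L" using L fg(1,3) by blast
      then have "mpoly_eval (f * g) v = 0"
        using vanishes_at_span[OF forms_mult[OF st], of v] v by simp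
      then show False using fg(2,4) vanishes_at_span st v by auto
    qed
  qed
  ultimately show ?thesis unfolding algebraic_set_def by blast
qed

lemma algebraic_set_Union:
  "finite C \<Longrightarrow> (\<And>Y. Y \<in> C \<Longrightarrow> algebraic_set N Y) \<Longrightarrow> algebraic_set N (\<Union>C)"
  by (induction C rule: finite_induct) (auto intro: algebraic_set_empty algebraic_set_Un)

text \<open>Noetherian induction: a set without a decomposition is reducible, and one of its two
  parts has no decomposition either. Iterating gives a strictly decreasing sequence of sets, whose
  ideals would increase strictly.\<close>

lemma irreducible_decomposition:
  fixes X :: "(nat \<Rightarrow> 'k::field) set set"
  assumes "algebraic_set N X"
  shows "\<exists>C. finite C \<and> (\<forall>Y\<in>C. irreducible_set N Y) \<and> X = \<Union>C"
proof (rule ccontr)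
  define bad where "bad Y \<longleftrightarrow> algebraic_set N Y \<and>
      \<not> (\<exists>C. finite C \<and> (\<forall>Z\<in>C. irreducible_set N Z) \<and> Y = \<Union>C)"
    for Y :: "(nat \<Rightarrow> 'k) set set"
  assume "\<not> ?thesis"
  then have "bad X" using assms by (simp add: bad_def)
  have smaller: "\<exists>Y'. bad Y' \<and> Y' \<subset> Y" if "bad Y" for Y
  proof -
    have "Y \<noteq> {}"
    proof
      assume "Y = {}"
      then have "finite {} \<and> (\<forall>Z\<in>{}. irreducible_set N Z) \<and> Y = \<Union>{}" by simp
      then show False using that unfolding bad_def by blast
    qed
    moreover have "\<not> irreducible_set N Y"
    proof
      assume "irreducible_set N Y"
      then have "finite {Y} \<and> (\<forall>Z\<in>{Y}. irreducible_set N Z) \<and> Y = \<Union>{Y}" by simp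
      then show False using that unfolding bad_def by blast
    qed
    moreover have "algebraic_set N Y" using that unfolding bad_def by blast
    ultimately obtain A B where AB: "algebraic_set N A" "algebraic_set N B" "Y = A \<union> B" "Y \<noteq> A" "Y \<noteq> B"
      unfolding irreducible_set_def by blast
    have "bad A \<or> bad B"
    proof (rule ccontr)
      assume "\<not> (bad A \<or> bad B)"
      then obtain C D where "finite C" "\<forall>Z\<in>C. irreducible_set N Z" "A = \<Union>C"
        "finite D" "\<forall>Z\<in>D. irreducible_set N Z" "B = \<Union>D"
        using AB(1,2) unfolding bad_def by blast
      then have "finite (C \<union> D) \<and> (\<forall>Z\<in>C \<union> D. irreducible_set N Z) \<and> Y = \<Union>(C \<union> D)"
        using AB(3) by auto
      then show False using that unfolding bad_def by blast
    qed
    then show ?thesis using AB(3-5) by blast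
  qed
  obtain Y where Y: "\<And>i. bad (Y i)" "\<And>i. Y (Suc i) \<subset> Y i"
    using dependent_nat_choice[of "\<lambda>_. bad" "\<lambda>_ Y Y'. Y' \<subset> Y"] \<open>bad X\<close> smaller by metis
  have "defining_ideal N (Y i) \<subseteq> defining_ideal N (Y (Suc i))" for i
    by (rule defining_ideal_antimono[OF psubset_imp_subset[OF Y(2)]])
  then obtain m where m: "defining_ideal N (Y (Suc m)) = defining_ideal N (Y m)"
    using ideal_chain_stabilises[of N "\<lambda>i. defining_ideal N (Y i)"] is_ideal_defining_ideal by blast
  have "algebraic_set N (Y i)" for i using Y(1)[of i] by (simp add: bad_def)
  then have "Y (Suc m) = Y m" using algebraic_set_eqI[OF _ _ m] by blast
  then show False using Y(2)[of m] by blast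
qed

lemma irreducible_subset_Union:
  assumes "irreducible_set N Z" "finite C" "\<And>Y. Y \<in> C \<Longrightarrow> algebraic_set N Y" "Z \<subseteq> \<Union>C"
  shows "\<exists>Y\<in>C. Z \<subseteq> Y"
  using assms(2-4)
proof (induction C rule: finite_induct)
  case empty
  then show ?case using assms(1) by (auto simp: irreducible_set_def)
next
  case (insert Y C)
  have Z: "algebraic_set N Z" using assms(1) by (simp add: irreducible_set_def)
  have "algebraic_set N (Z \<inter> Y)" by (rule algebraic_set_Int[OF Z]) (simp add: insert.prems)
  moreover have "algebraic_set N (Z \<inter> \<Union>C)"
    by (intro algebraic_set_Int Z algebraic_set_Union insert.hyps insert.prems) simp
  moreover have "Z = (Z \<inter> Y) \<union> (Z \<inter> \<Union>C)" using insert(5) by blast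
  ultimately have "Z = Z \<inter> Y \<or> Z = Z \<inter> \<Union>C" using assms(1) unfolding irreducible_set_def by blast
  then show ?case
  proof
    assume "Z = Z \<inter> \<Union>C"
    then have "Z \<subseteq> \<Union>C" by blast
    then have "\<exists>Y\<in>C. Z \<subseteq> Y" using insert.IH insert.prems(1) by simp
    then show ?thesis by blast
  qed blast
qed

text \<open>Base case of the cutting argument: a nonempty algebraic set has an irreducible
  component, which is a chain of length 0.\<close>

lemma no_chain_0_empty: "algebraic_set N X \<Longrightarrow> \<not> irreducible_chain N X 0 \<Longrightarrow> X = {}"
proof (rule ccontr)
  assume X: "algebraic_set N X" "\<not> irreducible_chain N X 0" "X \<noteq> {}"
  then obtain C where C: "finite C" "\<forall>Y\<in>C. irreducible_set N Y" "X = \<Union>C"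
    using irreducible_decomposition[OF X(1)] by blast
  then obtain Y where Y: "Y \<in> C" using X(3) by blast
  have "irreducible_set N Y" "Y \<subseteq> X" using C Y by auto
  then have "irreducible_chain N X 0"
    unfolding irreducible_chain_def by (intro exI[of _ "\<lambda>_. Y"]) simp
  then show False using X(2) by simp
qed

text \<open>The last member of a chain in the section lies in some \<open>Y\<close> of
  \<open>C\<close>, and \<open>Y\<close> is not contained in \<open>H\<close>, so \<open>Y\<close>
  prolongs the chain.\<close>

lemma hyperplane_section_no_chain:
  assumes C: "finite C" "\<And>Y. Y \<in> C \<Longrightarrow> irreducible_set N Y \<and> \<not> Y \<subseteq> H"
    and chain: "\<not> irreducible_chain N (\<Union>C) (Suc q)"
  shows "\<not> irreducible_chain N (\<Union>C \<inter> H) q"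
proof
  assume "irreducible_chain N (\<Union>C \<inter> H) q"
  then obtain Z where Z: "\<forall>i\<le>q. irreducible_set N (Z i) \<and> Z i \<subseteq> \<Union>C \<inter> H" "\<forall>i<q. Z i \<subset> Z (Suc i)"
    by (auto simp: irreducible_chain_def)
  have "\<exists>Y\<in>C. Z q \<subseteq> Y"
  proof (rule irreducible_subset_Union[OF _ C(1)])
    show "irreducible_set N (Z q)" "Z q \<subseteq> \<Union>C" using Z(1) by auto
    show "algebraic_set N Y" if "Y \<in> C" for Y using C(2)[OF that] by (simp add: irreducible_set_def)
  qed
  then obtain Y where Y: "Y \<in> C" "Z q \<subseteq> Y" by blast
  define Z' where "Z' i = (if i \<le> q then Z i else Y)" for i
  have "\<forall>i\<le>Suc q. irreducible_set N (Z' i) \<and> Z' i \<subseteq> \<Union>C"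
  proof (intro allI impI)
    fix i
    show "irreducible_set N (Z' i) \<and> Z' i \<subseteq> \<Union>C"
      using Z(1)[rule_format, of i] C(2)[OF Y(1)] Y(1) by (cases "i \<le> q") (auto simp: Z'_def)
  qed
  moreover have "\<forall>i<Suc q. Z' i \<subset> Z' (Suc i)"
  proof (intro allI impI)
    fix i assume "i < Suc q"
    then consider "i < q" | "i = q" by linarith
    then show "Z' i \<subset> Z' (Suc i)"
    proof cases
      case 2
      moreover have "Z q \<subseteq> H" using Z(1) by blast
      ultimately show ?thesis using Y C(2)[OF Y(1)] by (auto simp: Z'_def)
    qed (use Z(2) in \<open>simp add: Z'_def\<close>)
  qed
  ultimately show False using chain unfolding irreducible_chain_def by blast
qed

section \<open>Linear spaces in general position\<close>

definition dotp :: "nat \<Rightarrow> (nat \<Rightarrow> 'k::field) \<Rightarrow> (nat \<Rightarrow> 'k) \<Rightarrow> 'k" where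
  "dotp N a v = (\<Sum>j\<le>N. a j * v j)"

definition lform :: "nat \<Rightarrow> (nat \<Rightarrow> 'k::field) \<Rightarrow> (nat, 'k) mpoly" where
  "lform N a = (\<Sum>j\<le>N. single 0 (a j) * var j)"

lemma lform_forms: "lform N a \<in> forms N 1"
  unfolding lform_def using forms_mult[OF forms_const forms_var, of _ N] by (auto intro!: forms_sum)

lemma eval_lform [simp]: "mpoly_eval (lform N a) v = dotp N a v"
  by (simp add: lform_def dotp_def)

lemma dotp_add: "dotp N a (v + w) = dotp N a v + dotp N a w"
  by (simp add: dotp_def algebra_simps sum.distrib)

lemma dotp_scale: "dotp N a (scale_vec c v) = c * dotp N a v"
  by (simp add: dotp_def scale_vec_def sum_distrib_left mult.left_commute)

lemma dotp_sum: "dotp N a (sum f A) = (\<Sum>x\<in>A. dotp N a (f x))"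
  by (simp add: dotp_def sum_fun_apply sum_distrib_left) (rule sum.swap)

definition unit_vec :: "nat \<Rightarrow> nat \<Rightarrow> 'k::field" where
  "unit_vec j = (\<lambda>i. if i = j then 1 else 0)"

lemma coords_expand: "v \<in> coords N \<Longrightarrow> v = (\<Sum>j\<le>N. scale_vec (v j) (unit_vec j))"
proof
  fix i assume v: "v \<in> coords N"
  have "(\<Sum>j\<le>N. scale_vec (v j) (unit_vec j)) i = (\<Sum>j\<le>N. if i = j then v i else 0)"
    unfolding sum_fun_apply by (rule sum.cong) (auto simp: scale_vec_def unit_vec_def)
  then show "v i = (\<Sum>j\<le>N. scale_vec (v j) (unit_vec j)) i" using v by (auto simp: coords_def)
qed

lemma unit_vec_coords: "j \<le> N \<Longrightarrow> unit_vec j \<in> coords N"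
  by (auto simp: unit_vec_def coords_def)

lemma inj_unit_vec: "inj (unit_vec :: nat \<Rightarrow> nat \<Rightarrow> 'k::field)"
  by (rule injI) (metis unit_vec_def zero_neq_one)

lemma independent_unit_vecs: "vec.independent (unit_vec ` {..N} :: (nat \<Rightarrow> 'k::field) set)"
proof -
  have "u (unit_vec j) = 0" if "(\<Sum>v\<in>unit_vec ` {..N}. scale_vec (u v) v) = 0" "j \<le> N"
    for j and u :: "(nat \<Rightarrow> 'k) \<Rightarrow> 'k"
  proof -
    have "(\<Sum>v\<in>unit_vec ` {..N}. scale_vec (u v) v) = (\<Sum>i\<le>N. scale_vec (u (unit_vec i)) (unit_vec i))"
      by (rule sum.reindex[unfolded comp_def]) (rule inj_on_subset[OF inj_unit_vec], simp)
    then have "(\<Sum>i\<le>N. scale_vec (u (unit_vec i)) (unit_vec i)) j = 0"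
      using that(1) by (metis zero_fun_apply)
    moreover have "(\<Sum>i\<le>N. scale_vec (u (unit_vec i)) (unit_vec i)) j
        = (\<Sum>i\<le>N. if i = j then u (unit_vec j) else 0)"
      unfolding sum_fun_apply by (rule sum.cong) (auto simp: scale_vec_def unit_vec_def)
    ultimately show ?thesis using that(2) by simp
  qed
  then show ?thesis by (subst vec.dependent_finite) auto
qed

text \<open>The coordinate of \<open>w\<close> with respect to a basis that contains
  \<open>w\<close> and a basis of the span of \<open>S\<close>.\<close>

lemma functional_exists:
  assumes "w \<notin> vec.span S"
  shows "\<exists>\<phi> :: (nat \<Rightarrow> 'k::field) \<Rightarrow> 'k. (\<forall>v\<in>S. \<phi> v = 0) \<and> \<phi> w = 1 \<and>
    (\<forall>u v. \<phi> (u + v) = \<phi> u + \<phi> v) \<and> (\<forall>c v. \<phi> (scale_vec c v) = c * \<phi> v)"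
proof -
  obtain B where B: "B \<subseteq> S" "vec.independent B" "S \<subseteq> vec.span B"
    using vec.maximal_independent_subset[of S] by blast
  have "w \<notin> vec.span B" using assms vec.span_mono[OF B(1)] by blast
  then have ind: "vec.independent (insert w B)" using B(2) vec.independent_insertI by blast
  define E where "E = vec.extend_basis (insert w B)"
  have E: "vec.independent E" "vec.span E = UNIV" "insert w B \<subseteq> E"
    using vec.independent_extend_basis[OF ind] vec.span_extend_basis[OF ind]
      vec.extend_basis_superset[OF ind] by (auto simp: E_def)
  define \<phi> where "\<phi> v = vec.representation E v w" for v
  have add: "\<phi> (u + v) = \<phi> u + \<phi> v" for u v
    unfolding \<phi>_def using vec.representation_add[OF E(1)] E(2) by simp
  have sc: "\<phi> (scale_vec c v) = c * \<phi> v" for c v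
    unfolding \<phi>_def using vec.representation_scale[OF E(1)] E(2) by simp
  have "\<phi> w = 1" unfolding \<phi>_def using vec.representation_basis[OF E(1)] E(3) by simp
  moreover have "\<phi> v = 0" if "v \<in> S" for v
  proof -
    have "vec.subspace {v. \<phi> v = 0}"
      by (rule vec.subspaceI) (use sc[of 0 0] add sc in \<open>auto simp: scale_vec_def zero_fun_def\<close>)
    moreover have "B \<subseteq> {v. \<phi> v = 0}"
    proof
      fix b assume "b \<in> B"
      then have "b \<noteq> w" "b \<in> E" using \<open>w \<notin> vec.span B\<close> vec.span_base E(3) by auto
      then show "b \<in> {v. \<phi> v = 0}" unfolding \<phi>_def using vec.representation_basis[OF E(1)] by simp
    qed
    ultimately have "vec.span B \<subseteq> {v. \<phi> v = 0}" by (rule vec.span_minimal[rotated])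
    then show ?thesis using B(3) that by blast
  qed
  ultimately show ?thesis using add sc by blast
qed

lemma functional_dotp:
  assumes add: "\<And>u v. \<phi> (u + v) = \<phi> u + \<phi> v" and sc: "\<And>c v. \<phi> (scale_vec c v) = c * \<phi> v"
    and v: "v \<in> coords N"
  shows "\<phi> v = dotp N (\<lambda>j. \<phi> (unit_vec j)) (v :: nat \<Rightarrow> 'k::field)"
proof -
  have zero: "\<phi> 0 = 0" using add[of 0 0] by (metis add_cancel_left_right add.right_neutral)
  have "\<phi> (sum f A) = (\<Sum>x\<in>A. \<phi> (f x))" for f :: "nat \<Rightarrow> nat \<Rightarrow> 'k" and A
    by (induction A rule: infinite_finite_induct) (simp_all only: sum.infinite sum.empty sum.insert zero add not_False_eq_True)
  then have "\<phi> (\<Sum>j\<le>N. scale_vec (v j) (unit_vec j)) = dotp N (\<lambda>j. \<phi> (unit_vec j)) v"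
    by (simp add: sc dotp_def mult.commute)
  then show ?thesis using coords_expand[OF v] by simp
qed

text \<open>Along the moment curve \<open>(1, c, c^2, ...)\<close> the value at \<open>p\<close> is
  a polynomial in \<open>c\<close> with the entries of \<open>p\<close> as coefficients.\<close>

lemma generic_functional:
  fixes P :: "(nat \<Rightarrow> 'k::field_char_0) set"
  assumes "finite P" "\<And>p. p \<in> P \<Longrightarrow> p \<in> coords N \<and> p \<noteq> 0"
  shows "\<exists>a. \<forall>p\<in>P. dotp N a p \<noteq> 0"
proof -
  define Q where "Q p = (\<Sum>j\<le>N. monom (p j) j)" for p :: "nat \<Rightarrow> 'k"
  have "Q p \<noteq> 0" if p: "p \<in> P" for p
  proof -
    obtain i where "p i \<noteq> 0" using assms(2)[OF p] by (auto simp: fun_eq_iff)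
    moreover from this have "i \<le> N" using assms(2)[OF p] by (force simp: coords_def)
    moreover have "coeff (Q p) i = (\<Sum>j\<le>N. if j = i then p i else 0)"
      unfolding Q_def coeff_sum by (rule sum.cong) auto
    ultimately have "coeff (Q p) i \<noteq> 0" by simp
    then show ?thesis by auto
  qed
  then obtain c where c: "\<And>R. R \<in> Q ` P \<Longrightarrow> poly R c \<noteq> 0"
    using infinite_field_nonroots[of "Q ` P"] assms(1) by (metis (no_types, lifting) finite_imageI imageE)
  have "dotp N (\<lambda>j. c ^ j) p = poly (Q p) c" for p
    by (simp add: dotp_def Q_def poly_sum poly_monom mult.commute)
  then show ?thesis using c by (intro exI[of _ "\<lambda>j. c ^ j"]) auto
qed

text \<open>Spanning sets suit the passage to hyperplanes: one more vector turns a spanning set of a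
  proper hyperplane section of \<open>H\<close> into one of \<open>H\<close>.\<close>

definition dim_ge :: "(nat \<Rightarrow> 'k::field) set \<Rightarrow> nat \<Rightarrow> bool" where
  "dim_ge H k \<longleftrightarrow> (\<forall>S. finite S \<and> H \<subseteq> vec.span S \<longrightarrow> k \<le> card S)"

lemma dim_ge_coords: "dim_ge (coords N :: (nat \<Rightarrow> 'k::field) set) (Suc N)"
  unfolding dim_ge_def
proof (intro allI impI)
  fix S :: "(nat \<Rightarrow> 'k) set" assume S: "finite S \<and> coords N \<subseteq> vec.span S"
  have "unit_vec ` {..N} \<subseteq> vec.span S" using S unit_vec_coords by blast
  then have "card (unit_vec ` {..N} :: (nat \<Rightarrow> 'k) set) \<le> card S"
    using vec.independent_span_bound[OF _ independent_unit_vecs] S by blast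
  moreover have "card (unit_vec ` {..N} :: (nat \<Rightarrow> 'k) set) = Suc N"
    by (subst card_image) (auto intro: inj_on_subset[OF inj_unit_vec])
  ultimately show "Suc N \<le> card S" by simp
qed

text \<open>Independence of the indexed family: unlike independence of the image, it excludes
  repetitions.\<close>

definition indep_family :: "(nat \<Rightarrow> nat \<Rightarrow> 'k::field) \<Rightarrow> nat \<Rightarrow> bool" where
  "indep_family E e \<longleftrightarrow> (\<forall>c. (\<Sum>i<e. scale_vec (c i) (E i)) = 0 \<longrightarrow> (\<forall>i<e. c i = 0))"

lemma dim_ge_kernel:
  assumes "dim_ge H (Suc k)" "vec.subspace H" "H \<subseteq> coords N"
  shows "dim_ge (H \<inter> {v. dotp N a v = 0}) k"
proof (cases "\<exists>w\<in>H. dotp N a w \<noteq> 0")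
  case True
  then obtain w where w: "w \<in> H" "dotp N a w \<noteq> 0" by blast
  show ?thesis
    unfolding dim_ge_def
  proof (intro allI impI)
    fix S assume S: "finite S \<and> H \<inter> {v. dotp N a v = 0} \<subseteq> vec.span S"
    have "H \<subseteq> vec.span (insert w S)"
    proof
      fix v assume v: "v \<in> H"
      define c where "c = dotp N a v / dotp N a w"
      have "v - scale_vec c w \<in> H"
        using vec.subspace_diff[OF assms(2) v vec.subspace_scale[OF assms(2) w(1)]] .
      moreover have "dotp N a (v - scale_vec c w) = 0"
        using dotp_add[of N a "v - scale_vec c w" "scale_vec c w"] w(2) by (simp add: dotp_scale c_def)
      ultimately have "v - scale_vec c w \<in> vec.span S" using S by blast
      then show "v \<in> vec.span (insert w S)" using vec.span_breakdown_eq by blast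
    qed
    then have "Suc k \<le> card (insert w S)" using assms(1) S unfolding dim_ge_def by blast
    also have "\<dots> \<le> Suc (card S)" using S by (simp add: card_insert_if)
    finally show "k \<le> card S" by simp
  qed
next
  case False
  then have "H \<inter> {v. dotp N a v = 0} = H" by blast
  then show ?thesis using assms(1) Suc_leD unfolding dim_ge_def by metis
qed

text \<open>Cutting with hyperplanes that contain \<open>E\<close> lowers the dimension of \<open>X\<close> once the hyperplane misses
  a chosen point of each component. To achieve this, a hyperplane through \<open>E\<close> is moved together with
  \<open>E\<close> by the maps \<open>v \<mapsto> v + s \<lambda>(v) w\<close>; all conditions are open in \<open>s\<close>.\<close>

lemma general_position:
  fixes X :: "(nat \<Rightarrow> 'k::field_char_0) set set" and G :: "(nat \<times> nat, 'k) mpoly"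
  assumes "algebraic_set N X" "\<not> irreducible_chain N X q" "dim_ge H (e + q)"
    "vec.subspace H" "H \<subseteq> coords N" "\<And>L. L \<in> X \<Longrightarrow> L \<subseteq> H"
    "indep_family E e" "\<And>i. i < e \<Longrightarrow> E i \<in> H"
    "mpoly_eval G (\<lambda>(i, j). if i < e then E i j else r j) \<noteq> 0"
  shows "\<exists>E'. indep_family E' e \<and> (\<forall>i<e. E' i \<in> H) \<and>
    mpoly_eval G (\<lambda>(i, j). if i < e then E' i j else r j) \<noteq> 0 \<and>
    (\<forall>L\<in>X. \<not> L \<subseteq> vec.span (E' ` {..<e}))"
  using assms
proof (induction q arbitrary: X H E)
  case 0
  then have "X = {}" using no_chain_0_empty by blast
  then show ?case using 0 by (intro exI[of _ E]) simp
next
  case (Suc q)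
  note X = Suc.prems(1) and H = Suc.prems(4,5) and EH = Suc.prems(8)
  obtain C where C: "finite C" "\<And>Y. Y \<in> C \<Longrightarrow> irreducible_set N Y" "X = \<Union>C"
    using irreducible_decomposition[OF X] by blast
  have "\<exists>p. p \<in> coords N \<and> p \<noteq> 0 \<and> vec.span {p} \<in> Y" if Y: "Y \<in> C" for Y
  proof -
    have "Y \<noteq> {}" "Y \<subseteq> proj_space N"
      using C(2)[OF Y] algebraic_set_proj_space[of N Y] by (auto simp: irreducible_set_def)
    then obtain L where "L \<in> Y" "L \<in> proj_space N" by blast
    then show ?thesis unfolding proj_space_iff by blast
  qed
  then obtain p where p: "\<And>Y. Y \<in> C \<Longrightarrow> p Y \<in> coords N \<and> p Y \<noteq> 0 \<and> vec.span {p Y} \<in> Y"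
    by metis
  obtain lam where lam: "\<And>Y. Y \<in> C \<Longrightarrow> dotp N lam (p Y) \<noteq> 0"
    using generic_functional[of "p ` C" N] C(1) p by (metis (no_types, lifting) finite_imageI imageE imageI)
  have "\<not> H \<subseteq> vec.span (E ` {..<e})"
    using Suc.prems(3) card_image_le[of "{..<e}" E] unfolding dim_ge_def
    by (metis add_Suc_right card_lessThan finite_imageI finite_lessThan le_add1 le_trans not_less_eq_eq)
  then obtain w where w: "w \<in> H" "w \<notin> vec.span (E ` {..<e})" by blast
  \<comment> \<open>\<open>\<phi> = 0\<close> is a hyperplane that contains \<open>E\<close> but not
    \<open>w\<close>; \<open>w\<close> is the direction in which \<open>E\<close> will move.\<close>
  obtain \<phi> where \<phi>: "\<forall>v\<in>E ` {..<e}. \<phi> v = 0" "\<phi> w = 1" "\<forall>u v. \<phi> (u + v) = \<phi> u + \<phi> v"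
    "\<forall>c v. \<phi> (scale_vec c v) = c * \<phi> v"
    using functional_exists[OF w(2)] by blast
  define l where "l j = \<phi> (unit_vec j)" for j
  have l: "dotp N l v = \<phi> v" if "v \<in> coords N" for v
    unfolding l_def[abs_def] using functional_dotp[of \<phi> v N, OF _ _ that] \<phi>(3,4) by metis
  have lE: "dotp N l (E i) = 0" if i: "i < e" for i
  proof -
    have "E i \<in> coords N" using EH[OF i] H(2) by blast
    then show ?thesis using l \<phi>(1) i by simp
  qed
  have lw: "dotp N l w = 1" using l[of w] w(1) H(2) \<phi>(2) by (metis subsetD)
  \<comment> \<open>The matrix of the moved family is \<open>M0 + s * M1\<close>; the rows from
    \<open>e\<close> on keep the fixed value \<open>r\<close>.\<close>
  define M0 M1 where "M0 = (\<lambda>(i, j). if i < e then E i j else r j)"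
    and "M1 = (\<lambda>(i, j). if i < e then dotp N lam (E i) * w j else 0)"
  from mpoly_eval_on_line[of G M0 M1]
  obtain PG where PG: "\<forall>s. poly PG s = mpoly_eval G (\<lambda>x. M0 x + s * M1 x)" ..
  \<comment> \<open>The value of the moved hyperplane at \<open>p Y\<close> as a polynomial in
    \<open>s\<close>. If its constant term is 0, the linear coefficient is
    \<open>- dotp N lam (p Y)\<close>, which is nonzero.\<close>
  define Q where "Q Y = [:dotp N l (p Y), dotp N lam w * dotp N l (p Y) - dotp N lam (p Y):]" for Y
  have "PG \<noteq> 0" using PG[rule_format, of 0] Suc.prems(9) by (auto simp: M0_def)
  moreover have "Q Y \<noteq> 0" if "Y \<in> C" for Y using lam[OF that] by (auto simp: Q_def)
  moreover have "[:1, dotp N lam w:] \<noteq> 0" by simp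
  ultimately have "0 \<notin> insert PG (insert [:1, dotp N lam w:] (Q ` C))" by auto
  then obtain s where s: "\<And>R. R \<in> insert PG (insert [:1, dotp N lam w:] (Q ` C)) \<Longrightarrow> poly R s \<noteq> 0"
    using infinite_field_nonroots[of "insert PG (insert [:1, dotp N lam w:] (Q ` C))"] C(1) by blast
  define E1 where "E1 i = E i + scale_vec (s * dotp N lam (E i)) w" for i
  \<comment> \<open>\<open>ls\<close> is \<open>1 + s * dotp N lam w\<close> times the composition
    of \<open>l\<close> with the inverse of the moving map, hence it vanishes on the moved family
    \<open>E1\<close>.\<close>
  define ls where "ls j = l j + s * (dotp N lam w * l j - lam j)" for j
  have ls: "dotp N ls v = dotp N l v + s * (dotp N lam w * dotp N l v - dotp N lam v)" for v
    unfolding dotp_def[of N ls] dotp_def[of N l v] dotp_def[of N lam v] ls_def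
    by (simp add: algebra_simps sum.distrib sum_subtractf sum_distrib_left)
  have s1: "1 + s * dotp N lam w \<noteq> 0" using s[of "[:1, dotp N lam w:]"] by simp
  define H1 where "H1 = H \<inter> {v. dotp N ls v = 0}"
  have E1H: "E1 i \<in> H1" if "i < e" for i
  proof -
    have "E1 i \<in> H" unfolding E1_def
      by (intro vec.subspace_add[OF H(1)] vec.subspace_scale[OF H(1)] EH that w)
    moreover have "dotp N ls (E1 i) = 0"
      using lE[OF that] lw by (simp add: ls E1_def dotp_add dotp_scale algebra_simps)
    ultimately show ?thesis by (simp add: H1_def)
  qed
  have E1ind: "indep_family E1 e"
    unfolding indep_family_def
  proof (intro allI impI)
    fix c i assume c: "(\<Sum>i<e. scale_vec (c i) (E1 i)) = 0" and i: "i < e"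
    define u where "u = (\<Sum>i<e. scale_vec (c i) (E i))"
    have "(\<Sum>i<e. scale_vec (c i) (E1 i)) = u + scale_vec (s * dotp N lam u) w"
      by (auto simp: u_def E1_def fun_eq_iff sum_fun_apply scale_vec_def dotp_sum sum_distrib_left sum_distrib_right
          algebra_simps sum.distrib dotp_scale[unfolded scale_vec_def])
    then have u: "u + scale_vec (s * dotp N lam u) w = 0" using c by simp
    \<comment> \<open>Applying \<open>lam\<close> isolates the factor
      \<open>1 + s * dotp N lam w\<close>, which was kept nonzero so that the moving map is
      injective.\<close>
    have "dotp N lam (u + scale_vec (s * dotp N lam u) w) = 0" unfolding u by (simp add: dotp_def)
    then have "dotp N lam u * (1 + s * dotp N lam w) = 0"
      by (simp add: dotp_add dotp_scale algebra_simps)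
    then have "dotp N lam u = 0" using s1 by simp
    then have "u = 0" using u by (simp add: scale_vec_def fun_eq_iff)
    then show "c i = 0" using Suc.prems(7) i unfolding u_def indep_family_def by blast
  qed
  have "mpoly_eval G (\<lambda>(i, j). if i < e then E1 i j else r j) = poly PG s"
    unfolding PG[rule_format] M0_def M1_def
    by (rule arg_cong[of _ _ "mpoly_eval G"]) (auto simp: E1_def scale_vec_def fun_eq_iff)
  then have G1: "mpoly_eval G (\<lambda>(i, j). if i < e then E1 i j else r j) \<noteq> 0" using s by simp
  define V where "V = {L \<in> proj_space N. vanishes_at (lform N ls) L}"
  have V: "vec.span {v} \<in> V \<longleftrightarrow> dotp N ls v = 0" if "v \<in> coords N" "v \<noteq> 0" for v
    using that vanishes_at_span[OF lform_forms, of N ls v] proj_space_iff by (auto simp: V_def)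
  define X1 where "X1 = X \<inter> V"
  have X1alg: "algebraic_set N X1"
    unfolding X1_def V_def by (intro algebraic_set_Int X algebraic_set_form[OF lform_forms])
  have X1chain: "\<not> irreducible_chain N X1 q"
    unfolding X1_def C(3)
  proof (rule hyperplane_section_no_chain[OF C(1)])
    show "\<not> irreducible_chain N (\<Union>C) (Suc q)" using Suc.prems(2) C(3) by simp
    fix Y assume Y: "Y \<in> C"
    have "dotp N ls (p Y) \<noteq> 0" using s[of "Q Y"] Y by (simp add: Q_def ls)
    then have "vec.span {p Y} \<notin> V" using V p[OF Y] by blast
    then show "irreducible_set N Y \<and> \<not> Y \<subseteq> V" using C(2)[OF Y] p[OF Y] by blast
  qed
  have H1: "dim_ge H1 (e + q)" "vec.subspace H1" "H1 \<subseteq> coords N"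
  proof -
    show "dim_ge H1 (e + q)"
      unfolding H1_def using Suc.prems(3) by (intro dim_ge_kernel H) simp
    have "vec.subspace {v. dotp N ls v = 0}"
      by (rule vec.subspaceI) (auto simp: dotp_add dotp_scale, simp add: dotp_def)
    then show "vec.subspace H1" unfolding H1_def by (rule vec.subspace_inter[OF H(1)])
    show "H1 \<subseteq> coords N" using H(2) by (auto simp: H1_def)
  qed
  have X1H1: "L \<subseteq> H1" if L: "L \<in> X1" for L
  proof -
    have LV: "L \<in> X" "vanishes_at (lform N ls) L" using L by (auto simp: X1_def V_def)
    then show ?thesis using Suc.prems(6) by (auto simp: H1_def vanishes_at_def)
  qed
  obtain E2 where E2: "indep_family E2 e" "\<forall>i<e. E2 i \<in> H1"
    "mpoly_eval G (\<lambda>(i, j). if i < e then E2 i j else r j) \<noteq> 0"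
    "\<forall>L\<in>X1. \<not> L \<subseteq> vec.span (E2 ` {..<e})"
    using Suc.IH[OF X1alg X1chain H1 X1H1 E1ind E1H G1] by blast
  \<comment> \<open>\<open>E2\<close> lies in the hyperplane, so a point of \<open>X\<close> in its
    span is already a point of the section \<open>X1\<close>.\<close>
  have "\<not> L \<subseteq> vec.span (E2 ` {..<e})" if L: "L \<in> X" for L
  proof
    assume sub: "L \<subseteq> vec.span (E2 ` {..<e})"
    have "vec.span (E2 ` {..<e}) \<subseteq> H1" by (rule vec.span_minimal[OF _ H1(2)]) (use E2(2) in auto)
    then have "\<forall>v\<in>L. dotp N ls v = 0" using sub by (auto simp: H1_def)
    moreover have "L \<in> proj_space N" using L algebraic_set_proj_space[OF X] by blast
    ultimately have "L \<in> X1" using L by (simp add: X1_def V_def vanishes_at_def)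
    then show False using E2(4) sub by blast
  qed
  then show ?case using E2 by (intro exI[of _ E2]) (auto simp: H1_def)
qed

section \<open>The projective Nullstellensatz\<close>

lemma dependent_family:
  fixes q :: "'b \<Rightarrow> 'v \<Rightarrow> 'k::field"
  assumes "finite B" "finite T" "\<And>b. b \<in> B \<Longrightarrow> q b \<in> vec.span T" "card T < card B"
  shows "\<exists>c. (\<exists>b\<in>B. c b \<noteq> 0) \<and> (\<Sum>b\<in>B. scale_vec (c b) (q b)) = 0"
proof (cases "inj_on q B")
  case True
  have "\<not> vec.independent (q ` B)"
  proof
    assume "vec.independent (q ` B)"
    then have "card (q ` B) \<le> card T"
      using vec.independent_span_bound[OF assms(2)] assms(3) by blast
    then show False using card_image[OF True] assms(4) by simp
  qed
  then obtain u where u: "\<exists>v\<in>q ` B. u v \<noteq> 0" "(\<Sum>v\<in>q ` B. scale_vec (u v) v) = 0"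
    using vec.dependent_finite[of "q ` B"] assms(1) by auto
  then show ?thesis
    by (intro exI[of _ "u \<circ> q"]) (use True in \<open>auto simp: sum.reindex comp_def\<close>)
next
  case False
  then obtain b b' where b: "b \<in> B" "b' \<in> B" "b \<noteq> b'" "q b = q b'" by (auto simp: inj_on_def)
  define c :: "'b \<Rightarrow> 'k" where "c x = (if x = b then 1 else if x = b' then - 1 else 0)" for x
  have "(\<Sum>x\<in>B. scale_vec (c x) (q x)) = (\<Sum>x\<in>{b, b'}. scale_vec (c x) (q x))"
    by (rule sum.mono_neutral_right) (use assms(1) b in \<open>auto simp: c_def scale_vec_def\<close>)
  also have "\<dots> = 0" using b by (simp add: c_def scale_vec_def fun_eq_iff)
  finally show ?thesis using b(1) by (intro exI[of _ c]) (auto simp: c_def)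
qed

lemma lookup_in_span:
  assumes "keys p \<subseteq> K" "finite K"
  shows "lookup p \<in> vec.span (lookup ` (\<lambda>m. single m 1) ` K)"
proof -
  have "lookup p = (\<Sum>m\<in>K. scale_vec (lookup p m) (lookup (single m 1)))"
  proof
    fix k
    have "(\<Sum>m\<in>K. scale_vec (lookup p m) (lookup (single m 1))) k = (\<Sum>m\<in>K. if m = k then lookup p k else 0)"
      unfolding sum_fun_apply by (rule sum.cong) (auto simp: scale_vec_def lookup_single)
    then show "lookup p k = (\<Sum>m\<in>K. scale_vec (lookup p m) (lookup (single m 1))) k"
      using assms by (auto simp: in_keys_iff)
  qed
  also have "\<dots> \<in> vec.span (lookup ` (\<lambda>m. single m 1) ` K)"
    by (intro vec.span_sum vec.span_scale vec.span_base) auto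
  finally show ?thesis .
qed

lemma dependent_polynomials:
  fixes q :: "'b \<Rightarrow> ('v, 'k::field) mpoly"
  assumes "finite B" "finite K" "\<And>b. b \<in> B \<Longrightarrow> keys (q b) \<subseteq> K" "card K < card B"
  shows "\<exists>c. (\<exists>b\<in>B. c b \<noteq> 0) \<and> (\<Sum>b\<in>B. single 0 (c b) * q b) = 0"
proof -
  let ?T = "lookup ` (\<lambda>m. single m (1::'k)) ` K"
  have "card ?T \<le> card K" by (metis assms(2) card_image_le finite_imageI order_trans)
  then have "card ?T < card B" using assms(4) by simp
  moreover have "lookup (q b) \<in> vec.span ?T" if "b \<in> B" for b
    by (rule lookup_in_span[OF assms(3)[OF that] assms(2)])
  ultimately have "\<exists>c. (\<exists>b\<in>B. c b \<noteq> 0) \<and> (\<Sum>b\<in>B. scale_vec (c b) (lookup (q b))) = 0"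
    using assms(1,2) by (intro dependent_family[of B ?T]) auto
  then obtain c where c: "\<exists>b\<in>B. c b \<noteq> 0" "(\<Sum>b\<in>B. scale_vec (c b) (lookup (q b))) = 0" by blast
  have "(\<Sum>b\<in>B. single 0 (c b) * q b) = 0"
  proof (rule poly_mapping_eqI)
    fix k
    have "lookup (\<Sum>b\<in>B. single 0 (c b) * q b) k = (\<Sum>b\<in>B. scale_vec (c b) (lookup (q b))) k"
      unfolding lookup_sum sum_fun_apply
      using lookup_single_mult[of 0 _ "q _" k] by (simp add: scale_vec_def)
    then show "lookup (\<Sum>b\<in>B. single 0 (c b) * q b) k = lookup 0 k" using c(2) by simp
  qed
  then show ?thesis using c(1) by blast
qed

lemma split_exponent:
  fixes m :: "'v \<Rightarrow>\<^sub>0 nat"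
  assumes "mon_degree m = a + b"
  obtains m1 m2 where "m = m1 + m2" "mon_degree m1 = a" "mon_degree m2 = b"
  using assms
proof (induction a arbitrary: m thesis)
  case 0
  then show ?case by (metis add_0 mon_degree_0)
next
  case (Suc a)
  then have "m \<noteq> 0" by auto
  then obtain i where i: "i \<in> keys m" by (metis all_not_in_conv keys_eq_empty)
  define m' where "m' = m - single i 1"
  have m: "m = single i 1 + m'"
    using i by (intro poly_mapping_eqI) (auto simp: m'_def lookup_add lookup_minus lookup_single when_def in_keys_iff)
  then have "mon_degree m' = a + b" using Suc.prems(2) by (simp add: mon_degree_add)
  then obtain m1 m2 where "m' = m1 + m2" "mon_degree m1 = a" "mon_degree m2 = b"
    using Suc.IH by blast
  then show ?case
    using Suc.prems(1)[of "single i 1 + m1" m2] m by (simp add: mon_degree_add add.assoc)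
qed

text \<open>Every monomial of degree \<open>a + b\<close> is a product of monomials of degrees
  \<open>a\<close> and \<open>b\<close>.\<close>

lemma forms_add_subset:
  fixes K :: "(nat, 'k::field) mpoly set"
  assumes K: "is_ideal N K"
    and prod: "\<And>p q. p \<in> forms N (int a) \<Longrightarrow> q \<in> forms N (int b) \<Longrightarrow> p * q \<in> K"
  shows "forms N (int (a + b)) \<subseteq> K"
proof
  fix p :: "(nat, 'k) mpoly" assume p: "p \<in> forms N (int (a + b))"
  have "single m (lookup p m) \<in> K" if "m \<in> keys p" for m
  proof -
    have m: "mon_degree m = a + b" "keys m \<subseteq> {..N}"
      using p that by (auto simp: forms_def polys_def)
    obtain m1 m2 where m12: "m = m1 + m2" "mon_degree m1 = a" "mon_degree m2 = b"
      using split_exponent[OF m(1)] by blast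
    have "keys m1 \<subseteq> {..N}" "keys m2 \<subseteq> {..N}" using m(2) unfolding m12(1) keys_nat_add by auto
    then have "single m1 (lookup p m) * single m2 1 \<in> K"
      using m12 by (intro prod forms_single) auto
    then show ?thesis by (simp add: mult_single m12(1))
  qed
  then show "p \<in> K" by (subst mpoly_as_sum) (intro ideal_sum[OF K])
qed

lemma forms_subset_mono:
  fixes K :: "(nat, 'k::field) mpoly set"
  assumes "is_ideal N K" "forms N (int a) \<subseteq> K"
  shows "forms N (int (a + b)) \<subseteq> K"
proof (rule forms_add_subset[OF assms(1)])
  fix p q :: "(nat, 'k) mpoly" assume "p \<in> forms N (int a)" "q \<in> forms N (int b)"
  then show "p * q \<in> K"
    using ideal_mult[OF assms(1) forms_polyring, of q "int b" p] assms(2) by (auto simp: mult.commute)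
qed

definition principal :: "nat \<Rightarrow> (nat, 'k::field) mpoly \<Rightarrow> (nat, 'k) mpoly set" where
  "principal N f = (\<lambda>g. g * f) ` polyring N"

lemma is_ideal_principal:
  fixes f :: "(nat, 'a::field) mpoly"
  shows "f \<in> polyring N \<Longrightarrow> is_ideal N (principal N f)"
  unfolding is_ideal_def
proof (intro conjI ballI)
  assume f: "f \<in> polyring N"
  show "principal N f \<subseteq> polyring N" using f by (auto simp: principal_def intro: polys_mult)
  show "0 \<in> principal N f" using polys_0 by (force simp: principal_def)
next
  fix p q assume "p \<in> principal N f" "q \<in> principal N f"
  then obtain g h where "g \<in> polyring N" "h \<in> polyring N" "p = g * f" "q = h * f"
    by (auto simp: principal_def)
  then show "p + q \<in> principal N f"
    unfolding principal_def by (intro image_eqI[of _ _ "g + h"]) (auto simp: algebra_simps intro: polys_add)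
next
  fix g p :: "(nat, 'a) mpoly" assume "g \<in> polyring N" "p \<in> principal N f"
  then obtain h where "h \<in> polyring N" "p = h * f" by (auto simp: principal_def)
  then show "g * p \<in> principal N f"
    unfolding principal_def using \<open>g \<in> polyring N\<close>
    by (intro image_eqI[of _ _ "g * h"]) (auto simp: mult.assoc intro: polys_mult)
qed

lemma homogeneous_principal: "f \<in> forms N s \<Longrightarrow> homogeneous_set (principal N f)"
  unfolding homogeneous_set_def principal_def
  by (auto simp: mult.commute[of _ f] hcomp_mult_form intro!: image_eqI hcomp_polyring)

lemma var_power: "var i ^ k = single (single i k) 1"
proof (induction k)
  case (Suc k)
  have "single (single i 1) (1::'b) * single (single i k) 1 = single (single i (Suc k)) 1"
    by (simp only: mult_single mult_1 single_add[symmetric] plus_1_eq_Suc)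
  then show ?case using Suc by (simp add: var_def)
qed simp

lemma monv_var: "monv var m = single m 1"
proof -
  have "(\<Prod>i\<in>A. single (f i) (1::'b)) = single (\<Sum>i\<in>A. f i) 1" for f :: "'a \<Rightarrow> 'a \<Rightarrow>\<^sub>0 nat" and A
    by (induction A rule: infinite_finite_induct) (simp_all add: mult_single)
  then have "monv var m = single (\<Sum>i\<in>keys m. single i (lookup m i)) (1::'b)"
    by (simp add: monv_def var_power)
  then show ?thesis using mpoly_as_sum[of m] by simp
qed

lemma single_eq_monv: "single m c = single 0 c * monv var m"
  by (simp add: monv_var mult_single)

lemma congruent_prod:
  assumes K: "is_ideal N K" and "\<And>i. i \<in> A \<Longrightarrow> f i \<in> polyring N \<and> g i \<in> polyring N \<and> f i - g i \<in> K"
  shows "prod f A - prod g A \<in> K"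
  using assms(2)
proof (induction A rule: infinite_finite_induct)
  case (insert i A)
  have "prod f (insert i A) - prod g (insert i A) = prod f A * (f i - g i) + g i * (prod f A - prod g A)"
    using insert(1,2) by (simp add: algebra_simps)
  also have "\<dots> \<in> K"
    using insert by (intro ideal_add[OF K] ideal_mult[OF K] polys_prod) auto
  finally show ?case .
qed (use ideal_0[OF K] in auto)

lemma ideal_eq_polyring: "is_ideal N K \<Longrightarrow> 1 \<in> K \<Longrightarrow> K = polyring N"
  using ideal_mult[of N K _ 1] ideal_polyring by (metis mult.right_neutral subsetI subset_antisym)

text \<open>Homogenizing a univariate polynomial turns the root \<open>c\<close> into the linear
  factor \<open>x - h c * y\<close>. Here \<open>n\<close> only bounds the degree, so a power of
  \<open>y\<close> may split off as well.\<close>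

lemma homogenization_factor:
  fixes x y :: "'a::comm_ring_1" and Q :: "'k::comm_ring_1 poly"
  assumes h: "ring_hom h" and Q: "degree Q \<le> n"
  shows "(\<Sum>b\<le>Suc n. h (coeff ([:- c, 1:] * Q) b) * x ^ b * y ^ (Suc n - b)) =
    (x - h c * y) * (\<Sum>b\<le>n. h (coeff Q b) * x ^ b * y ^ (n - b))"
proof -
  have h0: "h 0 = 0" and hm: "h (a * b) = h a * h b" and hd: "h (a - b) = h a - h b" for a b
  proof -
    show "h 0 = 0" "h (a * b) = h a * h b" using h by (auto simp: ring_hom_def)
    have "h (a - b) + h b = h a" using h unfolding ring_hom_def by (metis diff_add_cancel)
    then show "h (a - b) = h a - h b" by (simp add: eq_diff_eq)
  qed
  have coeff: "coeff ([:- c, 1:] * Q) b = (case b of 0 \<Rightarrow> 0 | Suc k \<Rightarrow> coeff Q k) - c * coeff Q b" for b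
    by (simp add: coeff_pCons split: nat.split)
  have "(\<Sum>b\<le>Suc n. h (coeff ([:- c, 1:] * Q) b) * x ^ b * y ^ (Suc n - b)) =
      (\<Sum>b\<le>Suc n. h (case b of 0 \<Rightarrow> 0 | Suc k \<Rightarrow> coeff Q k) * x ^ b * y ^ (Suc n - b)) -
      (\<Sum>b\<le>Suc n. h c * h (coeff Q b) * x ^ b * y ^ (Suc n - b))"
    unfolding coeff hd hm by (simp only: sum_subtractf[symmetric] left_diff_distrib)
  also have "(\<Sum>b\<le>Suc n. h (case b of 0 \<Rightarrow> 0 | Suc k \<Rightarrow> coeff Q k) * x ^ b * y ^ (Suc n - b)) =
      x * (\<Sum>b\<le>n. h (coeff Q b) * x ^ b * y ^ (n - b))"
    unfolding sum.atMost_Suc_shift by (simp add: h0 sum_distrib_left algebra_simps)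
  also have "(\<Sum>b\<le>Suc n. h c * h (coeff Q b) * x ^ b * y ^ (Suc n - b)) =
      h c * y * (\<Sum>b\<le>n. h (coeff Q b) * x ^ b * y ^ (n - b))"
  proof -
    have "coeff Q (Suc n) = 0" using Q by (simp add: coeff_eq_0)
    then show ?thesis
      by (simp add: h0 sum_distrib_left) (rule sum.cong, auto simp: Suc_diff_le algebra_simps)
  qed
  finally show ?thesis by (simp add: left_diff_distrib)
qed

text \<open>An ideal maximal among the homogeneous ideals that contain no power of the irrelevant ideal is
  the ideal of a point: modulo such an ideal and a variable outside it, only finitely many degrees
  survive, so any two variables satisfy a binary form, which splits into linear factors.\<close>

locale maximal_relevant =
  fixes N :: nat and K :: "(nat, 'k::alg_closed_field) mpoly set"
  assumes K_ideal: "is_ideal N K" and K_homogeneous: "homogeneous_set K"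
    and K_relevant: "\<And>M. \<not> forms N (int M) \<subseteq> K"
    and K_maximal: "\<And>K'. is_ideal N K' \<Longrightarrow> homogeneous_set K' \<Longrightarrow> K \<subset> K' \<Longrightarrow> \<exists>M. forms N (int M) \<subseteq> K'"
begin

lemma one_notin: "1 \<notin> K"
  using K_relevant[of 0] ideal_eq_polyring[OF K_ideal] forms_polyring by blast

lemma forms_in_add_principal:
  assumes "f \<in> forms N s" "f \<notin> K"
  shows "\<exists>M. forms N (int M) \<subseteq> set_sum K (principal N f)"
proof (rule K_maximal)
  have f: "f \<in> polyring N" using assms(1) forms_polyring by blast
  show "is_ideal N (set_sum K (principal N f))"
    by (intro is_ideal_set_sum K_ideal is_ideal_principal f)
  show "homogeneous_set (set_sum K (principal N f))"
    by (intro homogeneous_set_sum K_homogeneous homogeneous_principal[OF assms(1)])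
  have "f \<in> principal N f" unfolding principal_def by (rule image_eqI[of _ _ 1]) auto
  then have "f \<in> set_sum K (principal N f)" by (rule set_sum_right[OF K_ideal])
  then show "K \<subset> set_sum K (principal N f)"
    using set_sum_left[OF is_ideal_principal[OF f]] assms(2) by blast
qed

text \<open>If neither factor lies in \<open>K\<close>, maximality gives all forms of some degrees
  \<open>a\<close> and \<open>b\<close> in the two enlarged ideals; with \<open>f * g\<close> in
  \<open>K\<close>, their products and hence all forms of degree \<open>a + b\<close> would lie in
  \<open>K\<close>.\<close>

lemma prime:
  assumes f: "f \<in> forms N s" "f \<notin> K" and g: "g \<in> forms N t" "g \<notin> K"
  shows "f * g \<notin> K"
proof
  assume fg: "f * g \<in> K"
  obtain a b where ab: "forms N (int a) \<subseteq> set_sum K (principal N f)"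
    "forms N (int b) \<subseteq> set_sum K (principal N g)"
    using forms_in_add_principal f g by metis
  have "forms N (int (a + b)) \<subseteq> K"
  proof (rule forms_add_subset[OF K_ideal])
    fix p q :: "(nat, 'k) mpoly" assume p: "p \<in> forms N (int a)" and q: "q \<in> forms N (int b)"
    obtain k u where u: "p = k + u * f" "k \<in> K" "u \<in> polyring N"
      using p ab(1) by (force simp: set_sum_def principal_def)
    obtain k' u' where u': "q = k' + u' * g" "k' \<in> K" "u' \<in> polyring N"
      using q ab(2) by (force simp: set_sum_def principal_def)
    have "p * q = q * k + (u * f) * k' + (u * u') * (f * g)"
      unfolding u(1) u'(1) by (simp add: algebra_simps)
    also have "\<dots> \<in> K"
      by (rule ideal_add[OF K_ideal ideal_add[OF K_ideal
            ideal_mult[OF K_ideal forms_polyring[OF q] u(2)]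
            ideal_mult[OF K_ideal polys_mult[OF u(3) forms_polyring[OF f(1)]] u'(2)]]
          ideal_mult[OF K_ideal polys_mult[OF u(3) u'(3)] fg]])
    finally show "p * q \<in> K" .
  qed
  then show False using K_relevant by blast
qed

lemma prime_power: "f \<in> forms N s \<Longrightarrow> f \<notin> K \<Longrightarrow> f ^ k \<notin> K"
proof (induction k)
  case (Suc k)
  then show ?case using prime[OF Suc.prems forms_power[OF Suc.prems(1)], of k] by simp
qed (simp add: one_notin)

lemma const_mult_notin:
  assumes "c \<noteq> 0" "f \<in> forms N s" "f \<notin> K" shows "single 0 c * f \<notin> K"
proof
  assume "single 0 c * f \<in> K"
  then have "single 0 (1 / c) * (single 0 c * f) \<in> K"
    using ideal_mult[OF K_ideal polys_single] by simp
  also have "single 0 (1 / c) * (single 0 c * f) = f"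
    using assms(1) by (simp only: mult.assoc[symmetric] mult_single) simp
  finally have "f \<in> K" .
  then show False using assms(3) by simp
qed

lemma exists_var_notin: "\<exists>a\<le>N. var a \<notin> K"
proof (rule ccontr)
  assume "\<not> ?thesis"
  then have var: "var i \<in> K" if "i \<le> N" for i using that by blast
  have "forms N (int 1) \<subseteq> K"
  proof
    fix p :: "(nat, 'k) mpoly" assume p: "p \<in> forms N (int 1)"
    have "single m (lookup p m) \<in> K" if m: "m \<in> keys p" for m
    proof -
      have m1: "mon_degree m = 1" "keys m \<subseteq> {..N}" using p m by (auto simp: forms_def polys_def)
      then obtain i where i: "i \<in> keys m" by (metis all_not_in_conv keys_eq_empty mon_degree_0 zero_neq_one)
      have "m = single i 1 + (m - single i 1)"
        using i by (intro poly_mapping_eqI) (auto simp: lookup_add lookup_minus lookup_single when_def in_keys_iff)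
      moreover from this have "mon_degree (m - single i 1) = 0"
        using m1(1) by (metis add_cancel_right_right mon_degree_add mon_degree_single)
      ultimately have "m = single i 1" by (metis add.right_neutral mon_degree_eq_0_iff)
      then have "single m (lookup p m) = single 0 (lookup p m) * var i"
        by (simp add: var_def mult_single)
      moreover have "i \<le> N" using i m1(2) by blast
      ultimately show ?thesis using ideal_mult[OF K_ideal polys_single var, of 0 i] by simp
    qed
    then show "p \<in> K" by (subst mpoly_as_sum) (intro ideal_sum[OF K_ideal])
  qed
  then show False using K_relevant by blast
qed

text \<open>The binary form splits over the algebraically closed field, and by primality some factor
  lies in \<open>K\<close>. This can be neither \<open>var a\<close> nor a nonzero constant.\<close>

lemma homogenization_root:
  fixes P :: "'k poly"
  assumes a: "a \<le> N" "var a \<notin> K" and i: "i \<le> N"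
    and P: "P \<noteq> 0" "degree P \<le> n" "(\<Sum>b\<le>n. single 0 (coeff P b) * var i ^ b * var a ^ (n - b)) \<in> K"
  shows "\<exists>c. var i - single 0 c * var a \<in> K"
  using P
proof (induction n arbitrary: P)
  case 0
  then have "single 0 (coeff P 0) * 1 \<in> K" by simp
  moreover have "coeff P 0 \<noteq> 0" using 0 by (metis le_zero_eq leading_coeff_0_iff)
  ultimately show ?case using const_mult_notin forms_1 one_notin by blast
next
  case (Suc n)
  show ?case
  proof (cases "degree P = 0")
    case True
    then obtain c where c: "P = [:c:]" by (rule degree_eq_zeroE)
    have "(\<Sum>b\<le>Suc n. single 0 (coeff P b) * var i ^ b * var a ^ (Suc n - b)) = single 0 c * var a ^ Suc n"
      unfolding sum.atMost_Suc_shift c by simp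
    then show ?thesis
      using Suc.prems const_mult_notin[OF _ forms_power[OF forms_var[OF a(1)]] prime_power[OF forms_var[OF a(1)] a(2)]] c
      by (metis pCons_0_0)
  next
    case False
    then obtain c where "poly P c = 0" using alg_closed_imp_poly_has_root by blast
    then obtain Q where Q: "P = [:- c, 1:] * Q" using poly_eq_0_iff_dvd by (metis dvd_def)
    have Q0: "Q \<noteq> 0" using Q Suc.prems(1) by auto
    have "degree P = Suc (degree Q)" unfolding Q using Q0 by (subst degree_mult_eq) auto
    then have degQ: "degree Q \<le> n" using Suc.prems(2) by simp
    let ?h = "\<Sum>b\<le>n. single 0 (coeff Q b) * var i ^ b * var a ^ (n - b)"
    have "(var i - single 0 c * var a) * ?h \<in> K"
      using Suc.prems(3) unfolding Q homogenization_factor[OF ring_hom_const degQ] .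
    moreover have "?h \<in> forms N (int n)"
    proof (rule forms_sum)
      fix b assume "b \<in> {..n}"
      then have "0 + int b * 1 + int (n - b) * 1 = int n" by simp
      then show "single 0 (coeff Q b) * var i ^ b * var a ^ (n - b) \<in> forms N (int n)"
        using forms_mult[OF forms_mult[OF forms_const forms_power[OF forms_var[OF i]]] forms_power[OF forms_var[OF a(1)]], of "coeff Q b" b "n - b"]
        by simp
    qed
    moreover have "var i - single 0 c * var a \<in> forms N 1"
      using forms_diff[OF forms_var[OF i], of "single 0 c * var a"]
        forms_mult[OF forms_const forms_var[OF a(1)], of c] by simp
    ultimately have "var i - single 0 c * var a \<in> K \<or> ?h \<in> K" using prime by blast
    then show ?thesis using Suc.IH[OF Q0 degQ] by blast
  qed
qed

text \<open>All forms of some degree \<open>M\<close> lie in \<open>K + (var a)\<close>, so modulo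
  \<open>K\<close> every form of degree \<open>M + t\<close> is \<open>var a ^ t\<close> times a
  form of degree \<open>M\<close>. The latter span a space of bounded dimension, which forces a
  relation between products of powers of \<open>var i\<close> and \<open>var a\<close>.\<close>

lemma var_relation:
  assumes a: "a \<le> N" "var a \<notin> K" and i: "i \<le> N"
  shows "\<exists>c. var i - single 0 c * var a \<in> K"
proof -
  obtain M where M: "forms N (int M) \<subseteq> set_sum K (principal N (var a))"
    using forms_in_add_principal[OF forms_var[OF a(1)] a(2)] by blast
  have va: "var a \<in> polyring N" using a(1) by (intro polys_var) simp
  have reduce: "\<exists>q\<in>forms N (int M). p - var a ^ t * q \<in> K" if "p \<in> forms N (int (M + t))" for p t
    using that
  proof (induction t arbitrary: p)
    case 0
    then show ?case using ideal_0[OF K_ideal] by (intro bexI[of _ p]) auto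
  next
    case (Suc t)
    have "p \<in> set_sum K (principal N (var a))"
      using forms_subset_mono[OF is_ideal_set_sum[OF K_ideal is_ideal_principal[OF va]] M, of "Suc t"] Suc.prems
      by blast
    then obtain k h where h: "p = k + h * var a" "k \<in> K" "h \<in> polyring N"
      by (auto simp: set_sum_def principal_def)
    define h' where "h' = hcomp (int (M + t)) h"
    have h': "h' \<in> forms N (int (M + t))" unfolding h'_def by (rule hcomp_forms[OF h(3)])
    have "p = hcomp (int (M + Suc t)) p" using hcomp_form[OF Suc.prems] by simp
    also have "\<dots> = hcomp (int (M + Suc t)) k + var a * h'"
      unfolding h(1) hcomp_add mult.commute[of h] hcomp_mult_form[OF forms_var[OF a(1)] h(3)] h'_def by simp
    finally have p: "p = hcomp (int (M + Suc t)) k + var a * h'" .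
    obtain q where q: "q \<in> forms N (int M)" "h' - var a ^ t * q \<in> K" using Suc.IH[OF h'] by blast
    have "p - var a ^ Suc t * q = hcomp (int (M + Suc t)) k + var a * (h' - var a ^ t * q)"
      unfolding p by (simp add: algebra_simps)
    also have "\<dots> \<in> K"
      using K_homogeneous h(2) q(2) by (intro ideal_add[OF K_ideal] ideal_mult[OF K_ideal va]) (auto simp: homogeneous_set_def)
    finally show ?case using q(1) by blast
  qed
  define D where "D = {m :: nat \<Rightarrow>\<^sub>0 nat. keys m \<subseteq> {..N} \<and> mon_degree m \<le> M}"
  have D: "finite D" unfolding D_def by (rule finite_exponents)
  \<comment> \<open>\<open>D\<close> contains all exponents of forms of degree \<open>M\<close>, so
    the \<open>t + 1\<close> forms \<open>q b\<close> with \<open>b \<le> t\<close> are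
    dependent.\<close>
  define t where "t = card D"
  define n where "n = M + t"
  have mon: "var i ^ b * var a ^ (n - b) \<in> forms N (int n)" if "b \<le> t" for b
  proof -
    have "int b * 1 + int (n - b) * 1 = int n" using that by (simp add: n_def)
    then show ?thesis
      using forms_mult[OF forms_power[OF forms_var[OF i], of b] forms_power[OF forms_var[OF a(1)], of "n - b"]] by simp
  qed
  have "\<forall>b\<in>{..t}. \<exists>q. q \<in> forms N (int M) \<and> var i ^ b * var a ^ (n - b) - var a ^ t * q \<in> K"
    using reduce mon unfolding n_def by blast
  then obtain q where q: "\<And>b. b \<le> t \<Longrightarrow> q b \<in> forms N (int M)"
    "\<And>b. b \<le> t \<Longrightarrow> var i ^ b * var a ^ (n - b) - var a ^ t * q b \<in> K"
    by (metis atMost_iff)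
  have "keys (q b) \<subseteq> D" if "b \<in> {..t}" for b
    using q(1)[of b] that by (auto simp: D_def forms_def polys_def)
  then obtain c where c: "\<exists>b\<in>{..t}. c b \<noteq> 0" "(\<Sum>b\<le>t. single 0 (c b) * q b) = 0"
    using dependent_polynomials[of "{..t}" D q] D by (auto simp: t_def)
  define P where "P = (\<Sum>b\<le>t. monom (c b) b)"
  have coeff: "coeff P b = (if b \<le> t then c b else 0)" for b
    unfolding P_def coeff_sum by simp
  have "P \<noteq> 0" using c(1) coeff by (metis atMost_iff coeff_0)
  moreover have "degree P \<le> n" by (rule degree_le) (simp add: coeff n_def)
  moreover have "(\<Sum>b\<le>n. single 0 (coeff P b) * var i ^ b * var a ^ (n - b)) \<in> K"
  proof -
    have "(\<Sum>b\<le>n. single 0 (coeff P b) * var i ^ b * var a ^ (n - b)) =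
        (\<Sum>b\<le>t. single 0 (c b) * (var i ^ b * var a ^ (n - b)))"
      by (rule sum.mono_neutral_cong_right) (auto simp: coeff n_def mult.assoc)
    also have "\<dots> = (\<Sum>b\<le>t. single 0 (c b) * (var i ^ b * var a ^ (n - b) - var a ^ t * q b))
        + var a ^ t * (\<Sum>b\<le>t. single 0 (c b) * q b)"
      by (simp add: sum_distrib_left sum.distrib[symmetric] algebra_simps)
    also have "\<dots> \<in> K"
      unfolding c(2) using q(2) by (auto intro!: ideal_sum[OF K_ideal] ideal_mult[OF K_ideal] polys_single)
    finally show ?thesis .
  qed
  ultimately show ?thesis by (rule homogenization_root[OF a i])
qed

text \<open>Modulo \<open>K\<close> every variable is a multiple \<open>v i\<close> of
  \<open>var a\<close>, so a form \<open>p\<close> of degree \<open>s\<close> is congruent to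
  \<open>p(v)\<close> times \<open>var a ^ s\<close>, and no power of \<open>var a\<close> lies in
  \<open>K\<close>.\<close>

lemma common_zero: "\<exists>v\<in>coords N. v \<noteq> 0 \<and> (\<forall>p\<in>K. mpoly_eval p v = 0)"
proof -
  obtain a where a: "a \<le> N" "var a \<notin> K" using exists_var_notin by blast
  have "\<forall>i. \<exists>c. i \<le> N \<longrightarrow> var i - single 0 c * var a \<in> K" using var_relation[OF a] by blast
  then obtain c where c: "\<And>i. i \<le> N \<Longrightarrow> var i - single 0 (c i) * var a \<in> K" by metis
  define v where "v i = (if i = a then 1 else if i \<le> N then c i else 0)" for i
  have rel: "var i - single 0 (v i) * var a \<in> K" if "i \<le> N" for i
    using c[OF that] ideal_0[OF K_ideal] that by (simp add: v_def)
  have zero: "mpoly_eval p v = 0" if p: "p \<in> K" "p \<in> forms N s" for p s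
  proof (rule ccontr)
    assume nz: "mpoly_eval p v \<noteq> 0"
    have mon: "single 0 (lookup p m) * (monv var m - single 0 (monv v m) * var a ^ nat s) \<in> K" if m: "m \<in> keys p" for m
    proof -
      have mN: "keys m \<subseteq> {..N}" "int (mon_degree m) = s" using p(2) m by (auto simp: forms_def polys_def)
      have "(\<Prod>i\<in>keys m. var i ^ lookup m i) - (\<Prod>i\<in>keys m. (single 0 (v i) * var a) ^ lookup m i) \<in> K"
      proof (rule congruent_prod[OF K_ideal])
        fix i assume "i \<in> keys m"
        then have i: "i \<le> N" using mN by blast
        have "(var i :: (nat, 'k) mpoly) \<in> polyring N" "single 0 (v i) * var a \<in> polyring N"
          using i a(1) by (auto intro!: polys_mult polys_single polys_var)
        then show "(var i :: (nat, 'k) mpoly) ^ lookup m i \<in> polyring N \<and> (single 0 (v i) * var a) ^ lookup m i \<in> polyring N \<and>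
            var i ^ lookup m i - (single 0 (v i) * var a) ^ lookup m i \<in> K"
          using rel[OF i] by (simp add: polys_power power_diff_ideal[OF K_ideal])
      qed
      also have "(\<Prod>i\<in>keys m. (single 0 (v i) * var a) ^ lookup m i) = single 0 (monv v m) * var a ^ nat s"
      proof -
        have "nat s = mon_degree m" using mN(2) by simp
        moreover have "(single 0 (monv v m) :: (nat, 'k) mpoly) = monv (single 0 \<circ> v) m"
          by (rule ring_hom_monv[OF ring_hom_const])
        ultimately show ?thesis
          by (simp add: power_mult_distrib prod.distrib monv_def mon_degree_def power_sum comp_def)
      qed
      finally show ?thesis by (intro ideal_mult[OF K_ideal] polys_single) (auto simp: monv_def)
    qed
    have "p - single 0 (mpoly_eval p v) * var a ^ nat s =
        (\<Sum>m\<in>keys p. single 0 (lookup p m) * (monv var m - single 0 (monv v m) * var a ^ nat s))"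
    proof -
      have 1: "(\<Sum>m\<in>keys p. single 0 (lookup p m) * monv var m) = p"
        by (subst (2) mpoly_as_sum) (rule sum.cong, simp_all only: single_eq_monv[symmetric])
      have 2: "(\<Sum>m\<in>keys p. single 0 (lookup p m) * single 0 (monv v m)) =
          (single 0 (mpoly_eval p v) :: (nat, 'k) mpoly)"
        by (simp add: mpoly_eval_insertion insertion_def ring_hom_sum[OF ring_hom_const] mult_single)
      show ?thesis
        by (simp only: right_diff_distrib sum_subtractf mult.assoc[symmetric] sum_distrib_right[symmetric] 1 2)
    qed
    also have "\<dots> \<in> K" using mon by (intro ideal_sum[OF K_ideal]) auto
    finally have "single 0 (mpoly_eval p v) * var a ^ nat s \<in> K" using p(1) ideal_cong[OF K_ideal] by blast
    then show False
      using const_mult_notin[OF nz forms_power prime_power] forms_var a by blast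
  qed
  have "mpoly_eval p v = 0" if p: "p \<in> K" for p
  proof -
    have "p \<in> polyring N" using p K_ideal ideal_polyring by blast
    then have "mpoly_eval (hcomp s p) v = 0" for s
      using zero[OF _ hcomp_forms] K_homogeneous p by (auto simp: homogeneous_set_def)
    then show ?thesis by (subst hcomp_decompose_keys) simp
  qed
  moreover have "v \<in> coords N" "v \<noteq> 0" using a(1) by (auto simp: coords_def v_def fun_eq_iff)
  ultimately show ?thesis by blast
qed

end

theorem projective_nullstellensatz:
  fixes J :: "(nat, 'k::alg_closed_field) mpoly set"
  assumes "is_ideal N J" "homogeneous_set J"
    and "\<And>v. v \<in> coords N \<Longrightarrow> (\<And>p. p \<in> J \<Longrightarrow> mpoly_eval p v = 0) \<Longrightarrow> v = 0"
  shows "\<exists>M. forms N (int M) \<subseteq> J"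
proof (rule ccontr)
  assume J: "\<nexists>M. forms N (int M) \<subseteq> J"
  define ok where "ok K \<longleftrightarrow> is_ideal N K \<and> homogeneous_set K \<and> J \<subseteq> K \<and> (\<forall>M. \<not> forms N (int M) \<subseteq> K)" for K
  have "ok J" using assms(1,2) J by (simp add: ok_def)
  \<comment> \<open>The ascending chain condition supplies a maximal homogeneous ideal among those
    above \<open>J\<close> that contain no \<open>forms N (int M)\<close>.\<close>
  have "\<exists>K. ok K \<and> (\<forall>K'. ok K' \<longrightarrow> \<not> K \<subset> K')"
  proof (rule ccontr)
    assume "\<not> ?thesis"
    then have "\<exists>K'. ok K' \<and> K \<subset> K'" if "ok K" for K using that by blast
    then obtain f where f: "\<And>i. ok (f i)" "\<And>i. f i \<subset> f (Suc i)"
      using dependent_nat_choice[of "\<lambda>_. ok" "\<lambda>_ K K'. K \<subset> K'"] \<open>ok J\<close> by metis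
    have "is_ideal N (f i)" for i using f(1) by (simp add: ok_def)
    then obtain m where "f (Suc m) = f m"
      using ideal_chain_stabilises[of N f] f(2) by (metis psubset_imp_subset)
    then show False using f(2)[of m] by blast
  qed
  then obtain K where K: "ok K" "\<And>K'. ok K' \<Longrightarrow> \<not> K \<subset> K'" by blast
  interpret maximal_relevant N K
  proof
    show "is_ideal N K" "homogeneous_set K" "\<not> forms N (int M) \<subseteq> K" for M
      using K(1) by (auto simp: ok_def)
    fix K' assume K': "is_ideal N K'" "homogeneous_set K'" "K \<subset> K'"
    have "J \<subseteq> K'" using K(1) K'(3) by (auto simp: ok_def)
    then show "\<exists>M. forms N (int M) \<subseteq> K'" using K(2)[of K'] K' unfolding ok_def by blast
  qed
  obtain v where v: "v \<in> coords N" "v \<noteq> 0" "\<forall>p\<in>K. mpoly_eval p v = 0" using common_zero by blast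
  have "J \<subseteq> K" using K(1) by (simp add: ok_def)
  then have "v = 0" using assms(3)[OF v(1)] v(3) by blast
  then show False using v(2) by simp
qed

section \<open>Linear coordinates\<close>

lemma subst_poly_forms:
  assumes "\<And>k. k \<le> N \<Longrightarrow> l k \<in> forms N 1" "p \<in> forms N s"
  shows "subst_poly l p \<in> forms N s"
  unfolding subst_poly_def insertion_def
proof (rule forms_sum)
  fix m assume m: "m \<in> keys p"
  then have mN: "keys m \<subseteq> {..N}" "int (mon_degree m) = s" using assms(2) by (auto simp: forms_def polys_def)
  have "l i ^ lookup m i \<in> forms N (int (lookup m i))" if "i \<in> keys m" for i
    using forms_power[OF assms(1), of i "lookup m i"] mN(1) that by auto
  then have "monv l m \<in> forms N (\<Sum>i\<in>keys m. int (lookup m i))"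
    unfolding monv_def by (rule forms_prod)
  then have "monv l m \<in> forms N s" using mN(2) by (simp add: mon_degree_def)
  then show "single 0 (lookup p m) * monv l m \<in> forms N s"
    using forms_mult[OF forms_const] by fastforce
qed

lemma ring_hom_diff: "ring_hom h \<Longrightarrow> h (a - b) = h a - h b"
  unfolding ring_hom_def by (metis diff_add_cancel eq_diff_eq)

lemma subst_poly_polyring:
  assumes "\<And>k. k \<le> N \<Longrightarrow> l k \<in> forms N 1" "p \<in> polyring N"
  shows "subst_poly l p \<in> polyring N"
proof -
  have "subst_poly l (\<Sum>s\<in>(\<lambda>m. int (mon_degree m)) ` keys p. hcomp s p) \<in> polyring N"
    unfolding ring_hom_sum[OF ring_hom_subst_poly]
    by (intro polys_sum forms_polyring[OF subst_poly_forms[OF assms(1) hcomp_forms[OF assms(2)]]])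
  then show ?thesis using hcomp_decompose_keys[of p] by simp
qed

lemma subst_poly_hcomp:
  assumes "\<And>k. k \<le> N \<Longrightarrow> l k \<in> forms N 1" "p \<in> polyring N"
  shows "hcomp s (subst_poly l p) = subst_poly l (hcomp s p)"
proof -
  let ?D = "insert s ((\<lambda>m. int (mon_degree m)) ` keys p)"
  have p: "p = (\<Sum>t\<in>?D. hcomp t p)" by (rule hcomp_decompose) auto
  have "hcomp s (subst_poly l p) = hcomp s (subst_poly l (\<Sum>t\<in>?D. hcomp t p))" using p by simp
  also have "\<dots> = (\<Sum>t\<in>?D. hcomp s (subst_poly l (hcomp t p)))"
    by (simp only: ring_hom_sum[OF ring_hom_subst_poly] hcomp_sum)
  also have "\<dots> = (\<Sum>t\<in>?D. if t = s then subst_poly l (hcomp s p) else 0)"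
    using hcomp_form[OF subst_poly_forms[OF assms(1) hcomp_forms[OF assms(2)]]]
    by (intro sum.cong) auto
  also have "\<dots> = subst_poly l (hcomp s p)" by simp
  finally show ?thesis .
qed

text \<open>The ideal of the first \<open>k\<close> variables. Describing it by monomials makes
  splitting and cancelling a variable a matter of single terms.\<close>

definition coord_ideal :: "nat \<Rightarrow> nat \<Rightarrow> (nat, 'k::field) mpoly set" where
  "coord_ideal N k = {p \<in> polyring N. \<forall>m\<in>keys p. \<exists>j<k. j \<in> keys m}"

lemma is_ideal_coord_ideal: "is_ideal N (coord_ideal N k :: (nat, 'k::field) mpoly set)"
  unfolding is_ideal_def
proof (intro conjI ballI)
  fix p q :: "(nat, 'k) mpoly" assume "p \<in> coord_ideal N k" "q \<in> coord_ideal N k"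
  then show "p + q \<in> coord_ideal N k"
    using keys_add[of p q] unfolding coord_ideal_def by (auto intro: polys_add)
next
  fix g p :: "(nat, 'k) mpoly" assume g: "g \<in> polyring N" and p: "p \<in> coord_ideal N k"
  have "\<exists>j<k. j \<in> keys m" if "m \<in> keys (g * p)" for m
  proof -
    obtain m1 m2 where "m = m1 + m2" "m2 \<in> keys p" using keys_mult[of g p] \<open>m \<in> keys (g * p)\<close> by blast
    then show ?thesis using p by (auto simp: coord_ideal_def keys_nat_add)
  qed
  then show "g * p \<in> coord_ideal N k" using g p by (simp add: coord_ideal_def polys_mult)
qed (auto simp: coord_ideal_def)

lemma homogeneous_coord_ideal: "homogeneous_set (coord_ideal N k)"
  by (auto simp: homogeneous_set_def coord_ideal_def hcomp_polyring hcomp_def keys_filter_monomials)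
     (metis hcomp_def hcomp_polyring)

lemma coord_ideal_0: "coord_ideal N 0 = {0}"
  by (auto simp: coord_ideal_def simp flip: keys_eq_empty)

lemma coord_ideal_Suc: "coord_ideal N k \<subseteq> coord_ideal N (Suc k)"
  unfolding coord_ideal_def using less_SucI by blast

lemma var_in_coord_ideal: "j < k \<Longrightarrow> j \<le> N \<Longrightarrow> var j \<in> coord_ideal N k"
  by (auto simp: coord_ideal_def polys_var) (auto simp: var_def split: if_splits)

lemma coord_ideal_split:
  assumes "k \<le> N" "p \<in> coord_ideal N (Suc k)"
  shows "\<exists>u\<in>polyring N. p - var k * u \<in> coord_ideal N k"
proof -
  define S where "S = {m \<in> keys p. \<not> (\<exists>j<k. j \<in> keys m)}"
  define u where "u = (\<Sum>m\<in>S. single (m - single k 1) (lookup p m))"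
  have p: "p \<in> polyring N" using assms(2) by (simp add: coord_ideal_def)
  have kS: "k \<in> keys m" "keys m \<subseteq> {..N}" if m: "m \<in> S" for m
  proof -
    obtain j where "j < Suc k" "j \<in> keys m" using m assms(2) by (auto simp: S_def coord_ideal_def)
    then show "k \<in> keys m" using m by (auto simp: S_def less_Suc_eq)
    show "keys m \<subseteq> {..N}" using m p by (auto simp: S_def polys_def)
  qed
  have "u \<in> polyring N"
    unfolding u_def
  proof (intro polys_sum polys_single)
    fix m assume "m \<in> S"
    moreover have "keys (m - single k 1) \<subseteq> keys m" by (auto simp: in_keys_iff lookup_minus)
    ultimately show "keys (m - single k 1) \<subseteq> {..N}" using kS(2) by blast
  qed
  have "var k * u = (\<Sum>m\<in>S. single m (lookup p m))"
  proof -
    have "single k 1 + (m - single k 1) = m" if "m \<in> S" for m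
      using kS(1)[OF that]
      by (intro poly_mapping_eqI) (auto simp: lookup_add lookup_minus lookup_single when_def in_keys_iff)
    then show ?thesis unfolding u_def var_def sum_distrib_left by (simp add: mult_single)
  qed
  also have "\<dots> = filter_monomials (\<lambda>m. \<not> (\<exists>j<k. j \<in> keys m)) p"
    by (simp add: filter_monomials_def S_def)
  finally have "p - var k * u = filter_monomials (\<lambda>m. \<exists>j<k. j \<in> keys m) p"
    by (intro poly_mapping_eqI) (auto simp: lookup_minus lookup_filter_monomials)
  also have "\<dots> \<in> coord_ideal N k"
    using p by (simp add: coord_ideal_def polys_filter_monomials keys_filter_monomials)
  finally show ?thesis using \<open>u \<in> polyring N\<close> by blast
qed

lemma coord_ideal_nonzerodivisor:
  assumes "u \<in> polyring N" "var k * u \<in> coord_ideal N k"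
  shows "u \<in> coord_ideal N k"
proof -
  have "\<exists>j<k. j \<in> keys m" if m: "m \<in> keys u" for m
  proof -
    have "lookup (var k * u) (single k 1 + m) = lookup u m"
      unfolding var_def lookup_single_mult by simp
    then have "single k 1 + m \<in> keys (var k * u)" using m by (simp add: in_keys_iff)
    then obtain j where "j < k" "j \<in> keys (single k 1 + m)" using assms(2) by (auto simp: coord_ideal_def)
    then show ?thesis by (auto simp: keys_nat_add split: if_splits)
  qed
  then show ?thesis using assms(1) by (simp add: coord_ideal_def)
qed

lemma coord_ideal_top: "p \<in> coord_ideal N (Suc N) \<longleftrightarrow> p \<in> polyring N \<and> lookup p 0 = 0"
proof
  assume p: "p \<in> coord_ideal N (Suc N)"
  have "0 \<notin> keys p" using p by (auto simp: coord_ideal_def)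
  then show "p \<in> polyring N \<and> lookup p 0 = 0" using p by (simp add: coord_ideal_def in_keys_iff)
next
  assume p: "p \<in> polyring N \<and> lookup p 0 = 0"
  have "\<exists>j<Suc N. j \<in> keys m" if m: "m \<in> keys p" for m
  proof -
    have "m \<noteq> 0" using p m by (metis in_keys_iff)
    then obtain j where "j \<in> keys m" by (metis all_not_in_conv keys_eq_empty)
    moreover have "keys m \<subseteq> {..N}" using p m by (auto simp: polys_def)
    ultimately show ?thesis by (auto simp: less_Suc_eq_le)
  qed
  then show "p \<in> coord_ideal N (Suc N)" using p by (simp add: coord_ideal_def)
qed

lemma coord_ideal_sum:
  assumes "k \<le> Suc N" "p \<in> coord_ideal N k"
  shows "\<exists>h. (\<forall>j. h j \<in> polyring N) \<and> p = (\<Sum>j<k. var j * h j)"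
  using assms
proof (induction k arbitrary: p)
  case 0
  then show ?case by (intro exI[of _ "\<lambda>_. 0"]) (simp add: coord_ideal_0)
next
  case (Suc k)
  then obtain u where u: "u \<in> polyring N" "p - var k * u \<in> coord_ideal N k"
    using coord_ideal_split by force
  then obtain h where h: "\<forall>j. h j \<in> polyring N" "p - var k * u = (\<Sum>j<k. var j * h j)"
    using Suc by auto
  have "p = (\<Sum>j<Suc k. var j * (h(k := u)) j)" using h(2) by (simp add: eq_diff_eq algebra_simps)
  then show ?case using h(1) u(1) by (intro exI[of _ "h(k := u)"]) simp
qed

section \<open>Polynomials of low degree in the last variables\<close>

definition tail_degree :: "nat \<Rightarrow> (nat \<Rightarrow>\<^sub>0 nat) \<Rightarrow> nat" where
  "tail_degree n1 m = (\<Sum>i\<in>{i\<in>keys m. n1 \<le> i}. lookup m i)"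

text \<open>The free module over the polynomial ring in the first \<open>n1\<close> variables on the
  monomials of degree less than \<open>d\<close> in the others; it will be the model of
  \<open>R/I\<close>.\<close>

definition low_tail :: "nat \<Rightarrow> nat \<Rightarrow> nat \<Rightarrow> (nat, 'k::field) mpoly set" where
  "low_tail N n1 d = {p \<in> polyring N. \<forall>m\<in>keys p. tail_degree n1 m < d}"

lemma tail_degree_le: "tail_degree n1 m \<le> mon_degree m"
  unfolding tail_degree_def mon_degree_def by (rule sum_mono2) auto

lemma tail_degree_single_add: "j < n1 \<Longrightarrow> tail_degree n1 (single j 1 + m) = tail_degree n1 m"
  unfolding tail_degree_def by (rule sum.cong) (auto simp: keys_nat_add lookup_add lookup_single when_def)

lemma low_tail_polyring: "p \<in> low_tail N n1 d \<Longrightarrow> p \<in> polyring N"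
  by (simp add: low_tail_def)

lemma low_tail_0: "0 \<in> low_tail N n1 d"
  by (simp add: low_tail_def)

lemma low_tail_add: "p \<in> low_tail N n1 d \<Longrightarrow> q \<in> low_tail N n1 d \<Longrightarrow> p + q \<in> low_tail N n1 d"
  using keys_add[of p q] by (auto simp: low_tail_def intro: polys_add)

lemma low_tail_uminus: "p \<in> low_tail N n1 d \<Longrightarrow> - p \<in> low_tail N n1 d"
  by (auto simp: low_tail_def in_keys_iff intro: polys_uminus)

lemma low_tail_diff: "p \<in> low_tail N n1 d \<Longrightarrow> q \<in> low_tail N n1 d \<Longrightarrow> p - q \<in> low_tail N n1 d"
  using low_tail_add[of p N n1 d "- q"] low_tail_uminus[of q] by simp

lemma low_tail_sum: "(\<And>a. a \<in> A \<Longrightarrow> f a \<in> low_tail N n1 d) \<Longrightarrow> sum f A \<in> low_tail N n1 d"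
  by (induction A rule: infinite_finite_induct) (auto intro: low_tail_add low_tail_0)

lemma low_tail_var_mult:
  assumes "j < n1" "j \<le> N" "p \<in> low_tail N n1 d"
  shows "var j * p \<in> low_tail N n1 d"
proof -
  have "tail_degree n1 m < d" if "m \<in> keys (var j * p)" for m
    using that keys_single_mult[of "single j 1" 1 p] tail_degree_single_add[OF assms(1)] assms(3)
    by (auto simp: var_def low_tail_def)
  then show ?thesis
    using assms by (auto simp: low_tail_def intro!: polys_mult polys_var)
qed

lemma low_tail_hcomp: "p \<in> low_tail N n1 d \<Longrightarrow> hcomp s p \<in> low_tail N n1 d"
  using hcomp_polyring[of p N s] by (auto simp: low_tail_def hcomp_def keys_filter_monomials)

lemma low_tail_low_degree: "p \<in> forms N s \<Longrightarrow> s < int d \<Longrightarrow> p \<in> low_tail N n1 d"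
proof -
  assume p: "p \<in> forms N s" "s < int d"
  have "tail_degree n1 m < d" if "m \<in> keys p" for m
  proof -
    have "int (mon_degree m) = s" using p that by (simp add: forms_def)
    then show ?thesis using p(2) tail_degree_le[of n1 m] by linarith
  qed
  then show ?thesis using p(1) by (simp add: low_tail_def forms_polyring)
qed

section \<open>Change of linear coordinates\<close>

locale coordinates =
  fixes N :: nat and b lam :: "nat \<Rightarrow> nat \<Rightarrow> 'k::field_char_0"
  assumes b_coords: "i \<le> N \<Longrightarrow> b i \<in> coords N"
    and dual: "i \<le> N \<Longrightarrow> k \<le> N \<Longrightarrow> dotp N (lam k) (b i) = (if i = k then 1 else 0)"
    and expand: "v \<in> coords N \<Longrightarrow> v = (\<Sum>i\<le>N. scale_vec (dotp N (lam i) v) (b i))"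
begin

text \<open>\<open>sig\<close> expresses the new coordinates \<open>dotp N (lam k)\<close> through
  the old ones, and \<open>tau\<close> is its inverse. Normal forms are written in the new
  coordinates, ideals in the old ones.\<close>

definition sig :: "(nat, 'k) mpoly \<Rightarrow> (nat, 'k) mpoly" where
  "sig = subst_poly (\<lambda>k. lform N (lam k))"

definition tau :: "(nat, 'k) mpoly \<Rightarrow> (nat, 'k) mpoly" where
  "tau = subst_poly (\<lambda>j. lform N (\<lambda>i. b i j))"

definition point :: "(nat \<Rightarrow> 'k) \<Rightarrow> nat \<Rightarrow> 'k" where
  "point x = (\<Sum>i\<le>N. scale_vec (x i) (b i))"

lemma ring_hom_sig: "ring_hom sig" and ring_hom_tau: "ring_hom tau"
  by (simp_all add: sig_def tau_def ring_hom_subst_poly)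

lemma eval_sig: "mpoly_eval (sig p) v = mpoly_eval p (\<lambda>k. dotp N (lam k) v)"
  by (simp add: sig_def mpoly_eval_subst_poly)

lemma eval_tau: "mpoly_eval (tau p) x = mpoly_eval p (point x)"
proof -
  have "point x = (\<lambda>j. dotp N (\<lambda>i. b i j) x)"
    by (auto simp: point_def sum_fun_apply scale_vec_def dotp_def fun_eq_iff mult.commute)
  then show ?thesis by (simp add: tau_def mpoly_eval_subst_poly)
qed

lemma dotp_point: "k \<le> N \<Longrightarrow> dotp N (lam k) (point x) = x k"
  by (simp add: point_def dotp_sum dotp_scale dual if_distrib[of "\<lambda>y. _ * y"] cong: if_cong)

lemma point_dotp: "v \<in> coords N \<Longrightarrow> point (\<lambda>k. dotp N (lam k) v) = v"
  using expand by (simp add: point_def)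

lemma sig_forms: "p \<in> forms N s \<Longrightarrow> sig p \<in> forms N s"
  unfolding sig_def by (rule subst_poly_forms) (rule lform_forms)

lemma tau_forms: "p \<in> forms N s \<Longrightarrow> tau p \<in> forms N s"
  unfolding tau_def by (rule subst_poly_forms) (rule lform_forms)

lemma sig_polyring: "p \<in> polyring N \<Longrightarrow> sig p \<in> polyring N"
  unfolding sig_def by (rule subst_poly_polyring) (rule lform_forms)

lemma tau_polyring: "p \<in> polyring N \<Longrightarrow> tau p \<in> polyring N"
  unfolding tau_def by (rule subst_poly_polyring) (rule lform_forms)

lemma sig_hcomp: "p \<in> polyring N \<Longrightarrow> hcomp s (sig p) = sig (hcomp s p)"
  unfolding sig_def by (rule subst_poly_hcomp) (rule lform_forms)

text \<open>Compared by values at all points of \<open>coords N\<close>, where the two changes of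
  coordinates cancel.\<close>

lemma sig_tau: "p \<in> polyring N \<Longrightarrow> sig (tau p) = p"
proof -
  assume p: "p \<in> polyring N"
  have "sig (tau p) - p = 0"
    by (rule polyring_eq_0_if_eval_0)
       (auto simp: eval_sig eval_tau point_dotp intro!: polys_diff sig_polyring tau_polyring p)
  then show ?thesis by simp
qed

lemma tau_sig: "p \<in> polyring N \<Longrightarrow> tau (sig p) = p"
proof -
  assume p: "p \<in> polyring N"
  have "mpoly_eval (tau (sig p)) x = mpoly_eval p x" for x
  proof -
    have "mpoly_eval (tau (sig p)) x = mpoly_eval p (\<lambda>k. dotp N (lam k) (point x))"
      by (simp add: eval_tau eval_sig)
    also have "\<dots> = mpoly_eval p x"
      unfolding mpoly_eval_insertion by (rule insertion_cong[OF p]) (simp add: dotp_point)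
    finally show ?thesis .
  qed
  then have "tau (sig p) - p = 0"
    by (intro polyring_eq_0_if_eval_0[of _ N]) (auto intro!: polys_diff sig_polyring tau_polyring p)
  then show ?thesis by simp
qed

lemma sig_add: "sig (p + q) = sig p + sig q" and sig_mult: "sig (p * q) = sig p * sig q"
  and sig_0: "sig 0 = 0"
  using ring_hom_sig by (auto simp: ring_hom_def)

lemma sig_diff: "sig (p - q) = sig p - sig q"
  by (rule ring_hom_diff[OF ring_hom_sig])

lemma sig_sum: "sig (sum f A) = (\<Sum>x\<in>A. sig (f x))"
  by (rule ring_hom_sum[OF ring_hom_sig])

lemma sig_var: "k \<le> N \<Longrightarrow> sig (var k) = lform N (lam k)"
  by (simp add: sig_def subst_poly_def insertion_var[OF ring_hom_const])

lemma sig_inj: "p \<in> polyring N \<Longrightarrow> q \<in> polyring N \<Longrightarrow> sig p = sig q \<Longrightarrow> p = q"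
  using tau_sig by metis

lemma sig_ideal:
  assumes "is_ideal N J" shows "is_ideal N (sig ` J)"
  unfolding is_ideal_def
proof (intro conjI ballI)
  show "sig ` J \<subseteq> polyring N" using assms by (auto intro: sig_polyring dest: ideal_polyring)
  show "0 \<in> sig ` J" using ideal_0[OF assms] sig_0 by (metis imageI)
next
  fix p q assume "p \<in> sig ` J" "q \<in> sig ` J"
  then obtain p' q' where "p' \<in> J" "q' \<in> J" "p = sig p'" "q = sig q'" by blast
  then show "p + q \<in> sig ` J" using ideal_add[OF assms, of p' q'] by (simp add: sig_add[symmetric])
next
  fix g p :: "(nat, 'k) mpoly" assume g: "g \<in> polyring N" and "p \<in> sig ` J"
  then obtain p' where "p' \<in> J" "p = sig p'" by blast
  then have "tau g * p' \<in> J" "g * p = sig (tau g * p')"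
    using ideal_mult[OF assms tau_polyring[OF g]] sig_tau[OF g] by (auto simp: sig_mult)
  then show "g * p \<in> sig ` J" by blast
qed

definition flag :: "nat \<Rightarrow> (nat, 'k) mpoly set" where
  "flag k = sig ` coord_ideal N k"

lemma linear_flag: "linear_flag N (\<lambda>k. lform N (lam k)) flag"
proof
  fix k
  show "is_ideal N (flag k)" unfolding flag_def by (intro sig_ideal is_ideal_coord_ideal)
  show "homogeneous_set (flag k)"
    unfolding homogeneous_set_def flag_def
  proof (intro ballI allI)
    fix p s assume "p \<in> sig ` coord_ideal N k"
    then obtain q where q: "p = sig q" "q \<in> coord_ideal N k" by blast
    have "q \<in> polyring N" using q(2) by (simp add: coord_ideal_def)
    then have "hcomp s p = sig (hcomp s q)" using sig_hcomp q(1) by simp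
    moreover have "hcomp s q \<in> coord_ideal N k"
      using homogeneous_coord_ideal q(2) unfolding homogeneous_set_def by blast
    ultimately show "hcomp s p \<in> sig ` coord_ideal N k" by blast
  qed
  show "flag k \<subseteq> flag (Suc k)" unfolding flag_def using coord_ideal_Suc by (intro image_mono)
next
  show "flag 0 = {0}" by (simp add: flag_def coord_ideal_0 sig_0)
next
  fix k assume k: "k \<le> N"
  show "lform N (lam k) \<in> forms N 1" by (rule lform_forms)
  show "lform N (lam k) \<in> flag (Suc k)"
    unfolding flag_def sig_var[OF k, symmetric] using k by (intro imageI var_in_coord_ideal) auto
next
  fix k p assume k: "k \<le> N" and "p \<in> flag (Suc k)"
  then obtain q where q: "q \<in> coord_ideal N (Suc k)" "p = sig q" by (auto simp: flag_def)
  obtain u where u: "u \<in> polyring N" "q - var k * u \<in> coord_ideal N k" using coord_ideal_split[OF k q(1)] by blast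
  have "p - lform N (lam k) * sig u = sig (q - var k * u)"
    by (simp add: q(2) sig_diff sig_mult sig_var[OF k])
  then have "p - lform N (lam k) * sig u \<in> flag k" using u(2) by (auto simp: flag_def)
  then show "\<exists>u\<in>polyring N. p - lform N (lam k) * u \<in> flag k" using sig_polyring[OF u(1)] by blast
next
  fix k u assume k: "k \<le> N" and u: "u \<in> polyring N" and "lform N (lam k) * u \<in> flag k"
  then obtain q where q: "q \<in> coord_ideal N k" "lform N (lam k) * u = sig q" by (auto simp: flag_def)
  have "sig (var k * tau u) = sig q" using q(2) by (simp add: sig_mult sig_var[OF k] sig_tau[OF u])
  then have "var k * tau u = q"
  proof (rule sig_inj[rotated 2])
    show "var k * tau u \<in> polyring N" by (intro polys_mult polys_var tau_polyring u) (simp add: k)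
    show "q \<in> polyring N" using q(1) by (simp add: coord_ideal_def)
  qed
  then have "tau u \<in> coord_ideal N k"
    using q(1) by (intro coord_ideal_nonzerodivisor[OF tau_polyring[OF u]]) simp
  then show "u \<in> flag k" unfolding flag_def using sig_tau[OF u] by (metis imageI)
next
  fix p
  have const: "lookup (sig q) 0 = lookup q 0" for q
    by (simp add: lookup_0_eval eval_sig dotp_def)
  show "p \<in> flag (Suc N) \<longleftrightarrow> p \<in> polyring N \<and> lookup p 0 = 0"
  proof
    show "p \<in> polyring N \<and> lookup p 0 = 0" if "p \<in> flag (Suc N)"
      using that by (auto simp: flag_def coord_ideal_top const intro: sig_polyring)
    assume p: "p \<in> polyring N \<and> lookup p 0 = 0"
    then have "tau p \<in> coord_ideal N (Suc N)"
      using const[of "tau p"] sig_tau[of p] by (simp add: coord_ideal_top tau_polyring)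
    then show "p \<in> flag (Suc N)" unfolding flag_def using sig_tau p by (metis imageI)
  qed
qed

end

text \<open>Here \<open>R/I\<close> is free over the polynomial ring in the first \<open>n1\<close> coordinates, on the monomials
  of degree less than \<open>d\<close> in the remaining ones.\<close>

locale free_quotient = coordinates N b lam
  for N :: nat and b lam :: "nat \<Rightarrow> nat \<Rightarrow> 'k::field_char_0" +
  fixes I :: "(nat, 'k) mpoly set" and n1 d :: nat
  assumes I_ideal: "is_ideal N I" and I_homogeneous: "homogeneous_set I"
    and n1_le: "n1 \<le> Suc N"
    and generated: "p \<in> forms N s \<Longrightarrow> s \<ge> int d \<Longrightarrow> p \<in> set_sum I (flag n1)"
    and independent: "f \<in> low_tail N n1 d \<Longrightarrow> f \<in> forms N s \<Longrightarrow> sig f \<in> I \<Longrightarrow> f = 0"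
begin

lemma independent_all:
  assumes "f \<in> low_tail N n1 d" "sig f \<in> I"
  shows "f = 0"
proof -
  have f: "f \<in> polyring N" by (rule low_tail_polyring[OF assms(1)])
  have "hcomp s f = 0" for s
  proof (rule independent[OF low_tail_hcomp[OF assms(1)] hcomp_forms[OF f]])
    show "sig (hcomp s f) \<in> I"
      using I_homogeneous assms(2) unfolding sig_hcomp[OF f, symmetric] homogeneous_set_def by blast
  qed
  then show ?thesis using hcomp_decompose_keys[of f] by simp
qed

text \<open>From degree \<open>d\<close> on, a form is congruent modulo \<open>I\<close> to a
  combination of the first \<open>n1\<close> coordinates, whose coefficients have degree one less
  and are reduced by induction.\<close>

lemma normal_form_form:
  assumes "p \<in> forms N (int s)"
  shows "\<exists>q\<in>low_tail N n1 d. q \<in> forms N (int s) \<and> p - sig q \<in> I"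
  using assms
proof (induction s arbitrary: p rule: less_induct)
  case (less s)
  have pp: "p \<in> polyring N" using forms_polyring[OF less.prems] .
  show ?case
  proof (cases "s < d")
    case True
    have "tau p \<in> forms N (int s)" by (rule tau_forms[OF less.prems])
    then show ?thesis
      using low_tail_low_degree[of "tau p" N "int s" d n1] True sig_tau[OF pp] ideal_0[OF I_ideal]
      by (intro bexI[of _ "tau p"]) auto
  next
    case False
    then obtain i a where ia: "p = i + a" "i \<in> I" "a \<in> flag n1"
      using generated[OF less.prems] by (auto simp: set_sum_def)
    obtain a' where a': "a' \<in> coord_ideal N n1" "a = sig a'" using ia(3) by (auto simp: flag_def)
    obtain h where h: "\<forall>j. h j \<in> polyring N" "a' = (\<Sum>j<n1. var j * h j)"
      using coord_ideal_sum[OF n1_le a'(1)] by blast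
    show ?thesis
    proof (cases s)
      \<comment> \<open>Only reached for \<open>d = 0\<close>: the first coordinates contribute
        nothing in degree 0, so \<open>p\<close> lies in \<open>I\<close>.\<close>
      case 0
      have "hcomp 0 (var j * h j) = 0" if "j < n1" for j
        using hcomp_mult_form[OF forms_var h(1)[rule_format, of j], of j 0] that n1_le
          forms_neg[OF _ hcomp_forms[OF h(1)[rule_format, of j]], of "-1"] by simp
      then have "hcomp 0 a' = 0" unfolding h(2) hcomp_sum by simp
      moreover have "a' \<in> polyring N" using a'(1) by (simp add: coord_ideal_def)
      ultimately have "hcomp 0 a = 0" using sig_hcomp[of a' 0] by (simp add: a'(2) sig_0)
      then have "p = hcomp 0 i" using hcomp_form[OF less.prems, of 0] 0 by (simp add: ia(1) hcomp_add)
      then have "p - sig 0 \<in> I" using I_homogeneous ia(2) by (simp add: homogeneous_set_def sig_0)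
      then show ?thesis using low_tail_0 by (intro bexI[of _ 0]) auto
    next
      case (Suc t)
      define g where "g j = hcomp (int t) (h j)" for j
      have g: "g j \<in> forms N (int t)" for j unfolding g_def using h(1) by (intro hcomp_forms) simp
      have "sig (g j) \<in> forms N (int t)" for j by (rule sig_forms[OF g])
      then have "\<forall>j. \<exists>q. q \<in> low_tail N n1 d \<and> q \<in> forms N (int t) \<and> sig (g j) - sig q \<in> I"
        using less.IH[of t] Suc by blast
      then obtain q where q: "\<And>j. q j \<in> low_tail N n1 d" "\<And>j. q j \<in> forms N (int t)"
        "\<And>j. sig (g j) - sig (q j) \<in> I" by metis
      define Q where "Q = (\<Sum>j<n1. var j * q j)"
      have "hcomp (int s) (var j * h j) = var j * g j" if "j < n1" for j
        using hcomp_mult_form[OF forms_var h(1)[rule_format, of j], of j "int s"] that n1_le Suc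
        by (simp add: g_def)
      then have "hcomp (int s) a' = (\<Sum>j<n1. var j * g j)" unfolding h(2) hcomp_sum by simp
      moreover have "a' \<in> polyring N" using a'(1) by (simp add: coord_ideal_def)
      ultimately have ha: "hcomp (int s) a = sig (\<Sum>j<n1. var j * g j)"
        using sig_hcomp[of a' "int s"] by (simp add: a'(2))
      have "p = hcomp (int s) i + hcomp (int s) a"
        using hcomp_form[OF less.prems, of "int s"] by (simp add: ia(1) hcomp_add)
      then have "p - sig Q = hcomp (int s) i + (\<Sum>j<n1. sig (var j) * (sig (g j) - sig (q j)))"
        by (simp add: ha Q_def sig_sum sig_mult sum_subtractf right_diff_distrib)
      also have "\<dots> \<in> I"
      proof (rule ideal_add[OF I_ideal _ ideal_sum[OF I_ideal ideal_mult[OF I_ideal _ q(3)]]])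
        show "hcomp (int s) i \<in> I" using I_homogeneous ia(2) by (simp add: homogeneous_set_def)
        show "sig (var j) \<in> polyring N" if "j \<in> {..<n1}" for j
          using that n1_le by (intro sig_polyring polys_var) auto
      qed
      finally have "p - sig Q \<in> I" .
      moreover have "Q \<in> low_tail N n1 d"
        unfolding Q_def using q(1) n1_le by (intro low_tail_sum low_tail_var_mult) auto
      moreover have "Q \<in> forms N (int s)"
        unfolding Q_def
      proof (rule forms_sum)
        fix j assume "j \<in> {..<n1}"
        then have "j \<le> N" using n1_le by auto
        from forms_mult[OF forms_var[OF this] q(2)[of j]] show "var j * q j \<in> forms N (int s)"
          using Suc by simp
      qed
      ultimately show ?thesis by blast
    qed
  qed
qed

text \<open>The bound on the degrees of \<open>q\<close> serves to count monomials when the length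
  of a regular sequence is compared with \<open>n1\<close>.\<close>

lemma normal_form:
  assumes "p \<in> polyring N"
  shows "\<exists>q\<in>low_tail N n1 d. p - sig q \<in> I \<and>
    (\<forall>t. (\<forall>m\<in>keys p. mon_degree m \<le> t) \<longrightarrow> (\<forall>m\<in>keys q. mon_degree m \<le> t))"
proof -
  let ?D = "mon_degree ` keys p"
  have "\<forall>s. \<exists>q. q \<in> low_tail N n1 d \<and> q \<in> forms N (int s) \<and> hcomp (int s) p - sig q \<in> I"
    using normal_form_form[OF hcomp_forms[OF assms]] by blast
  then obtain q where q: "\<And>s. q s \<in> low_tail N n1 d" "\<And>s. q s \<in> forms N (int s)"
    "\<And>s. hcomp (int s) p - sig (q s) \<in> I" by metis
  have "p = (\<Sum>s\<in>int ` ?D. hcomp s p)" by (rule hcomp_decompose) auto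
  also have "\<dots> = (\<Sum>s\<in>?D. hcomp (int s) p)" by (subst sum.reindex) auto
  finally have "p - sig (\<Sum>s\<in>?D. q s) = (\<Sum>s\<in>?D. hcomp (int s) p - sig (q s))"
    by (simp add: sig_sum sum_subtractf)
  also have "\<dots> \<in> I" by (intro ideal_sum[OF I_ideal] q)
  finally have "p - sig (\<Sum>s\<in>?D. q s) \<in> I" .
  moreover have "mon_degree m \<le> t" if t: "\<forall>m\<in>keys p. mon_degree m \<le> t" and m: "m \<in> keys (\<Sum>s\<in>?D. q s)" for m t
  proof -
    obtain s where "s \<in> ?D" "m \<in> keys (q s)" using keys_sum[of q ?D] m by blast
    then show ?thesis using q(2)[of s] t by (auto simp: forms_def)
  qed
  ultimately show ?thesis using low_tail_sum[of ?D q] q(1) by blast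
qed

text \<open>In the new coordinates no monomial of such a form reaches tail degree \<open>d\<close>,
  so \<open>independent\<close> applies.\<close>

lemma low_degree_zero:
  assumes "p \<in> I" "p \<in> forms N t" "t < int d"
  shows "p = 0"
proof -
  have p: "p \<in> polyring N" using forms_polyring[OF assms(2)] .
  have "tau p = 0"
    using independent[OF low_tail_low_degree[OF tau_forms[OF assms(2)] assms(3)] tau_forms[OF assms(2)]]
      assms(1) sig_tau[OF p] by simp
  then show ?thesis using sig_tau[OF p] sig_0 by simp
qed

text \<open>After \<open>u\<close> and all coefficients are replaced by normal forms, the relation
  modulo \<open>I\<close> becomes an identity of polynomials by independence, and in the polynomial
  ring \<open>var k\<close> is a nonzerodivisor modulo the earlier variables.\<close>

lemma regular:
  assumes k: "k < n1" and u: "u \<in> polyring N" and lu: "lform N (lam k) * u \<in> set_sum I (flag k)"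
  shows "u \<in> set_sum I (flag k)"
proof -
  have kN: "k \<le> N" using k n1_le by simp
  obtain i a where ia: "lform N (lam k) * u = i + a" "i \<in> I" "a \<in> flag k"
    using lu by (auto simp: set_sum_def)
  obtain a' where a': "a' \<in> coord_ideal N k" "a = sig a'" using ia(3) by (auto simp: flag_def)
  obtain h where h: "\<forall>j. h j \<in> polyring N" "a' = (\<Sum>j<k. var j * h j)"
    using coord_ideal_sum[of k N a'] a'(1) kN by auto
  have "\<forall>j. \<exists>q. q \<in> low_tail N n1 d \<and> sig (h j) - sig q \<in> I"
    using normal_form[OF sig_polyring] h(1) by blast
  then obtain q where q: "\<And>j. q j \<in> low_tail N n1 d" "\<And>j. sig (h j) - sig (q j) \<in> I" by metis
  obtain w where w: "w \<in> low_tail N n1 d" "u - sig w \<in> I" using normal_form[OF u] by blast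
  have varI: "sig (var j) \<in> polyring N" if "j \<le> N" for j using that by (intro sig_polyring polys_var) simp
  have "sig (var k * w - (\<Sum>j<k. var j * q j)) =
      i - sig (var k) * (u - sig w) + (\<Sum>j<k. sig (var j) * (sig (h j) - sig (q j)))"
  proof -
    have "sig (var k) * u = i + (\<Sum>j<k. sig (var j) * sig (h j))"
      using ia(1) by (simp add: sig_var[OF kN] a'(2) h(2) sig_sum sig_mult)
    then show ?thesis
      by (simp add: sig_diff sig_mult sig_sum right_diff_distrib sum_subtractf)
  qed
  also have "\<dots> \<in> I"
    using kN by (intro ideal_add[OF I_ideal ideal_diff[OF I_ideal ia(2) ideal_mult[OF I_ideal varI w(2)]]
        ideal_sum[OF I_ideal ideal_mult[OF I_ideal varI q(2)]]]) auto
  finally have "sig (var k * w - (\<Sum>j<k. var j * q j)) \<in> I" .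
  moreover have "var k * w - (\<Sum>j<k. var j * q j) \<in> low_tail N n1 d"
    using k kN w(1) q(1) by (intro low_tail_diff low_tail_sum low_tail_var_mult) auto
  ultimately have "var k * w = (\<Sum>j<k. var j * q j)" using independent_all by fastforce
  moreover have "(\<Sum>j<k. var j * q j) \<in> coord_ideal N k"
  proof (rule ideal_sum[OF is_ideal_coord_ideal])
    fix j assume "j \<in> {..<k}"
    then have "q j * var j \<in> coord_ideal N k"
      using kN by (intro ideal_mult[OF is_ideal_coord_ideal] var_in_coord_ideal low_tail_polyring[OF q(1)]) auto
    then show "var j * q j \<in> coord_ideal N k" by (simp add: mult.commute)
  qed
  ultimately have "w \<in> coord_ideal N k"
    using coord_ideal_nonzerodivisor[OF low_tail_polyring[OF w(1)]] by simp
  then have "sig w \<in> flag k" by (auto simp: flag_def)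
  moreover have "u = (u - sig w) + sig w" by simp
  ultimately show ?thesis using w(2) unfolding set_sum_def by blast
qed

end

section \<open>Sections over general linear subspaces\<close>

lemma indep_family_iff: "indep_family E e \<longleftrightarrow> inj_on E {..<e} \<and> vec.independent (E ` {..<e})"
proof
  assume E: "indep_family E e"
  have inj: "inj_on E {..<e}"
  proof (rule inj_onI)
    fix i j assume ij: "i \<in> {..<e}" "j \<in> {..<e}" "E i = E j"
    show "i = j"
    proof (rule ccontr)
      assume "i \<noteq> j"
      define c :: "nat \<Rightarrow> 'a" where "c x = (if x = i then 1 else if x = j then - 1 else 0)" for x
      have "(\<Sum>x<e. scale_vec (c x) (E x)) = (\<Sum>x\<in>{i, j}. scale_vec (c x) (E x))"
        by (rule sum.mono_neutral_right) (use ij in \<open>auto simp: c_def scale_vec_def fun_eq_iff\<close>)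
      also have "\<dots> = 0" using \<open>i \<noteq> j\<close> ij(3) by (simp add: c_def scale_vec_def fun_eq_iff)
      finally have "c i = 0" using E ij(1) unfolding indep_family_def by blast
      then show False by (simp add: c_def)
    qed
  qed
  have "u v = 0" if u: "(\<Sum>v\<in>E ` {..<e}. scale_vec (u v) v) = 0" and v: "v \<in> E ` {..<e}" for u v
  proof -
    have "(\<Sum>i<e. scale_vec (u (E i)) (E i)) = 0" using u by (simp add: sum.reindex[OF inj] comp_def)
    then have "\<forall>i<e. u (E i) = 0"
      using E[unfolded indep_family_def, THEN spec, of "\<lambda>i. u (E i)"] by blast
    then show ?thesis using v by blast
  qed
  then have "vec.independent (E ` {..<e})" by (subst vec.dependent_finite) auto
  with inj show "inj_on E {..<e} \<and> vec.independent (E ` {..<e})" by blast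
next
  assume E: "inj_on E {..<e} \<and> vec.independent (E ` {..<e})"
  show "indep_family E e"
    unfolding indep_family_def
  proof (intro allI impI)
    fix c i assume c: "(\<Sum>i<e. scale_vec (c i) (E i)) = 0" and i: "i < e"
    let ?g = "the_inv_into {..<e} E"
    have g: "?g (E j) = j" if "j < e" for j using the_inv_into_f_f[of E "{..<e}" j] E that by simp
    have "(\<Sum>v\<in>E ` {..<e}. scale_vec (c (?g v)) v) = (\<Sum>j<e. scale_vec (c (?g (E j))) (E j))"
      using E by (simp add: sum.reindex comp_def)
    also have "\<dots> = (\<Sum>j<e. scale_vec (c j) (E j))" by (rule sum.cong) (simp_all add: g)
    finally have "(\<Sum>v\<in>E ` {..<e}. scale_vec (c (?g v)) v) = 0" using c by simp
    moreover have "\<not> (\<exists>u. (\<exists>v\<in>E ` {..<e}. u v \<noteq> 0) \<and> (\<Sum>v\<in>E ` {..<e}. scale_vec (u v) v) = 0)"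
      using E vec.dependent_finite[of "E ` {..<e}"] by simp
    then have "\<not> ((\<exists>v\<in>E ` {..<e}. c (?g v) \<noteq> 0) \<and> (\<Sum>v\<in>E ` {..<e}. scale_vec (c (?g v)) v) = 0)"
      unfolding not_ex by (rule spec)
    ultimately have "\<forall>v\<in>E ` {..<e}. c (?g v) = 0" by blast
    then show "c i = 0" using g[OF i] i by force
  qed
qed

lemma span_family_in_grass:
  assumes "\<And>i. i \<le> m \<Longrightarrow> E i \<in> coords N" "indep_family E (Suc m)"
  shows "vec.span (E ` {..m}) \<in> grass N m"
proof -
  have E: "inj_on E {..m}" "vec.independent (E ` {..m})"
    using assms(2) by (auto simp: indep_family_iff lessThan_Suc_atMost)
  have "vec.span (E ` {..m}) \<subseteq> coords N"
    by (rule vec.span_minimal[OF _ subspace_coords]) (use assms(1) in auto)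
  moreover have "vec.dim (vec.span (E ` {..m})) = m + 1"
    using vec.dim_span_eq_card_independent[OF E(2)] card_image[OF E(1)] by simp
  ultimately show ?thesis by (simp add: grass_def)
qed

lemma row_space_family:
  assumes "\<And>i. i \<le> m \<Longrightarrow> E i \<in> coords N"
  shows "row_space N m (\<lambda>(i, j). E i j) = vec.span (E ` {..m})"
proof -
  have "(\<lambda>i j. if j \<le> N then E i j else 0) ` {..m} = E ` {..m}"
    by (rule image_cong) (use assms in \<open>auto simp: coords_def fun_eq_iff not_le\<close>)
  then show ?thesis by (simp only: row_space_def prod.case)
qed

lemma grass_family_exists:
  assumes "W \<in> grass N m"
  shows "\<exists>E. (\<forall>i\<le>m. E i \<in> coords N) \<and> indep_family E (Suc m) \<and> W = vec.span (E ` {..m})"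
proof -
  have W: "vec.subspace W" "W \<subseteq> coords N" "vec.dim W = m + 1" using assms by (auto simp: grass_def)
  obtain B where B: "B \<subseteq> W" "vec.independent B" "W \<subseteq> vec.span B" "card B = m + 1"
    using vec.maximal_independent_subset[of W] vec.basis_card_eq_dim W(3) by metis
  have "finite B" using B(4) card.infinite by fastforce
  then obtain E where E: "bij_betw E {..<Suc m} B"
    using ex_bij_betw_nat_finite[of B] B(4) by (auto simp: lessThan_atLeast0)
  have img: "E ` {..<Suc m} = B" using E by (simp add: bij_betw_def)
  have "indep_family E (Suc m)"
    unfolding indep_family_iff using E B(2) by (simp add: bij_betw_def)
  moreover have "E i \<in> coords N" if "i \<le> m" for i
  proof -
    have "E i \<in> B" unfolding img[symmetric] using that by (intro imageI) simp
    then show ?thesis using B(1) W(2) by blast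
  qed
  moreover have "W = vec.span (E ` {..m})"
    using B(1,3) img vec.span_minimal[OF B(1) W(1)] by (auto simp: lessThan_Suc_atMost)
  ultimately show ?thesis by blast
qed

text \<open>\<open>E\<close> is extended to a basis and put last, so that its span is the common
  zero set of the first \<open>n1\<close> dual forms.\<close>

lemma coordinates_exist:
  fixes E :: "nat \<Rightarrow> nat \<Rightarrow> 'k::field_char_0"
  assumes n1: "n1 + e = Suc N" and E: "indep_family E e" "\<And>i. i < e \<Longrightarrow> E i \<in> coords N"
  shows "\<exists>b lam. coordinates N b lam \<and> (\<forall>i<e. b (n1 + i) = E i)"
proof -
  let ?S = "E ` {..<e}"
  have S: "inj_on E {..<e}" "vec.independent ?S" using E(1) by (auto simp: indep_family_iff)
  have "?S \<subseteq> coords N" using E(2) by auto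
  from vec.maximal_independent_subset_extend[OF this S(2)]
  obtain B where B: "?S \<subseteq> B" "B \<subseteq> coords N" "vec.independent B" "coords N \<subseteq> vec.span B" .
  let ?U = "unit_vec ` {..N} :: (nat \<Rightarrow> 'k) set"
  have U: "card ?U = Suc N" "?U \<subseteq> coords N"
    using card_image[OF inj_on_subset[OF inj_unit_vec, of "{..N}"]] unit_vec_coords by auto
  have "coords N \<subseteq> vec.span ?U"
  proof
    fix v :: "nat \<Rightarrow> 'k" assume "v \<in> coords N"
    then have "v = (\<Sum>j\<le>N. scale_vec (v j) (unit_vec j))" by (rule coords_expand)
    also have "\<dots> \<in> vec.span ?U" by (intro vec.span_sum vec.span_scale vec.span_base) auto
    finally show "v \<in> vec.span ?U" .
  qed
  then have fB: "finite B" "card B \<le> Suc N"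
    using vec.independent_span_bound[of ?U B] B(2,3) U(1) by auto
  have "Suc N \<le> card B"
    using vec.independent_span_bound[OF fB(1) independent_unit_vecs[of N]] U B(4) by auto
  then have cB: "card B = Suc N" using fB(2) by simp
  have "card ?S = e" using card_image[OF S(1)] by simp
  then have "card (B - ?S) = n1" using card_Diff_subset[OF _ B(1)] cB n1 by simp
  then obtain h where h: "bij_betw h {..<n1} (B - ?S)"
    using ex_bij_betw_nat_finite[of "B - ?S"] fB(1) by (auto simp: lessThan_atLeast0)
  define b where "b i = (if i < n1 then h i else E (i - n1))" for i
  have bE: "b (n1 + i) = E i" for i by (simp add: b_def)
  have img: "b ` {..<Suc N} = B"
  proof -
    have "{..<Suc N} = {..<n1} \<union> (+) n1 ` {..<e}"
    proof (intro equalityI subsetI)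
      fix i assume "i \<in> {..<Suc N}"
      then show "i \<in> {..<n1} \<union> (+) n1 ` {..<e}"
        unfolding n1[symmetric] by (cases "i < n1") (auto intro!: image_eqI[of i "(+) n1" "i - n1"])
    qed (use n1 in auto)
    then have "b ` {..<Suc N} = b ` {..<n1} \<union> (\<lambda>i. b (n1 + i)) ` {..<e}" by (simp add: image_Un image_image)
    also have "b ` {..<n1} = h ` {..<n1}" by (rule image_cong) (auto simp: b_def)
    also have "\<dots> = B - ?S" using h by (simp add: bij_betw_def)
    finally show ?thesis using B(1) by (auto simp: bE)
  qed
  then have inj: "inj_on b {..<Suc N}" using cB by (intro eq_card_imp_inj_on) simp_all
  have bB: "b i \<in> B" if "i \<le> N" for i unfolding img[symmetric] using that by (intro imageI) simp
  have "\<exists>a. \<forall>i\<le>N. dotp N a (b i) = (if i = k then 1 else 0)" if k: "k \<le> N" for k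
  proof -
    have "b k \<notin> vec.span (B - {b k})" using B(3) bB[OF k] unfolding vec.dependent_def by blast
    from functional_exists[OF this] obtain \<phi> where \<phi>: "\<forall>v\<in>B - {b k}. \<phi> v = 0" "\<phi> (b k) = 1"
      "\<forall>u v. \<phi> (u + v) = \<phi> u + \<phi> v" "\<forall>c v. \<phi> (scale_vec c v) = c * \<phi> v" by blast
    have "dotp N (\<lambda>j. \<phi> (unit_vec j)) (b i) = (if i = k then 1 else 0)" if i: "i \<le> N" for i
    proof -
      have "b i \<in> coords N" using bB[OF i] B(2) by blast
      then have "\<phi> (b i) = dotp N (\<lambda>j. \<phi> (unit_vec j)) (b i)"
        by (rule functional_dotp[OF \<phi>(3)[rule_format] \<phi>(4)[rule_format]])
      moreover have "b i = b k \<longleftrightarrow> i = k" using inj i k by (auto simp: inj_on_def)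
      ultimately show ?thesis using \<phi>(1,2) bB[OF i] by auto
    qed
    then show ?thesis by blast
  qed
  then obtain lam where lam: "\<And>k i. k \<le> N \<Longrightarrow> i \<le> N \<Longrightarrow> dotp N (lam k) (b i) = (if i = k then 1 else 0)"
    by metis
  have "coordinates N b lam"
  proof
    show "b i \<in> coords N" if "i \<le> N" for i using bB[OF that] B(2) by blast
    show "dotp N (lam k) (b i) = (if i = k then 1 else 0)" if "i \<le> N" "k \<le> N" for i k
      using lam that by simp
    fix v :: "nat \<Rightarrow> 'k" assume v: "v \<in> coords N"
    have "v \<in> vec.span (b ` {..N})" using v B(4) img by (auto simp: lessThan_Suc_atMost)
    moreover have sub: "vec.subspace {v. v = (\<Sum>i\<le>N. scale_vec (dotp N (lam i) v) (b i))}"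
    proof (rule vec.subspaceI)
      show "0 \<in> {v. v = (\<Sum>i\<le>N. scale_vec (dotp N (lam i) v) (b i))}"
        by (auto simp: dotp_def scale_vec_def fun_eq_iff sum_fun_apply)
      fix u v c
      assume u: "u \<in> {v. v = (\<Sum>i\<le>N. scale_vec (dotp N (lam i) v) (b i))}"
      then have su: "scale_vec c u = scale_vec c (\<Sum>i\<le>N. scale_vec (dotp N (lam i) u) (b i))"
        unfolding mem_Collect_eq by (rule arg_cong)
      show "scale_vec c u \<in> {v. v = (\<Sum>i\<le>N. scale_vec (dotp N (lam i) v) (b i))}"
        unfolding mem_Collect_eq dotp_scale by (rule trans[OF su]) (simp add: vec.scale_sum_right)
      assume v: "v \<in> {v. v = (\<Sum>i\<le>N. scale_vec (dotp N (lam i) v) (b i))}"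
      have uv: "u + v = (\<Sum>i\<le>N. scale_vec (dotp N (lam i) u) (b i)) + (\<Sum>i\<le>N. scale_vec (dotp N (lam i) v) (b i))"
        using u v unfolding mem_Collect_eq by (rule arg_cong2)
      show "u + v \<in> {v. v = (\<Sum>i\<le>N. scale_vec (dotp N (lam i) v) (b i))}"
        unfolding mem_Collect_eq dotp_add by (rule trans[OF uv]) (simp add: vec.scale_left_distrib sum.distrib)
    qed
    moreover have "b ` {..N} \<subseteq> {v. v = (\<Sum>i\<le>N. scale_vec (dotp N (lam i) v) (b i))}"
    proof (rule image_subsetI)
      fix j assume "j \<in> {..N}"
      then have j: "j \<le> N" by simp
      have "(\<Sum>i\<le>N. scale_vec (dotp N (lam i) (b j)) (b i)) = (\<Sum>i\<le>N. if i = j then b j else 0)"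
        by (rule sum.cong) (use lam j in \<open>auto simp: scale_vec_def fun_eq_iff\<close>)
      then show "b j \<in> {v. v = (\<Sum>i\<le>N. scale_vec (dotp N (lam i) v) (b i))}" using j by simp
    qed
    ultimately show "v = (\<Sum>i\<le>N. scale_vec (dotp N (lam i) v) (b i))"
      using vec.span_minimal[OF _ sub] by blast
  qed
  then show ?thesis using bE by blast
qed

lemma form_in_defining_ideal_points:
  assumes "p \<in> forms N s" "\<And>w. w \<in> W \<Longrightarrow> mpoly_eval p w = 0"
  shows "p \<in> defining_ideal N (points_of N W)"
  using assms by (auto simp: defining_ideal_form vanishing_forms_def points_of_def vanishes_at_def)

lemma defining_ideal_points_eval:
  assumes "p \<in> defining_ideal N (points_of N W)" "p \<in> forms N s" "vec.subspace W"
    "v \<in> W" "v \<in> coords N" "v \<noteq> 0"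
  shows "mpoly_eval p v = 0"
proof -
  have "vec.span {v} \<in> points_of N W"
    using assms(3-6) vec.span_minimal[of "{v}" W] proj_space_iff[of "vec.span {v}" N] by (auto simp: points_of_def)
  then have "vanishes_at p (vec.span {v})"
    using assms(1,2) by (auto simp: defining_ideal_form vanishing_forms_def)
  then show ?thesis using vanishes_at_span[OF assms(2)] by simp
qed

context coordinates
begin

text \<open>A form \<open>f\<close> of degree less than \<open>d\<close> in the last \<open>e\<close> coordinates restricts to \<open>W\<close>, spanned by the
  last \<open>e\<close> basis vectors and one point with first coordinates \<open>c\<close>, as a power of \<open>t\<close> times a form
  \<open>g\<close> of degree \<open>d - 1\<close>; here \<open>t\<close> is the coordinate of \<open>W\<close> with \<open>x\<^sub>k = c\<^sub>k t\<close>.\<close>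

lemma restrict_low_tail:
  fixes f :: "(nat, 'k) mpoly" and c :: "nat \<Rightarrow> 'k"
  assumes f: "f \<in> low_tail N n1 d" "f \<in> forms N (int D)" and D: "d - 1 \<le> D" and n1: "0 < n1"
    and c: "c 0 \<noteq> 0"
  shows "\<exists>g\<in>forms N (int (d - 1)). \<forall>\<tau> x. (\<forall>k<n1. x k = \<tau> * c k) \<longrightarrow>
    mpoly_eval f x = \<tau> ^ (D - (d - 1)) * mpoly_eval g x"
proof -
  define A where "A m = {k\<in>keys m. k < n1}" for m :: "nat \<Rightarrow>\<^sub>0 nat"
  define B where "B m = {k\<in>keys m. n1 \<le> k}" for m :: "nat \<Rightarrow>\<^sub>0 nat"
  have split: "(\<Prod>k\<in>keys m. u k) = (\<Prod>k\<in>A m. u k) * (\<Prod>k\<in>B m. u k)" for m and u :: "nat \<Rightarrow> 'k"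
  proof -
    have "keys m = A m \<union> B m" by (auto simp: A_def B_def)
    then show ?thesis by (metis (no_types, lifting) A_def B_def disjoint_iff finite_Un finite_keys leD mem_Collect_eq prod.union_disjoint)
  qed
  have dsplit: "mon_degree m = (\<Sum>k\<in>A m. lookup m k) + tail_degree n1 m" for m
  proof -
    have "keys m = A m \<union> B m" by (auto simp: A_def B_def)
    then show ?thesis unfolding mon_degree_def tail_degree_def B_def[symmetric]
      by (metis (no_types, lifting) A_def B_def disjoint_iff finite_Un finite_keys leD mem_Collect_eq sum.union_disjoint)
  qed
  have m: "keys m \<subseteq> {..N}" "mon_degree m = D" "tail_degree n1 m \<le> d - 1" if "m \<in> keys f" for m
    using f that by (auto simp: low_tail_def forms_def polys_def)
  \<comment> \<open>Powers of \<open>var 0 / c 0\<close>, which restricts to \<open>\<tau>\<close>,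
    fill every monomial up to degree \<open>d - 1\<close>; \<open>co\<close> is the resulting
    coefficient.\<close>
  define co where "co m = lookup f m * (\<Prod>k\<in>A m. c k ^ lookup m k) * (1 / c 0) ^ (d - 1 - tail_degree n1 m)" for m
  define g where "g = (\<Sum>m\<in>keys f. single 0 (co m) * (var 0 ^ (d - 1 - tail_degree n1 m) * (\<Prod>k\<in>B m. var k ^ lookup m k)))"
  have "g \<in> forms N (int (d - 1))"
    unfolding g_def
  proof (rule forms_sum)
    fix m assume mf: "m \<in> keys f"
    have "(\<Prod>k\<in>B m. var k ^ lookup m k) \<in> forms N (\<Sum>k\<in>B m. int (lookup m k) * 1)"
      using m(1)[OF mf] by (intro forms_prod forms_power forms_var) (auto simp: B_def)
    moreover have "var 0 ^ (d - 1 - tail_degree n1 m) \<in> forms N (int (d - 1 - tail_degree n1 m) * 1)"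
      by (intro forms_power forms_var) simp
    ultimately have "single 0 (co m) * (var 0 ^ (d - 1 - tail_degree n1 m) * (\<Prod>k\<in>B m. var k ^ lookup m k))
        \<in> forms N (0 + (int (d - 1 - tail_degree n1 m) * 1 + (\<Sum>k\<in>B m. int (lookup m k) * 1)))"
      by (intro forms_mult forms_const)
    moreover have "0 + (int (d - 1 - tail_degree n1 m) * 1 + (\<Sum>k\<in>B m. int (lookup m k) * 1)) = int (d - 1)"
      using m(3)[OF mf] by (simp add: tail_degree_def B_def flip: of_nat_sum of_nat_add)
    ultimately show "single 0 (co m) * (var 0 ^ (d - 1 - tail_degree n1 m) * (\<Prod>k\<in>B m. var k ^ lookup m k))
        \<in> forms N (int (d - 1))"
      by (simp only:)
  qed
  moreover have "mpoly_eval f x = \<tau> ^ (D - (d - 1)) * mpoly_eval g x" if x: "\<forall>k<n1. x k = \<tau> * c k" for \<tau> x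
  proof -
    have prod_eval: "mpoly_eval (prod u S) x = (\<Prod>k\<in>S. mpoly_eval (u k) x)" for u :: "nat \<Rightarrow> (nat, 'k) mpoly" and S
      by (rule ring_hom_prod[OF ring_hom_eval])
    have "lookup f m * monv x m = \<tau> ^ (D - (d - 1)) *
        mpoly_eval (single 0 (co m) * (var 0 ^ (d - 1 - tail_degree n1 m) * (\<Prod>k\<in>B m. var k ^ lookup m k))) x"
      if mf: "m \<in> keys f" for m
    proof -
      let ?r = "d - 1 - tail_degree n1 m"
      have "(\<Prod>k\<in>A m. x k ^ lookup m k) = \<tau> ^ (\<Sum>k\<in>A m. lookup m k) * (\<Prod>k\<in>A m. c k ^ lookup m k)"
        using x by (simp add: A_def power_mult_distrib prod.distrib power_sum)
      moreover have "(\<Sum>k\<in>A m. lookup m k) = (D - (d - 1)) + ?r"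
        using dsplit[of m] m(2,3)[OF mf] D by simp
      ultimately have "monv x m = \<tau> ^ (D - (d - 1)) * \<tau> ^ ?r * (\<Prod>k\<in>A m. c k ^ lookup m k) * (\<Prod>k\<in>B m. x k ^ lookup m k)"
        by (simp add: monv_def split power_add)
      moreover have "x 0 = \<tau> * c 0" using x n1 by blast
      ultimately show ?thesis
        using c by (simp add: co_def prod_eval power_mult_distrib power_one_over field_simps)
    qed
    then show ?thesis
      unfolding g_def mpoly_eval_sum sum_distrib_left
      by (simp only: mpoly_eval_insertion[of f] insertion_def cong: sum.cong)
  qed
  ultimately show ?thesis by blast
qed

lemma no_low_tail_in_ideal:
  fixes G :: "(nat \<times> nat, 'k) mpoly"
  assumes n1: "n1 + e = Suc N" "0 < n1" and d: "1 \<le> d"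
    and I: "is_ideal N I"
    and S: "\<And>a. row_space N e a \<in> grass N e \<Longrightarrow> mpoly_eval G a \<noteq> 0 \<Longrightarrow>
        no_sections_on N I (int d - 1) (row_space N e a)"
    and r: "r \<in> coords N" "mpoly_eval G (\<lambda>(i, j). if i < e then b (n1 + i) j else r j) \<noteq> 0"
    and fin: "forms N (int M) \<subseteq> set_sum I (flag n1)"
    and f: "f \<in> low_tail N n1 d" "f \<in> forms N s" "sig f \<in> I"
  shows "f = 0"
proof (rule ccontr)
  assume f0: "f \<noteq> 0"
  then have s: "s \<ge> 0" using forms_neg[OF _ f(2)] by fastforce
  \<comment> \<open>Multiplying by a power of a head variable keeps the tail degree and lifts the
    total degree to at least \<open>d\<close>, so that a power of \<open>tt\<close> can be split off
    below.\<close>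
  define f1 where "f1 = var 0 ^ d * f"
  define D where "D = d + nat s"
  have v0: "(var 0 :: (nat, 'k) mpoly) \<in> polyring N" by (intro polys_var) simp
  have "var 0 ^ k * f \<in> low_tail N n1 d" for k
  proof (induction k)
    case (Suc k)
    then have "var 0 * (var 0 ^ k * f) \<in> low_tail N n1 d" using n1(2) by (intro low_tail_var_mult) auto
    then show ?case by (simp add: mult.assoc)
  qed (use f(1) in simp)
  then have f1l: "f1 \<in> low_tail N n1 d" by (simp add: f1_def)
  have f1f: "f1 \<in> forms N (int D)"
    using forms_mult[OF forms_power[OF forms_var, of 0 N d] f(2)] s by (simp add: f1_def D_def)
  have f1I: "sig f1 \<in> I"
    using ideal_mult[OF I sig_polyring[OF polys_power[OF v0, of d]] f(3)] by (simp add: f1_def sig_mult)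
  have "lookup (var 0 :: (nat, 'k) mpoly) (single 0 1) = 1" by (simp add: var_def)
  then have "(var 0 :: (nat, 'k) mpoly) \<noteq> 0" by force
  then have "f1 \<noteq> 0" using f0 by (simp add: f1_def)
  have f1p: "f1 \<in> polyring N" using forms_polyring[OF f1f] .
  have "sig f1 \<noteq> 0" using \<open>f1 \<noteq> 0\<close> sig_inj[OF f1p polys_0] sig_0 by auto
  moreover have "sig (var 0) \<noteq> 0" using \<open>var 0 \<noteq> 0\<close> sig_inj[OF v0 polys_0] sig_0 by auto
  ultimately have hn: "sig f1 * sig (var 0) \<noteq> 0" by simp
  have hp: "sig f1 * sig (var 0) \<in> polyring N" by (intro polys_mult sig_polyring f1p v0)
  obtain v1 where v1: "v1 \<in> coords N" "mpoly_eval (sig f1 * sig (var 0)) v1 \<noteq> 0"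
    using polyring_eq_0_if_eval_0[OF hp] hn by blast
  \<comment> \<open>\<open>G\<close> as a polynomial in the additional row only, with the first
    \<open>e\<close> rows fixed; a point where neither it nor \<open>sig f1 * sig (var 0)\<close>
    vanishes becomes \<open>V\<close>.\<close>
  define G1 where "G1 = subst_poly (\<lambda>(i, j). if i < e then single 0 (b (n1 + i) j) else var j) G"
  have G1: "mpoly_eval G1 v = mpoly_eval G (\<lambda>(i, j). if i < e then b (n1 + i) j else v j)" for v
    unfolding G1_def mpoly_eval_subst_poly by (rule arg_cong[of _ _ "mpoly_eval G"]) (auto simp: fun_eq_iff)
  have "mpoly_eval G1 r \<noteq> 0" using r(2) G1 by simp
  from common_nonzero_point[OF this v1(2)]
  obtain t where t: "mpoly_eval G1 (\<lambda>i. r i + t * (v1 i - r i)) \<noteq> 0"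
    "mpoly_eval (sig f1 * sig (var 0)) (\<lambda>i. r i + t * (v1 i - r i)) \<noteq> 0" .
  define V where "V = (\<lambda>i. r i + t * (v1 i - r i))"
  have V: "V \<in> coords N" using r(1) v1(1) by (auto simp: V_def coords_def)
  have GV: "mpoly_eval G (\<lambda>(i, j). if i < e then b (n1 + i) j else V j) \<noteq> 0" 
    using t(1)[folded V_def] unfolding G1 .
  have fV: "mpoly_eval (sig f1) V \<noteq> 0" using t(2) by (simp add: V_def)
  define c where "c k = dotp N (lam k) V" for k
  have c0: "c 0 \<noteq> 0" using t(2) by (simp add: V_def[symmetric] c_def sig_var)
  then have Vn: "V \<noteq> 0" by (auto simp: c_def dotp_def)
  define E where "E i = (if i < e then b (n1 + i) else V)" for i
  have Ec: "E i \<in> coords N" if "i \<le> e" for i using b_coords V n1 by (auto simp: E_def)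
  have dE: "dotp N (lam k) (E i) = 0" if "k < n1" "i < e" for k i
    using dual[of "n1 + i" k] that n1(1) by (simp add: E_def)
  have Eind: "indep_family E (Suc e)"
    unfolding indep_family_def
  proof (intro allI impI)
    fix x i assume x: "(\<Sum>i<Suc e. scale_vec (x i) (E i)) = 0" and i: "i < Suc e"
    have zero: "dotp N a (\<Sum>i<Suc e. scale_vec (x i) (E i)) = 0" for a unfolding x by (simp add: dotp_def)
    have "x e * c 0 = 0"
      using zero[of "lam 0"] dE n1(2) by (simp add: dotp_sum dotp_scale dotp_add E_def[of e] c_def)
    then have xe: "x e = 0" using c0 by simp
    show "x i = 0"
    proof (cases "i = e")
      case False
      then have ie: "i < e" using i by simp
      have "dotp N (lam (n1 + i)) (E j) = (if j = i then 1 else 0)" if "j < e" for j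
        using dual[of "n1 + j" "n1 + i"] that ie n1(1) by (simp add: E_def)
      then have "(\<Sum>j<e. x j * dotp N (lam (n1 + i)) (E j)) = (\<Sum>j<e. if j = i then x i else 0)"
        by (intro sum.cong) auto
      then show ?thesis
        using zero[of "lam (n1 + i)"] xe ie by (simp add: dotp_sum dotp_scale dotp_add)
    qed (use xe in simp)
  qed
  define W where "W = vec.span (E ` {..e})"
  have row: "row_space N e (\<lambda>(i, j). E i j) = W" unfolding W_def by (rule row_space_family) (rule Ec)
  have "W \<in> grass N e" unfolding W_def by (rule span_family_in_grass[OF Ec Eind])
  moreover have "mpoly_eval G (\<lambda>(i, j). E i j) \<noteq> 0"
  proof -
    have "(\<lambda>(i, j). E i j) = (\<lambda>(i, j). if i < e then b (n1 + i) j else V j)" by (auto simp: E_def fun_eq_iff)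
    then show ?thesis using GV by simp
  qed
  ultimately have nosec: "no_sections_on N I (int d - 1) W" using S[of "\<lambda>(i, j). E i j"] row by simp
  have VW: "V \<in> W" unfolding W_def by (rule vec.span_base) (auto simp: E_def image_iff intro!: bexI[of _ e])
  have Wc: "W \<subseteq> coords N" and Wsub: "vec.subspace W" using \<open>W \<in> grass N e\<close> by (auto simp: grass_def)
  \<comment> \<open>On \<open>W\<close> the first \<open>n1\<close> coordinates are proportional to
    those of \<open>V\<close>, because they vanish on the other spanning vectors.\<close>
  have Wprop: "\<forall>k<n1. dotp N (lam k) w = (dotp N (lam 0) w / c 0) * c k" if "w \<in> W" for w
  proof -
    have sub: "vec.subspace {w. \<forall>k<n1. dotp N (lam k) w * c 0 = dotp N (lam 0) w * c k}"
      by (rule vec.subspaceI) (auto simp: dotp_add dotp_scale algebra_simps, auto simp: dotp_def)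
    have "E ` {..e} \<subseteq> {w. \<forall>k<n1. dotp N (lam k) w * c 0 = dotp N (lam 0) w * c k}"
    proof (rule image_subsetI)
      fix i assume "i \<in> {..e}"
      show "E i \<in> {w. \<forall>k<n1. dotp N (lam k) w * c 0 = dotp N (lam 0) w * c k}"
        using dE n1(2) by (cases "i < e") (auto simp: E_def c_def)
    qed
    from vec.span_minimal[OF this sub] show ?thesis using that c0 by (auto simp: W_def field_simps)
  qed
  have "d - 1 \<le> D" by (simp add: D_def)
  from restrict_low_tail[where c = c, OF f1l f1f this n1(2) c0]
  obtain g' where g': "g' \<in> forms N (int (d - 1))" "\<And>\<tau> x. \<forall>k<n1. x k = \<tau> * c k \<Longrightarrow>
      mpoly_eval f1 x = \<tau> ^ (D - (d - 1)) * mpoly_eval g' x"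
    by blast
  define g where "g = sig g'"
  define K where "K = D - (d - 1)"
  \<comment> \<open>The coordinate of \<open>W\<close> with value 1 at \<open>V\<close> and 0 on the
    first \<open>e\<close> spanning vectors.\<close>
  define tt where "tt = single 0 (1 / c 0) * lform N (lam 0)"
  have gf: "g \<in> forms N (int d - 1)" using sig_forms[OF g'(1)] d by (simp add: g_def of_nat_diff)
  have ttf: "tt \<in> forms N 1" unfolding tt_def using forms_mult[OF forms_const lform_forms] by simp
  have fg: "mpoly_eval (sig f1) w = mpoly_eval tt w ^ K * mpoly_eval g w" if "w \<in> W" for w
    using g'(2)[of "\<lambda>k. dotp N (lam k) w", OF Wprop[OF that]] by (simp add: eval_sig g_def K_def tt_def)
  define IW where "IW = defining_ideal N (points_of N W)"
  define J where "J = ideal_gen N (I \<union> IW)"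
  have IWi: "is_ideal N IW" unfolding IW_def by (rule is_ideal_defining_ideal)
  have J: "is_ideal N J"
    unfolding J_def using I IWi by (intro is_ideal_ideal_gen) (auto dest: ideal_polyring)
  have JI: "I \<subseteq> J" "IW \<subseteq> J" unfolding J_def using ideal_gen_superset by blast+
  have gp: "g \<in> polyring N" and ttp: "tt \<in> polyring N" using gf ttf forms_polyring by blast+
  have "tt ^ K * g - sig f1 \<in> IW"
    unfolding IW_def
  proof (rule form_in_defining_ideal_points)
    have "tt ^ K * g \<in> forms N (int K * 1 + (int d - 1))" by (intro forms_mult forms_power ttf gf)
    moreover have "int K * 1 + (int d - 1) = int D" using d by (simp add: K_def D_def)
    ultimately show "tt ^ K * g - sig f1 \<in> forms N (int D)" using sig_forms[OF f1f] by (metis forms_diff)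
  qed (simp add: fg)
  then have tgJ: "tt ^ K * g \<in> J" using ideal_cong[OF J] f1I JI by blast
  \<comment> \<open>Chart by chart: on \<open>W\<close> the first coordinates are multiples of
    \<open>tt\<close>, so by \<open>fin\<close> a power of \<open>var i\<close> is a multiple of
    \<open>tt\<close> modulo \<open>J\<close>. Hence \<open>tt ^ K * g\<close> in \<open>J\<close>
    puts \<open>var i ^ (M * K) * g\<close> into \<open>J\<close>.\<close>
  have "\<exists>k. var i ^ k * g \<in> J" if i: "i \<le> N" for i
  proof -
    have vi: "(var i :: (nat, 'k) mpoly) \<in> polyring N" using i by (intro polys_var) simp
    have "var i ^ M \<in> set_sum I (flag n1)" using forms_power[OF forms_var[OF i], of M] fin by auto
    then obtain p a where pa: "var i ^ M = p + sig a" "p \<in> I" "a \<in> coord_ideal N n1"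
      by (auto simp: set_sum_def flag_def)
    obtain h where h: "\<forall>j. h j \<in> polyring N" "a = (\<Sum>j<n1. var j * h j)"
      using coord_ideal_sum[OF _ pa(3)] n1 by auto
    define u where "u = (\<Sum>j<n1. single 0 (c j) * sig (h j))"
    have u: "u \<in> polyring N"
      unfolding u_def using h(1) by (intro polys_sum polys_mult sig_polyring polys_single) auto
    have "var i ^ M - tt * u = p + (\<Sum>j<n1. sig (h j) * (sig (var j) - single 0 (c j) * tt))"
      by (simp add: pa(1) h(2) u_def sig_sum sig_mult sum_distrib_left right_diff_distrib sum_subtractf mult.commute mult.left_commute)
    also have "\<dots> \<in> J"
    proof (rule ideal_add[OF J _ ideal_sum[OF J ideal_mult[OF J]]])
      show "p \<in> J" using pa(2) JI by blast
      show "sig (h j) \<in> polyring N" for j using h(1) by (intro sig_polyring) simp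
      fix j assume "j \<in> {..<n1}"
      then have j: "j < n1" "j \<le> N" using n1 by auto
      have "sig (var j) - single 0 (c j) * tt \<in> IW"
        unfolding IW_def
      proof (rule form_in_defining_ideal_points)
        show "sig (var j) - single 0 (c j) * tt \<in> forms N 1"
          using forms_mult[OF forms_const ttf, of "c j"] sig_forms[OF forms_var[OF j(2)]] by (auto intro: forms_diff)
        fix w assume "w \<in> W"
        then show "mpoly_eval (sig (var j) - single 0 (c j) * tt) w = 0"
          using Wprop[of w] j c0 by (simp add: sig_var tt_def field_simps)
      qed
      then show "sig (var j) - single 0 (c j) * tt \<in> J" using JI by blast
    qed
    finally have "(var i ^ M) ^ K - (tt * u) ^ K \<in> J"
      by (intro power_diff_ideal[OF J]) (auto intro!: polys_power polys_mult vi ttp u)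
    then have "g * ((var i ^ M) ^ K - (tt * u) ^ K) \<in> J" by (rule ideal_mult[OF J gp])
    moreover have "u ^ K * (tt ^ K * g) \<in> J" by (rule ideal_mult[OF J polys_power[OF u] tgJ])
    ultimately have "g * ((var i ^ M) ^ K - (tt * u) ^ K) + u ^ K * (tt ^ K * g) \<in> J" by (rule ideal_add[OF J])
    then have "(var i ^ M) ^ K * g \<in> J" by (simp add: algebra_simps power_mult_distrib)
    then have "var i ^ (M * K) * g \<in> J" by (simp only: power_mult)
    then show ?thesis by blast
  qed
  then have "g \<in> sheaf_sections N J (int d - 1)" using gf by (simp add: sheaf_sections_def)
  then have "g \<in> IW" using nosec unfolding no_sections_on_def J_def IW_def by blast
  then have "mpoly_eval g V = 0"
    unfolding IW_def by (rule defining_ideal_points_eval[OF _ gf Wsub VW V Vn])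
  then show False using fg[OF VW] fV by simp
qed

end

section \<open>Depth\<close>

text \<open>\<open>P1\<close> collects the monomials divisible by \<open>var j\<close>. The two
  degree clauses are the step and the base of an induction on the degree of a relation.\<close>

lemma var_split:
  assumes P: "P \<in> polys V"
  shows "\<exists>P0\<in>polys (V - {j}). \<exists>P1\<in>polys V. P = P0 + var j * P1 \<and>
    (\<forall>t. (\<forall>m\<in>keys P. mon_degree m \<le> Suc t) \<longrightarrow> (\<forall>m\<in>keys P1. mon_degree m \<le> t)) \<and>
    ((\<forall>m\<in>keys P. mon_degree m \<le> 0) \<longrightarrow> P1 = 0)"
proof -
  define S where "S = {m\<in>keys P. j \<in> keys m}"
  define P1 where "P1 = (\<Sum>m\<in>S. single (m - single j 1) (lookup P m))"
  define P0 where "P0 = filter_monomials (\<lambda>m. j \<notin> keys m) P"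
  have S: "single j 1 + (m - single j 1) = m" if "m \<in> S" for m
    using that by (intro poly_mapping_eqI)
      (auto simp: S_def lookup_add lookup_minus lookup_single when_def in_keys_iff)
  have deg: "Suc (mon_degree (m - single j 1)) = mon_degree m" if "m \<in> S" for m
    using arg_cong[OF S[OF that], of mon_degree] by (simp add: mon_degree_add)
  have "P0 \<in> polys (V - {j})"
    using P by (auto simp: P0_def polys_def keys_filter_monomials)
  moreover have "P1 \<in> polys V"
    unfolding P1_def
  proof (intro polys_sum polys_single)
    fix m assume "m \<in> S"
    moreover have "keys (m - single j 1) \<subseteq> keys m" by (auto simp: in_keys_iff lookup_minus)
    ultimately show "keys (m - single j 1) \<subseteq> V" using P by (auto simp: S_def polys_def)
  qed
  moreover have "P = P0 + var j * P1"
  proof -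
    have "var j * P1 = (\<Sum>m\<in>S. single m (lookup P m))"
      unfolding P1_def var_def sum_distrib_left using S by (simp add: mult_single)
    also have "\<dots> = filter_monomials (\<lambda>m. j \<in> keys m) P" by (simp add: filter_monomials_def S_def)
    finally show ?thesis
      unfolding P0_def by (intro poly_mapping_eqI) (auto simp: lookup_add lookup_filter_monomials)
  qed
  moreover have "\<exists>m'\<in>S. m = m' - single j 1" if "m \<in> keys P1" for m
    using that keys_sum[of "\<lambda>m. single (m - single j 1) (lookup P m)" S] unfolding P1_def
    by (auto split: if_splits)
  then have "mon_degree m \<le> t" if "\<forall>m\<in>keys P. mon_degree m \<le> Suc t" "m \<in> keys P1" for m t
    using that deg unfolding S_def by fastforce
  moreover have "P1 = 0" if "\<forall>m\<in>keys P. mon_degree m \<le> 0"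
  proof -
    have "S = {}" using deg that unfolding S_def by fastforce
    then show ?thesis by (simp add: P1_def)
  qed
  ultimately show ?thesis by blast
qed

text \<open>In a relation \<open>P\<^sub>0 + f\<^sub>j P\<^sub>1 = 0\<close> modulo \<open>f\<^sub>0,\<dots>,f\<^sub>j\<^sub>-\<^sub>1\<close>, where \<open>P\<^sub>0\<close> does not involve \<open>f\<^sub>j\<close>, the
  polynomial \<open>P\<^sub>0\<close> vanishes by the relation modulo \<open>f\<^sub>j\<close>, and then \<open>f\<^sub>j\<close> can be cancelled.\<close>

lemma regular_sequence_independent:
  assumes I: "is_ideal N I" and fs: "set fs \<subseteq> polyring N" "regular_sequence N I fs"
    and r: "r \<le> length fs"
    and P: "P \<in> polys {..<r}" "subst_poly (\<lambda>i. fs ! i) P \<in> I"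
  shows "P = 0"
proof -
  define K where "K i = ideal_gen N (I \<union> set (take i fs))" for i
  have IK: "I \<union> set (take i fs) \<subseteq> polyring N" for i
    using I fs(1) set_take_subset[of i fs] by (auto dest: ideal_polyring)
  have K: "is_ideal N (K i)" for i unfolding K_def by (rule is_ideal_ideal_gen[OF IK])
  have K_mono: "K i \<subseteq> K (Suc i)" for i
    unfolding K_def
  proof (rule ideal_gen_least[OF is_ideal_ideal_gen[OF IK]])
    have "set (take i fs) \<subseteq> set (take (Suc i) fs)" by (rule set_take_subset_set_take) simp
    then show "I \<union> set (take i fs) \<subseteq> ideal_gen N (I \<union> set (take (Suc i) fs))"
      using ideal_gen_superset[of "I \<union> set (take (Suc i) fs)" N] by blast
  qed
  have fsK: "fs ! i \<in> K (Suc i)" if "i < length fs" for i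
    unfolding K_def using that ideal_gen_superset[of "I \<union> set (take (Suc i) fs)" N]
    by (auto simp: take_Suc_conv_app_nth)
  have one: "1 \<notin> K (length fs)"
  proof
    assume "1 \<in> K (length fs)"
    then have "K (length fs) = polyring N" by (rule ideal_eq_polyring[OF K])
    then show False using fs(2) by (simp add: K_def regular_sequence_def)
  qed
  have oner: "1 \<notin> K r"
    using one lift_Suc_mono_le[of K, OF K_mono r] by blast
  let ?s = "subst_poly (\<lambda>i. fs ! i)"
  have sp: "?s P \<in> polyring N" if "P \<in> polys {..<r}" for P
  proof -
    have "monv ((!) fs) m \<in> polyring N" if "m \<in> keys P" for m
    proof -
      have "fs ! i \<in> polyring N" if "i \<in> keys m" for i
      proof -
        have "keys m \<subseteq> {..<r}" using \<open>P \<in> polys {..<r}\<close> \<open>m \<in> keys P\<close> by (simp add: polys_def)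
        then have "i < length fs" using that r by auto
        then show ?thesis using fs(1) nth_mem by blast
      qed
      then show ?thesis unfolding monv_def by (intro polys_prod polys_power)
    qed
    then show ?thesis unfolding subst_poly_def insertion_def by (intro polys_sum polys_mult polys_single) auto
  qed
  have main: "P = 0" if "j \<le> r" "P \<in> polys {j..<r}" "?s P \<in> K j" for j P
    using that
  proof (induction j arbitrary: P rule: inc_induct)
    case base
    have "P = single 0 (lookup P 0)"
    proof (rule poly_mapping_eqI)
      fix k
      have "k \<in> keys P \<Longrightarrow> keys k = {}" using base(1) by (auto simp: polys_def)
      then show "lookup P k = lookup (single 0 (lookup P 0)) k"
        by (cases "k = 0") (auto simp: lookup_single in_keys_iff keys_eq_empty)
    qed
    then have "?s P = single 0 (lookup P 0)"
      using insertion_single[OF ring_hom_const, of "\<lambda>i. fs ! i" 0 "lookup P 0"] by (simp add: subst_poly_def)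
    then have c: "single 0 (lookup P 0) \<in> K r" using base(2) by simp
    have "lookup P 0 = 0"
    proof (rule ccontr)
      assume "lookup P 0 \<noteq> 0"
      then have "single 0 (1 / lookup P 0) * single 0 (lookup P 0) = (1 :: (nat, 'a) mpoly)"
        by (simp add: mult_single)
      moreover have "single 0 (1 / lookup P 0) * single 0 (lookup P 0) \<in> K r"
        by (rule ideal_mult[OF K polys_single c]) simp
      ultimately show False using oner by simp
    qed
    then show ?case using \<open>P = single 0 (lookup P 0)\<close> by simp
  next
    case (step j)
    have "P = 0" if "\<forall>m\<in>keys P. mon_degree m \<le> t" "P \<in> polys {j..<r}" "?s P \<in> K j" for t P
      using that
    proof (induction t arbitrary: P)
      case (0 P)
      obtain P0 P1 where P01: "P0 \<in> polys ({j..<r} - {j})" "P = P0 + var j * P1" "P1 = 0"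
        using var_split[OF 0(2), of j] 0(1) by blast
      have "{j..<r} - {j} = {Suc j..<r}" by auto
      moreover have "?s P0 \<in> K (Suc j)" using P01 0(3) K_mono by auto
      ultimately show ?case using step.IH[of P0] P01 by simp
    next
      case (Suc t P)
      obtain P0 P1 where P01: "P0 \<in> polys ({j..<r} - {j})" "P1 \<in> polys {j..<r}" "P = P0 + var j * P1"
        "\<forall>m\<in>keys P1. mon_degree m \<le> t"
        using var_split[OF Suc.prems(2), of j] Suc.prems(1) by blast
      have jl: "j < length fs" using step.hyps r by simp
      have P1r: "P1 \<in> polys {..<r}" using P01(2) unfolding polys_def by fastforce
      have sP: "?s P = ?s P0 + fs ! j * ?s P1"
        using ring_hom_subst_poly[of "\<lambda>i. fs ! i"] insertion_var[OF ring_hom_const, of "\<lambda>i. fs ! i" j]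
        unfolding P01(3) ring_hom_def subst_poly_def by simp
      have "?s P1 * fs ! j \<in> K (Suc j)" by (rule ideal_mult[OF K sp[OF P1r] fsK[OF jl]])
      then have "?s P0 \<in> K (Suc j)"
        using ideal_diff[OF K, of "?s P" "Suc j" "?s P1 * fs ! j"] Suc.prems(3) K_mono sP by (auto simp: mult.commute)
      moreover have "{j..<r} - {j} = {Suc j..<r}" by auto
      ultimately have "P0 = 0" using step.IH[of P0] P01(1) by simp
      then have "fs ! j * ?s P1 \<in> K j"
        using Suc.prems(3) sP ring_hom_subst_poly[of "\<lambda>i. fs ! i"] by (simp add: ring_hom_def)
      then have "?s P1 \<in> K j"
        using fs(2) jl sp[OF P1r] unfolding regular_sequence_def K_def by blast
      then have "P1 = 0" using Suc.IH[OF P01(4,2)] by simp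
      then show ?case using P01(3) \<open>P0 = 0\<close> by simp
    qed
    moreover have "\<forall>m\<in>keys P. mon_degree m \<le> Max (insert 0 (mon_degree ` keys P))" by auto
    ultimately show ?case using step.prems by blast
  qed
  have "K 0 \<supseteq> I" unfolding K_def using ideal_gen_superset[of "I \<union> set (take 0 fs)" N] by auto
  then show ?thesis using main[of 0 P] P by (auto simp: atLeast0LessThan)
qed

definition box :: "nat \<Rightarrow> (nat \<Rightarrow> nat) \<Rightarrow> (nat \<Rightarrow>\<^sub>0 nat) set" where
  "box a B = {m. keys m \<subseteq> {..<a} \<and> (\<forall>i<a. lookup m i \<le> B i)}"

lemma card_box: "finite (box a B) \<and> card (box a B) = (\<Prod>i<a. B i + 1)"
proof (induction a)
  case 0
  have "box 0 B = {0}" by (auto simp: box_def keys_eq_empty)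
  then show ?case by simp
next
  case (Suc a)
  let ?h = "\<lambda>(m, j). m + single a j :: nat \<Rightarrow>\<^sub>0 nat"
  have la: "lookup m a = 0" if "m \<in> box a B" for m
    using that by (auto simp: box_def in_keys_iff)
  have img: "box (Suc a) B = ?h ` (box a B \<times> {..B a})"
  proof (intro equalityI subsetI)
    fix m assume m: "m \<in> box (Suc a) B"
    define m' where "m' = m - single a (lookup m a)"
    have lm: "lookup m' i = (if i = a then 0 else lookup m i)" for i
      by (auto simp: m'_def lookup_minus lookup_single when_def)
    have "m = ?h (m', lookup m a)"
      by (auto intro!: poly_mapping_eqI simp: lookup_add lm lookup_single when_def)
    moreover have "m' \<in> box a B"
    proof -
      have "i < a" if "i \<in> keys m'" for i
      proof -
        have "i \<noteq> a" "i \<in> keys m" using that by (auto simp: in_keys_iff lm split: if_splits)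
        moreover have "i < Suc a" using m \<open>i \<in> keys m\<close> by (auto simp: box_def)
        ultimately show ?thesis by simp
      qed
      then show ?thesis using m by (auto simp: box_def lm)
    qed
    moreover have "lookup m a \<le> B a" using m by (simp add: box_def)
    ultimately show "m \<in> ?h ` (box a B \<times> {..B a})" by (intro image_eqI[of _ _ "(m', lookup m a)"]) auto
  next
    fix m assume "m \<in> ?h ` (box a B \<times> {..B a})"
    then obtain m' j where m': "m' \<in> box a B" "j \<le> B a" "m = m' + single a j" by auto
    have "keys m \<subseteq> {..<Suc a}" using m'(1) unfolding m'(3) keys_nat_add by (auto simp: box_def split: if_splits)
    moreover have "lookup m i \<le> B i" if "i < Suc a" for i
      using m' la[OF m'(1)] that by (cases "i = a") (auto simp: box_def lookup_add lookup_single)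
    ultimately show "m \<in> box (Suc a) B" by (simp add: box_def)
  qed
  have inj: "inj_on ?h (box a B \<times> {..B a})"
  proof (rule inj_onI, clarsimp)
    fix m j m' j' assume m: "m \<in> box a B" "m' \<in> box a B" and eq: "m + single a j = m' + single a j'"
    have "j = j'" using arg_cong[OF eq, of "\<lambda>x. lookup x a"] la[OF m(1)] la[OF m(2)] by (simp add: lookup_add)
    then show "m = m' \<and> j = j'" using eq by simp
  qed
  show ?case using Suc card_image[OF inj] by (simp add: img card_cartesian_product)
qed

lemma keys_mon_degree_mult:
  assumes "\<forall>m\<in>keys p. mon_degree m \<le> a" "\<forall>m\<in>keys q. mon_degree m \<le> b"
  shows "\<forall>m\<in>keys (p * q). mon_degree m \<le> a + b"
  using keys_mult[of p q] assms by (fastforce simp: mon_degree_add intro: add_mono)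

lemma keys_mon_degree_power:
  assumes "\<forall>m\<in>keys p. mon_degree m \<le> a"
  shows "\<forall>m\<in>keys (p ^ k). mon_degree m \<le> k * a"
proof (induction k)
  case (Suc k)
  show ?case using keys_mon_degree_mult[OF assms Suc] by simp
qed simp

lemma keys_mon_degree_prod:
  assumes "\<And>i. i \<in> A \<Longrightarrow> \<forall>m\<in>keys (f i). mon_degree m \<le> g i"
  shows "\<forall>m\<in>keys (prod f A). mon_degree m \<le> sum g A"
  using assms
proof (induction A rule: infinite_finite_induct)
  case (insert i A)
  then show ?case using keys_mon_degree_mult[of "f i" "g i" "prod f A" "sum g A"] by simp
qed simp_all

context free_quotient
begin

text \<open>For positive \<open>d\<close> the ideal \<open>I\<close> has no nonzero constants, and
  the linear forms have no constant term; this makes the ideal of the regular sequence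
  proper.\<close>

lemma constant_zero: "0 < d \<Longrightarrow> p \<in> set_sum I (flag n1) \<Longrightarrow> lookup p 0 = 0"
proof -
  assume d: "0 < d" and "p \<in> set_sum I (flag n1)"
  then obtain i a where ia: "p = i + a" "i \<in> I" "a \<in> flag n1" by (auto simp: set_sum_def)
  interpret fl: linear_flag N "\<lambda>k. lform N (lam k)" flag by (rule linear_flag)
  have "lookup a 0 = 0" using fl.A_mono[OF n1_le] ia(3) fl.A_top by blast
  moreover have "hcomp 0 i = 0"
    using low_degree_zero[of "hcomp 0 i" 0] ia(2) I_homogeneous d hcomp_forms[OF ideal_polyring[OF I_ideal ia(2)]]
    by (auto simp: homogeneous_set_def)
  then have "lookup i 0 = 0"
    using lookup_filter_monomials[of "\<lambda>m. int (mon_degree m) = 0" i 0] by (simp add: hcomp_def)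
  ultimately show ?thesis by (simp add: ia(1) lookup_add)
qed

text \<open>Links \<open>ideal_gen\<close>, in which regular sequences are stated, with the sums of
  \<open>I\<close> and \<open>flag k\<close> in the earlier arguments.\<close>

lemma ideal_gen_flag:
  assumes "k \<le> n1"
  shows "ideal_gen N (I \<union> (\<lambda>j. lform N (lam j)) ` {..<k}) = set_sum I (flag k)"
proof
  interpret fl: linear_flag N "\<lambda>k. lform N (lam k)" flag by (rule linear_flag)
  have lk: "lform N (lam j) \<in> flag k" if "j < k" for j
    using fl.l_in_A[of j] fl.A_mono[of "Suc j" k] that assms n1_le by fastforce
  show "ideal_gen N (I \<union> (\<lambda>j. lform N (lam j)) ` {..<k}) \<subseteq> set_sum I (flag k)"
    using set_sum_left[OF fl.A_ideal] set_sum_right[OF I_ideal] lk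
    by (intro ideal_gen_least is_ideal_set_sum I_ideal fl.A_ideal) blast
  let ?S = "I \<union> (\<lambda>j. lform N (lam j)) ` {..<k}"
  have S: "is_ideal N (ideal_gen N ?S)"
    using I_ideal lform_forms forms_polyring by (intro is_ideal_ideal_gen) (blast dest: ideal_polyring)
  show "set_sum I (flag k) \<subseteq> ideal_gen N ?S"
  proof
    fix p assume "p \<in> set_sum I (flag k)"
    then obtain i a where ia: "p = i + sig a" "i \<in> I" "a \<in> coord_ideal N k"
      by (auto simp: set_sum_def flag_def)
    obtain h where h: "\<forall>j. h j \<in> polyring N" "a = (\<Sum>j<k. var j * h j)"
      using coord_ideal_sum[OF _ ia(3)] assms n1_le by auto
    have "sig a = (\<Sum>j<k. sig (h j) * lform N (lam j))"
      unfolding h(2) sig_sum sig_mult using assms n1_le by (intro sum.cong) (auto simp: sig_var mult.commute)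
    also have "\<dots> \<in> ideal_gen N ?S"
      using h(1) ideal_gen_superset[of ?S N] by (intro ideal_sum[OF S] ideal_mult[OF S] sig_polyring) auto
    finally show "p \<in> ideal_gen N ?S"
      using ideal_add[OF S] ideal_gen_superset[of ?S N] ia by blast
  qed
qed

lemma coordinates_regular_sequence:
  assumes "0 < d"
  shows "regular_sequence N I (map (\<lambda>k. lform N (lam k)) [0..<n1])"
proof -
  let ?fs = "map (\<lambda>k. lform N (lam k)) [0..<n1]"
  have take: "set (take k ?fs) = (\<lambda>j. lform N (lam j)) ` {..<k}" if "k \<le> n1" for k
    using that by (simp add: take_map atLeast0LessThan)
  have gen: "ideal_gen N (I \<union> set (take k ?fs)) = set_sum I (flag k)" if "k \<le> n1" for k
    unfolding take[OF that] by (rule ideal_gen_flag[OF that])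
  have "1 \<notin> set_sum I (flag n1)" using constant_zero[OF assms, of 1] by auto
  then have "ideal_gen N (I \<union> set ?fs) \<noteq> polyring N" using gen[of n1] polys_1[of "{..N}"] by auto
  then show ?thesis
    unfolding regular_sequence_def using gen regular by auto
qed

text \<open>Monomials in \<open>n1 + 1\<close> elements with exponents up to \<open>T\<close> would
  be \<open>(T + 1) ^ Suc n1\<close> independent elements of \<open>R/I\<close>, while their normal
  forms involve at most a constant times \<open>(T + 1) ^ n1\<close> monomials.\<close>

lemma regular_sequence_length:
  assumes fs: "set fs \<subseteq> polyring N" "regular_sequence N I fs"
  shows "length fs \<le> n1"
proof (rule ccontr)
  assume "\<not> length fs \<le> n1"
  then have r: "Suc n1 \<le> length fs" by simp
  define Dg where "Dg = Max (insert 0 (\<Union>p\<in>set fs. mon_degree ` keys p))"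
  have fin: "finite (insert 0 (\<Union>p\<in>set fs. mon_degree ` keys p))" by simp
  have Dg: "mon_degree m \<le> Dg" if "p \<in> set fs" "m \<in> keys p" for p m
    unfolding Dg_def using that by (intro Max_ge[OF fin]) auto
  \<comment> \<open>\<open>C\<close> is the part of the bound on \<open>card Kx\<close> that does
    not depend on \<open>T\<close>; with \<open>T = C\<close> the inequality
    \<open>C < T + 1\<close> is immediate.\<close>
  define C where "C = (Suc n1 * Dg + 1) ^ n1 * (d + 1) ^ (Suc N - n1)"
  define T where "T = C"
  \<comment> \<open>Degree bound for a product of \<open>Suc n1\<close> powers with exponents at
    most \<open>T\<close>.\<close>
  define t where "t = Suc n1 * (T * Dg)"
  define Bx where "Bx = box (Suc n1) (\<lambda>_. T)"
  define Kx where "Kx = box (Suc N) (\<lambda>i. if i < n1 then t else d)"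
  have fB: "finite Bx" "card Bx = (T + 1) ^ Suc n1" using card_box[of "Suc n1" "\<lambda>_. T"] by (auto simp: Bx_def)
  have fK: "finite Kx" "card Kx = (t + 1) ^ n1 * (d + 1) ^ (Suc N - n1)"
  proof -
    have "(\<Prod>i<Suc N. (if i < n1 then t else d) + 1) = (\<Prod>i\<in>{..<n1} \<union> {n1..<Suc N}. (if i < n1 then t else d) + 1)"
      by (rule prod.cong) (use n1_le in auto)
    also have "\<dots> = (\<Prod>i<n1. (if i < n1 then t else d) + 1) * (\<Prod>i\<in>{n1..<Suc N}. (if i < n1 then t else d) + 1)"
      by (rule prod.union_disjoint) auto
    also have "\<dots> = (t + 1) ^ n1 * (d + 1) ^ (Suc N - n1)" by simp
    finally show "finite Kx" "card Kx = (t + 1) ^ n1 * (d + 1) ^ (Suc N - n1)"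
      using card_box[of "Suc N" "\<lambda>i. if i < n1 then t else d"] unfolding Kx_def by auto
  qed
  let ?s = "subst_poly (\<lambda>i. fs ! i)"
  have s_single: "?s (single \<alpha> 1) = monv ((!) fs) \<alpha>" for \<alpha>
    using insertion_single[OF ring_hom_const, of "(!) fs" \<alpha> 1] by (simp add: subst_poly_def)
  have "\<exists>q. q \<in> low_tail N n1 d \<and> monv ((!) fs) \<alpha> - sig q \<in> I \<and> keys q \<subseteq> Kx" if a: "\<alpha> \<in> Bx" for \<alpha>
  proof -
    have ka: "keys \<alpha> \<subseteq> {..<Suc n1}" "lookup \<alpha> i \<le> T" for i
      using a by (auto simp: Bx_def box_def) (metis in_keys_iff lessThan_iff not_gr_zero subsetD zero_le)
    have fsi: "fs ! i \<in> set fs" if "i \<in> keys \<alpha>" for i using ka(1) that r by (intro nth_mem) auto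
    have "monv ((!) fs) \<alpha> \<in> polyring N"
      unfolding monv_def using fsi fs(1) by (intro polys_prod polys_power) auto
    moreover have "\<forall>m\<in>keys (monv ((!) fs) \<alpha>). mon_degree m \<le> t"
    proof -
      have "\<forall>m\<in>keys (monv ((!) fs) \<alpha>). mon_degree m \<le> (\<Sum>i\<in>keys \<alpha>. lookup \<alpha> i * Dg)"
        unfolding monv_def using Dg fsi by (intro keys_mon_degree_prod keys_mon_degree_power) blast
      moreover have "(\<Sum>i\<in>keys \<alpha>. lookup \<alpha> i * Dg) \<le> (\<Sum>i\<in>keys \<alpha>. T * Dg)"
        by (intro sum_mono mult_right_mono ka) simp
      moreover have "(\<Sum>i\<in>keys \<alpha>. T * Dg) \<le> t"
        using card_mono[OF _ ka(1)] by (simp add: t_def del: mult_Suc)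
      ultimately show ?thesis by (meson le_trans)
    qed
    ultimately obtain q where q: "q \<in> low_tail N n1 d" "monv ((!) fs) \<alpha> - sig q \<in> I" "\<forall>m\<in>keys q. mon_degree m \<le> t"
      using normal_form by blast
    have "m \<in> Kx" if m: "m \<in> keys q" for m
    proof -
      have mN: "keys m \<subseteq> {..<Suc N}" "tail_degree n1 m < d"
        using q(1) m by (auto simp: low_tail_def polys_def lessThan_Suc_atMost)
      have "lookup m i \<le> (if i < n1 then t else d)" for i
      proof (cases "i \<in> keys m")
        case True
        have "lookup m i \<le> mon_degree m" unfolding mon_degree_def by (rule member_le_sum) (use True in auto)
        moreover have "lookup m i \<le> tail_degree n1 m" if "n1 \<le> i"
          unfolding tail_degree_def by (rule member_le_sum) (use True that in auto)
        ultimately show ?thesis using q(3) m mN(2) by fastforce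
      qed (simp add: in_keys_iff)
      then show ?thesis using mN(1) by (simp add: Kx_def box_def)
    qed
    then show ?thesis using q by blast
  qed
  then obtain q where q: "\<And>\<alpha>. \<alpha> \<in> Bx \<Longrightarrow> q \<alpha> \<in> low_tail N n1 d \<and> monv ((!) fs) \<alpha> - sig (q \<alpha>) \<in> I \<and> keys (q \<alpha>) \<subseteq> Kx"
    by metis
  have "card Kx < card Bx"
  proof -
    have "t + 1 \<le> (Suc n1 * Dg + 1) * (T + 1)" by (simp add: t_def algebra_simps)
    then have "(t + 1) ^ n1 \<le> (Suc n1 * Dg + 1) ^ n1 * (T + 1) ^ n1"
      by (metis power_mono power_mult_distrib zero_le)
    then have "card Kx \<le> (Suc n1 * Dg + 1) ^ n1 * (T + 1) ^ n1 * (d + 1) ^ (Suc N - n1)"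
      unfolding fK(2) by (rule mult_right_mono) simp
    also have "\<dots> = C * (T + 1) ^ n1" by (simp add: C_def)
    also have "\<dots> < (T + 1) ^ Suc n1" by (simp add: T_def)
    finally show ?thesis using fB(2) by simp
  qed
  then obtain c where c: "\<exists>\<alpha>\<in>Bx. c \<alpha> \<noteq> 0" "(\<Sum>\<alpha>\<in>Bx. single 0 (c \<alpha>) * q \<alpha>) = 0"
    using dependent_polynomials[OF fB(1) fK(1), of q] q by blast
  define P where "P = (\<Sum>\<alpha>\<in>Bx. single \<alpha> (c \<alpha>))"
  have "?s P = (\<Sum>\<alpha>\<in>Bx. single 0 (c \<alpha>) * monv ((!) fs) \<alpha>)"
    unfolding P_def ring_hom_sum[OF ring_hom_subst_poly]
    using insertion_single[OF ring_hom_const, of "(!) fs"] by (simp add: subst_poly_def)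
  also have "\<dots> = (\<Sum>\<alpha>\<in>Bx. single 0 (c \<alpha>) * (monv ((!) fs) \<alpha> - sig (q \<alpha>))) + sig (\<Sum>\<alpha>\<in>Bx. single 0 (c \<alpha>) * q \<alpha>)"
  proof -
    have "sig (single 0 x) = single 0 x" for x
      unfolding sig_def subst_poly_def insertion_single[OF ring_hom_const] by simp
    then show ?thesis by (simp add: sig_sum sig_mult sum.distrib[symmetric] algebra_simps)
  qed
  also have "\<dots> \<in> I"
    unfolding c(2) sig_0 add_0_right using q by (intro ideal_sum[OF I_ideal] ideal_mult[OF I_ideal] polys_single) auto
  finally have "?s P \<in> I" .
  moreover have "P \<in> polys {..<Suc n1}"
    unfolding P_def by (intro polys_sum polys_single) (auto simp: Bx_def box_def)
  ultimately have "P = 0" using regular_sequence_independent[OF I_ideal fs r] by blast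
  moreover have "lookup P \<alpha> = c \<alpha>" if "\<alpha> \<in> Bx" for \<alpha>
  proof -
    have "lookup P \<alpha> = (\<Sum>\<beta>\<in>Bx. if \<beta> = \<alpha> then c \<alpha> else 0)"
      unfolding P_def lookup_sum by (rule sum.cong) (auto simp: lookup_single)
    then show ?thesis using that fB(1) by simp
  qed
  ultimately show False using c(1) by auto
qed

lemma quotient_depth_eq:
  assumes "0 < d"
  shows "quotient_depth N I = enat n1"
proof -
  let ?m = "ideal_gen N (var ` {..N} :: (nat, 'k) mpoly set)"
  have vp: "var ` {..N} \<subseteq> (polyring N :: (nat, 'k) mpoly set)" by (auto intro: polys_var)
  have m: "is_ideal N ?m" by (rule is_ideal_ideal_gen[OF vp])
  let ?D = "{enat (length fs) | fs. set fs \<subseteq> ?m \<and> regular_sequence N I fs}"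
  have "lform N a \<in> ?m" for a
    unfolding lform_def using ideal_gen_superset[of "var ` {..N}" N]
    by (intro ideal_sum[OF m] ideal_mult[OF m] polys_single) auto
  then have "enat n1 \<in> ?D"
    using coordinates_regular_sequence[OF assms]
    by (intro CollectI exI[of _ "map (\<lambda>k. lform N (lam k)) [0..<n1]"]) auto
  moreover have "x \<le> enat n1" if "x \<in> ?D" for x
  proof -
    obtain fs where fs: "x = enat (length fs)" "set fs \<subseteq> ?m" "regular_sequence N I fs" using \<open>x \<in> ?D\<close> by blast
    have "set fs \<subseteq> polyring N" using fs(2) ideal_polyring[OF m] by blast
    then show ?thesis using regular_sequence_length fs(1,3) by simp
  qed
  ultimately show ?thesis
    unfolding quotient_depth_def by (intro antisym Sup_least Sup_upper) auto
qed

end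

section \<open>Application to algebraic sets with condition ND\<close>

lemma indep_family_less:
  assumes "indep_family E (Suc e)" shows "indep_family E e"
  using assms unfolding indep_family_iff lessThan_Suc
  using vec.independent_mono[OF _ subset_insertI[of "E ` {..<e}" "E e"]] by auto

theorem theorem1p2:
  fixes X :: "(nat \<Rightarrow> 'k::{alg_closed_field, field_char_0}) set set"
    and d n e :: nat
  assumes "d \<ge> 2" and "e \<ge> 1"
    and "algebraic_set (n + e) X" and "has_dim (n + e) X n"
    and "condition_ND (n + e) e (defining_ideal (n + e) X) (int d - 1)"
    and "property_N (n + e) X d e"
  shows "CM_regular (n + e) X d \<and> arithmetically_CM (n + e) X \<and> linear_resolution (n + e) X d"
proof -
  define N where "N = n + e"
  define n1 where "n1 = Suc n"
  define I where "I = defining_ideal N X"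
  have n1: "n1 + e = Suc N" "0 < n1" "n1 \<le> Suc N" by (simp_all add: n1_def N_def)
  have X: "algebraic_set N X" using assms(3) by (simp add: N_def)
  have I: "is_ideal N I" "homogeneous_set I"
    by (simp_all add: I_def is_ideal_defining_ideal homogeneous_defining_ideal)
  have "for_general_subspace N e (no_sections_on N I (int d - 1))"
    using assms(5) unfolding condition_ND_def N_def[symmetric] I_def[symmetric] by (simp add: N_def)
  then obtain U where U: "open_in_grass N e U" "U \<noteq> {}" "\<forall>W\<in>U. no_sections_on N I (int d - 1) W"
    by (auto simp: for_general_subspace_def)
  then obtain S where S: "\<And>a. row_space N e a \<in> grass N e \<Longrightarrow>
      row_space N e a \<in> U \<longleftrightarrow> (\<exists>F\<in>S. mpoly_eval F a \<noteq> 0)" and Ug: "U \<subseteq> grass N e"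
    by (auto simp: open_in_grass_def)
  obtain W where W: "W \<in> U" "W \<in> grass N e" using U(2) Ug by blast
  obtain E0 where E0: "\<forall>i\<le>e. E0 i \<in> coords N" "indep_family E0 (Suc e)" "W = vec.span (E0 ` {..e})"
    using grass_family_exists[OF W(2)] by blast
  \<comment> \<open>The row space does not see the matrix entries after row \<open>e\<close>;
    repeating row \<open>e\<close> there gives the matrix the shape in which
    \<open>general_position\<close> varies the first \<open>e\<close> rows.\<close>
  define E1 where "E1 i = (if i < e then E0 i else E0 e)" for i
  have "E1 ` {..e} = E0 ` {..e}" by (rule image_cong) (auto simp: E1_def)
  then have "row_space N e (\<lambda>(i, j). E1 i j) = W"
    using row_space_family[of e E1 N] E0(1,3) by (simp add: E1_def)
  then obtain G where G: "G \<in> S" "mpoly_eval G (\<lambda>(i, j). E1 i j) \<noteq> 0"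
    using S[of "\<lambda>(i, j). E1 i j"] W by auto
  have "(\<lambda>(i, j). E1 i j) = (\<lambda>(i, j). if i < e then E0 i j else E0 e j)" by (auto simp: E1_def fun_eq_iff)
  then have G0: "mpoly_eval G (\<lambda>(i, j). if i < e then E0 i j else E0 e j) \<noteq> 0" using G(2) by simp
  have XH: "L \<subseteq> coords N" if "L \<in> X" for L
    using algebraic_set_proj_space[OF X] that by (auto simp: proj_space_def grass_def)
  have chain: "\<not> irreducible_chain N X (Suc n)"
    using assms(4) by (simp add: has_dim_def N_def)
  have dim: "dim_ge (coords N :: (nat \<Rightarrow> 'k) set) (e + Suc n)" using dim_ge_coords[of N] by (simp add: N_def add.commute)
  obtain E where E: "indep_family E e" "\<forall>i<e. E i \<in> coords N"
      "mpoly_eval G (\<lambda>(i, j). if i < e then E i j else E0 e j) \<noteq> 0"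
      "\<forall>L\<in>X. \<not> L \<subseteq> vec.span (E ` {..<e})"
    using general_position[OF X chain dim subspace_coords order_refl XH indep_family_less[OF E0(2)] _ G0] E0(1)
    by auto
  obtain b lam where "coordinates N b lam" and bE: "\<forall>i<e. b (n1 + i) = E i"
    using coordinates_exist[OF n1(1) E(1)] E(2) by blast
  then interpret co: coordinates N b lam by blast
  interpret fl: linear_flag N "\<lambda>k. lform N (lam k)" co.flag by (rule co.linear_flag)
  \<comment> \<open>A nonzero common zero would be a point of \<open>X\<close> whose first
    \<open>n1\<close> coordinates vanish, that is, a point of \<open>X\<close> in the span of
    \<open>E\<close>.\<close>
  have "\<exists>M. forms N (int M) \<subseteq> set_sum I (co.flag n1)"
  proof (rule projective_nullstellensatz)
    show "is_ideal N (set_sum I (co.flag n1))" by (intro is_ideal_set_sum I fl.A_ideal)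
    show "homogeneous_set (set_sum I (co.flag n1))" by (intro homogeneous_set_sum I fl.A_homogeneous)
    fix v assume v: "v \<in> coords N" and z: "\<And>p. p \<in> set_sum I (co.flag n1) \<Longrightarrow> mpoly_eval p v = 0"
    show "v = 0"
    proof (rule ccontr)
      assume v0: "v \<noteq> 0"
      have "vec.span {v} \<in> X"
        unfolding algebraic_set_iff_forms[OF X]
      proof (intro conjI allI ballI)
        show "vec.span {v} \<in> proj_space N" using v v0 proj_space_iff by blast
        fix s f assume f: "f \<in> vanishing_forms N X s"
        then have "f \<in> forms N s" "f \<in> I" by (auto simp: vanishing_forms_eq I_def)
        then show "vanishes_at f (vec.span {v})"
          using vanishes_at_span z set_sum_left[OF fl.A_ideal] by blast
      qed
      have "dotp N (lam k) v = 0" if "k < n1" for k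
      proof -
        have "lform N (lam k) \<in> co.flag n1"
          using fl.l_in_A[of k] fl.A_mono[of "Suc k" n1] that n1 by auto
        then show ?thesis using z[of "lform N (lam k)"] set_sum_right[OF I(1)] by auto
      qed
      then have "scale_vec (dotp N (lam i) v) (b i) \<in> vec.span (E ` {..<e})" if "i \<le> N" for i
      proof (cases "i < n1")
        case True
        then show ?thesis using \<open>\<And>k. k < n1 \<Longrightarrow> dotp N (lam k) v = 0\<close> vec.span_zero by (simp add: scale_vec_def zero_fun_def)
      next
        case False
        then have "b i = E (i - n1)" "i - n1 < e" using bE[rule_format, of "i - n1"] that n1(1) by auto
        then show ?thesis by (auto intro: vec.span_scale vec.span_base)
      qed
      then have "(\<Sum>i\<le>N. scale_vec (dotp N (lam i) v) (b i)) \<in> vec.span (E ` {..<e})"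
        by (intro vec.span_sum) simp
      then have "v \<in> vec.span (E ` {..<e})" using co.expand[OF v] by simp
      then have "vec.span {v} \<subseteq> vec.span (E ` {..<e})" by (intro vec.span_minimal vec.subspace_span) simp
      then show False using E(4) \<open>vec.span {v} \<in> X\<close> by blast
    qed
  qed
  then obtain M where M: "forms N (int M) \<subseteq> set_sum I (co.flag n1)" by blast
  \<comment> \<open>The same choice as in \<open>tor_dim\<close>, so that \<open>betti\<close>
    unfolds to the homology of this complex.\<close>
  define F where "F = (SOME F. graded_free_resolution N I F)"
  have F: "graded_free_resolution N I F"
    unfolding F_def by (rule someI_ex[OF graded_free_resolution_exists[OF I]])
  interpret res: resolution N "\<lambda>k. lform N (lam k)" co.flag I F
    by unfold_locales (use I F in auto)
  have betti: "betti N X (Suc i) j = 0 \<longleftrightarrow> res.homology_vanishes (Suc N) (Suc i) (int (Suc i) + j)" for i j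
    unfolding betti_def tor_dim_def Let_def I_def[symmetric] F_def[symmetric] by (rule res.tor_vanishes_iff)
  have strand: "betti N X i j = 0" if "i \<le> e" "j \<ge> int d" for i j
    using assms(6) that by (simp add: property_N_def N_def)
  have van_e: "res.homology_vanishes (Suc N) e s" if "s \<ge> int e + int d" for s
  proof -
    \<comment> \<open>\<open>betti\<close> has been related to homology for positive indices, and
      \<open>e\<close> is one of them.\<close>
    obtain e' where e': "e = Suc e'" using assms(2) by (cases e) auto
    have "betti N X e (s - int e) = 0" using that by (intro strand) auto
    then show ?thesis using betti[of e' "s - int e"] by (simp add: e')
  qed
  interpret fq: free_quotient N b lam I n1 d
  proof
    show "is_ideal N I" "homogeneous_set I" "n1 \<le> Suc N" using I n1 by blast+
    show "p \<in> set_sum I (co.flag n1)" if "p \<in> forms N s" "s \<ge> int d" for p s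
      using res.generation_bound[OF n1(1) _ van_e that(2,1), of M] M by blast
    show "f = 0" if f: "f \<in> low_tail N n1 d" "f \<in> forms N s" "co.sig f \<in> I" for f s
    proof (rule co.no_low_tail_in_ideal[OF n1(1,2) _ I(1) _ _ _ M f])
      show "1 \<le> d" using assms(1) by simp
      show "no_sections_on N I (int d - 1) (row_space N e a)"
        if "row_space N e a \<in> grass N e" "mpoly_eval G a \<noteq> 0" for a
        using S[OF that(1)] that(2) G(1) U(3) by blast
      show "E0 e \<in> coords N" using E0(1) by simp
      have "(\<lambda>(i, j). if i < e then b (n1 + i) j else E0 e j) = (\<lambda>(i, j). if i < e then E i j else E0 e j)"
        using bE by (auto simp: fun_eq_iff)
      then show "mpoly_eval G (\<lambda>(i, j). if i < e then b (n1 + i) j else E0 e j) \<noteq> 0" using E(3) by simp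
    qed
  qed
  have high: "betti N X i j = 0" if ei: "e < i" for i j
  proof -
    obtain i' where i': "i = Suc i'" using ei by (cases i) auto
    show ?thesis
      unfolding i' betti
      by (rule res.high_homology_vanishes[OF n1(1) fq.regular]) (use ei i' in auto)
  qed
  have low: "betti N X i j = 0" if i: "1 \<le> i" and j: "j < int d - 1" for i j
  proof -
    obtain i' where i': "i = Suc i'" using i by (cases i) auto
    show ?thesis
      unfolding i' betti
      by (rule res.low_homology_vanishes[OF fq.low_degree_zero]) (use j in auto)
  qed
  have CM: "CM_regular N X d"
    unfolding CM_regular_def using strand high by (metis not_le)
  moreover have "linear_resolution N X d"
    unfolding linear_resolution_def
  proof (intro allI impI)
    fix i :: nat and j :: int assume i: "1 \<le> i" and j: "j \<noteq> int d - 1"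
    show "betti N X i j = 0"
    proof (cases "j < int d - 1")
      case False
      then have "j \<ge> int d" using j by simp
      then show ?thesis using CM by (simp add: CM_regular_def)
    qed (use low i in simp)
  qed
  moreover have "arithmetically_CM N X"
    unfolding arithmetically_CM_def I_def[symmetric]
    using assms(1,4) fq.quotient_depth_eq by (intro exI[of _ n]) (simp add: N_def n1_def)
  ultimately show ?thesis by (simp add: N_def)
qed

end
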